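(* Write $r=\prod_{j=1}^n p_j^{t_j}$. If $q$ is fixed, then as $d_1,\dots,d_{r-1}\to\infty$, for any choice of $M_d \in \mathbb{Z}[\zeta_d]$ ($d\mid r$, $d\neq 1$), $$\frac{|\{F\in\hat{\mathcal{F}}_{[d_1,\dots,d_{r-1}]} : S_d(F_{(d)}) = M_d \text{ for all } d\mid r, d\not=1 \}|}{|\hat{\mathcal{F}}_{[d_1,\dots,d_{r-1}]}|} \sim \mathrm{Prob}\left(\sum_{i=1}^{q+1} X_{d,i} = M_d \text{ for all } d\mid r, d\not=1 \right)$$ where $X_{d,i}$ are random variables taking values in $\mu_d \cup \{0\}$ such that $$\mathrm{Prob}(X_{d,i}=0) = \frac{r-\frac{r}{d}}{q+r-1}, \qquad \mathrm{Prob}(X_{d,i} = \epsilon_{d,i}) = \frac{q+\frac{r}{d}-1} {d(q+r-1)} \text{ for each } \epsilon_{d,i}\in\mu_d.$$ Moreover, if $i\not=j$ then $X_{d,i}$ and $X_{d',j}$ are independent for all $d,d'\mid r$. However, for fixed $i$ and all $d\mid r$, $$X_{d,i} = \prod_{p\mid d} (X_{p^{v_p(d)},i})^{\sigma_p}, \text{ where } 1 \leq \sigma_p \leq \tfrac{d}{p^{v_p(d)}} \text{ with } \sigma_p \equiv (p^{v_p(d)})^{-1} \bmod{\tfrac{d}{p^{v_p(d)}}}.$$ Further, for all primes $p\mid r$ and $1 < s \leq v_p(r)$, $$\mathrm{Prob}\left(X_{p^s,i}=0 \mid X_{p^{s-1},i}=0\right)=1, \qquad \mathrm{Prob}\left(X_{p^{s-1},i}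 = \epsilon_{p^s,i}^p \mid X_{p^s,i} = \epsilon_{p^s,i} \right) = 1.$$ Finally, if $d\mid r$ but $d\not=r$ then $$\mathrm{Prob}\left(X_{p^s,i} = \epsilon_{p^s,i}\not=0 \text{ for } 1 \leq s \leq v_p(d), \text{ and } X_{p^s,i} =0 \text{ for } v_p(d)<s\leq v_p(r), \text{ for all } p\mid r\right) = \begin{cases}\frac{\phi(\frac{r}{d})}{d(q+r-1)} & \text{if } \epsilon_{p^{s-1},i} = \epsilon_{p^s,i}^p \text{ for all } p\mid r,\ 1\leq s \leq v_p(d), \\ 0 & \text{otherwise,} \end{cases}$$ and, if $d=r$, $$\mathrm{Prob}\left(X_{p^s,i} = \epsilon_{p^s,i} \text{ for } s \leq v_p(r), \text{ for all } p\mid r\right) = \begin{cases} \frac{q }{ r(q+r-1)} & \text{if } \epsilon_{p^{s-1},i} = \epsilon_{p^s,i}^p \text{ for } 1\leq s \leq v_p(r), \text{ for all } p\mid r, \\ 0 & \text{otherwise.} \end{cases}$$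
   Context: Let $q$ be a prime power and $r\ge 2$ an integer with $q\equiv 1 \pmod r$. For nonnegative integers $d_1,\dots,d_{r-1}$ let $\mathcal{F}_{(d_1,\dots,d_{r-1})}$ be the set of polynomials $F=f_1f_2^2\cdots f_{r-1}^{r-1}$ where $f_i\in\mathbb{F}_q[X]$ are monic, square-free, pairwise coprime with $\deg f_i=d_i$. Let $\hat{\mathcal{F}}_{(d_1,\dots,d_{r-1})}=\{\alpha F : F\in\mathcal{F}_{(d_1,\dots,d_{r-1})},\ \alpha\in\mathbb{F}_q^*\}$, let $\hat{\mathcal{F}}^j_{(d_1,\dots,d_{r-1})}=\hat{\mathcal{F}}_{(d_1,\dots,d_j-1,\dots,d_{r-1})}$, and let $\hat{\mathcal{F}}_{[d_1,\dots,d_{r-1}]}=\hat{\mathcal{F}}_{(d_1,\dots,d_{r-1})}\cup\bigcup_{j=1}^{r-1}\hat{\mathcal{F}}^j_{(d_1,\dots,d_{r-1})}$. For $F=\alpha f_1f_2^2\cdots f_{r-1}^{r-1}$ and $d\mid r$, put $F_{(d)}(X)=\alpha\prod_{i=1}^{r-1} f_i(X)^{i \bmod d}$. Let $\chi_d$ be a primitive character of order $d$ on $\mathbb{F}_q^*$ (extended by $\chi_d(0)=0$), and $S_d(F_{(d)})=\sum_{x\in\mathbb{P}^1(\mathbb{F}_q)}\chi_d(F_{(d)}(x))$, where at the point at infinity one sets $F_{(d)}(\infty)=\alpha$ if $F\in\hat{\mathcal{F}}^{jd}_{(d_1,\dots,d_{r-1})}$ for some $1\le j\le r/d-1$, and $F_{(d)}(\infty)=0$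 otherwise. Here $\mu_d$ denotes the $d$-th roots of unity, $\zeta_d$ a primitive $d$-th root of unity, $v_p$ the $p$-adic valuation, and $\phi$ Euler's totient function.
   Formalization: F_(d)(∞)=α also for F in F̂_{(d_1,…,d_{r-1})}; σ_p is the inverse of d/p^{v_p(d)} mod p^{v_p(d)}, 1≤σ_p≤p^{v_p(d)}; the characters satisfy χ_d=χ_r^{r/d}; the vectors (X_{d,i})_{d|r} are mutually independent over i, not only pairwise. *)

theory Defs
  imports
    "HOL-Probability.Probability"
    "HOL-Computational_Algebra.Computational_Algebra"
    "HOL-Number_Theory.Cong"
    "HOL-Number_Theory.Totient"
    "HOL-Library.Landau_Symbols"
begin

section \<open>The families of polynomials\<close>

text \<open>
  A finite field \<open>\<F>\<^sub>q\<close> is a type \<open>'a\<close> of class \<open>{field, finite}\<close>, with \<open>q = CARD('a)\<close>. Tuples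
  \<open>(f\<^sub>1, \<dots>, f\<^bsub>r-1\<^esub>)\<close> and \<open>(d\<^sub>1, \<dots>, d\<^bsub>r-1\<^esub>)\<close> are functions on \<open>nat\<close> of which only the values on
  \<open>{1..<r}\<close> matter.
\<close>

definition sqfree_tuple :: "nat \<Rightarrow> (nat \<Rightarrow> 'a::field poly) \<Rightarrow> bool" where
  "sqfree_tuple r f \<longleftrightarrow>
     (\<forall>i\<in>{1..<r}. lead_coeff (f i) = 1 \<and> squarefree (f i)) \<and>
     (\<forall>i\<in>{1..<r}. \<forall>j\<in>{1..<r}. i \<noteq> j \<longrightarrow> coprime (f i) (f j))"

definition F_set :: "nat \<Rightarrow> (nat \<Rightarrow> nat) \<Rightarrow> 'a::field poly set" where
  "F_set r ds = {F. \<exists>f. sqfree_tuple r f \<and> (\<forall>i\<in>{1..<r}. degree (f i) = ds i) \<and>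
                        F = (\<Prod>i=1..<r. f i ^ i)}"

definition F_hat :: "nat \<Rightarrow> (nat \<Rightarrow> nat) \<Rightarrow> 'a::field poly set" where
  "F_hat r ds = {smult \<alpha> F |\<alpha> F. \<alpha> \<noteq> 0 \<and> F \<in> F_set r ds}"

text \<open>The guard avoids truncated subtraction: there are no polynomials of degree \<open>-1\<close> here.\<close>

definition F_hat_minus :: "nat \<Rightarrow> (nat \<Rightarrow> nat) \<Rightarrow> nat \<Rightarrow> 'a::field poly set" where
  "F_hat_minus r ds j = (if ds j = 0 then {} else F_hat r (ds(j := ds j - 1)))"

definition F_hat_full :: "nat \<Rightarrow> (nat \<Rightarrow> nat) \<Rightarrow> 'a::field poly set" where
  "F_hat_full r ds = F_hat r ds \<union> (\<Union>j\<in>{1..<r}. F_hat_minus r ds j)"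

text \<open>
  \<open>F\<^bsub>(d)\<^esub>\<close>. The scalar \<open>\<alpha>\<close> and the polynomials \<open>f\<^sub>1, \<dots>, f\<^bsub>r-1\<^esub>\<close> are determined by \<open>F\<close>: \<open>\<alpha>\<close> is its
  leading coefficient and \<open>f\<^sub>i\<close> is the product of the monic irreducible factors of multiplicity \<open>i\<close>.
\<close>

definition F_red :: "nat \<Rightarrow> nat \<Rightarrow> 'a::field poly \<Rightarrow> 'a poly" where
  "F_red r d F = (THE G. \<exists>\<alpha> f. \<alpha> \<noteq> 0 \<and> sqfree_tuple r f \<and> F = smult \<alpha> (\<Prod>i=1..<r. f i ^ i) \<and>
                               G = smult \<alpha> (\<Prod>i=1..<r. f i ^ (i mod d)))"

text \<open>
  Values of \<open>F\<^bsub>(d)\<^esub>\<close> on \<open>\<P>\<^sup>1(\<F>\<^sub>q)\<close>, which is the type \<open>'a option\<close> with \<open>None\<close> as the point at infinity.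
  Relative to the degrees \<open>ds\<close>, an element of \<open>F_hat_minus r ds j\<close> is to be thought of as having
  the missing root of \<open>f\<^sub>j\<close> at infinity. So \<open>F\<^bsub>(d)\<^esub>\<close> vanishes at infinity precisely if that happens
  for some \<open>j\<close> not divisible by \<open>d\<close>; in particular it does not for \<open>F\<close> in \<open>F_hat r ds\<close>, where
  there is no missing root (the case \<open>j = 0\<close>).
\<close>

fun F_red_value :: "nat \<Rightarrow> (nat \<Rightarrow> nat) \<Rightarrow> nat \<Rightarrow> 'a::field poly \<Rightarrow> 'a option \<Rightarrow> 'a" where
  "F_red_value r ds d F (Some x) = poly (F_red r d F) x"
| "F_red_value r ds d F None =
     (if F \<in> F_hat r ds \<or> (\<exists>j. 1 \<le> j \<and> j \<le> r div d - 1 \<and> F \<in> F_hat_minus r ds (j * d))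
      then lead_coeff F else 0)"


section \<open>Characters and character sums\<close>

definition mult_character :: "('a::field \<Rightarrow> complex) \<Rightarrow> bool" where
  "mult_character \<psi> \<longleftrightarrow> \<psi> 0 = 0 \<and> \<psi> 1 = 1 \<and> (\<forall>x y. \<psi> (x * y) = \<psi> x * \<psi> y)"

definition char_order :: "('a::field \<Rightarrow> complex) \<Rightarrow> nat" where
  "char_order \<psi> = (LEAST k. k > 0 \<and> (\<forall>x. x \<noteq> 0 \<longrightarrow> \<psi> x ^ k = 1))"

text \<open>
  The characters \<open>\<chi>\<^sub>d\<close> have to be chosen compatibly, as powers of one character of order \<open>r\<close>. For
  instance, the relation between the limiting variables for \<open>p\<^bsup>s-1\<^esup>\<close> and \<open>p\<^sup>s\<close> reflects that the
  \<open>p\<close>-th power of the character of order \<open>p\<^sup>s\<close> is the one of order \<open>p\<^bsup>s-1\<^esup>\<close>.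
\<close>

definition character_system :: "nat \<Rightarrow> (nat \<Rightarrow> 'a::field \<Rightarrow> complex) \<Rightarrow> bool" where
  "character_system r chi \<longleftrightarrow>
     (\<forall>d. d dvd r \<longrightarrow> mult_character (chi d) \<and> char_order (chi d) = d \<and>
                     (\<forall>x. chi d x = chi r x ^ (r div d)))"

definition char_sum ::
    "nat \<Rightarrow> (nat \<Rightarrow> nat) \<Rightarrow> (nat \<Rightarrow> 'a::{field,finite} \<Rightarrow> complex) \<Rightarrow> nat \<Rightarrow> 'a poly \<Rightarrow> complex" where
  "char_sum r ds chi d F = (\<Sum>x\<in>(UNIV :: 'a option set). chi d (F_red_value r ds d F x))"

definition unity_roots :: "nat \<Rightarrow> complex set" where
  "unity_roots d = {z. z ^ d = 1}"

text \<open>The ring \<open>\<int>[\<zeta>\<^sub>d]\<close> inside the complex numbers; it does not depend on the choice of \<open>\<zeta>\<^sub>d\<close>.\<close>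

definition cyclotomic_ring :: "nat \<Rightarrow> complex set" where
  "cyclotomic_ring d = range (\<lambda>P :: int poly. poly (map_poly of_int P) (cis (2 * pi / real d)))"

text \<open>\<open>d\<^sub>1, \<dots>, d\<^bsub>r-1\<^esub> \<rightarrow> \<infinity>\<close>, with no relation between the rates.\<close>

definition degrees_at_top :: "nat \<Rightarrow> (nat \<Rightarrow> nat) filter" where
  "degrees_at_top r = (INF i\<in>{1..<r}. filtercomap (\<lambda>ds. ds i) at_top)"


section \<open>The limiting random variables\<close>

text \<open>
  \<open>X d i\<close> is \<open>X\<^bsub>d,i\<^esub>\<close>. A tuple \<open>\<epsilon>\<close> of prescribed values satisfies \<open>\<epsilon> d \<in> \<mu>\<^sub>d\<close>, so that \<open>\<epsilon> 1 = 1\<close>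
  and the condition \<open>\<epsilon> (p ^ (s - 1)) = \<epsilon> (p ^ s) ^ p\<close> is void for \<open>s = 1\<close>.

  Independence for different \<open>i\<close> means that the whole vectors \<open>(X d i)\<^sub>d\<close> are mutually independent
  for \<open>i = 1, \<dots>, q+1\<close>; independence of pairs alone would not determine the distribution of the
  sums over \<open>i\<close>.

  The exponents \<open>\<sigma>\<^sub>p\<close> satisfy \<open>\<Sum>\<^sub>p \<sigma>\<^sub>p * (d div p\<^bsup>v\<^esup>) \<equiv> 1 (mod d)\<close>, where \<open>v\<close> is the multiplicity of
  \<open>p\<close> in \<open>d\<close>. This corresponds to writing a character of order \<open>d\<close> as the product of the
  \<open>\<sigma>\<^sub>p\<close>-th powers of its powers of order \<open>p\<^bsup>v\<^esup>\<close>. It means that \<open>\<sigma>\<^sub>p\<close> is inverse to \<open>d div p\<^bsup>v\<^esup>\<close>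
  modulo \<open>p\<^bsup>v\<^esup>\<close>. (With the two moduli interchanged the product would lie in \<open>\<mu>\<^sub>3 \<union> {0}\<close> for \<open>d = 6\<close>,
  and could not take all values in \<open>\<mu>\<^sub>6\<close>.)
\<close>

locale limit_variables = prob_space P
  for q r :: nat and P :: "'b measure" and X :: "nat \<Rightarrow> nat \<Rightarrow> 'b \<Rightarrow> complex" +
  assumes random_variable_X:
    "\<And>d i. \<lbrakk>d dvd r; i \<in> {1..q+1}\<rbrakk> \<Longrightarrow> random_variable borel (X d i)"
  and values_X:
    "\<And>d i \<omega>. \<lbrakk>d dvd r; i \<in> {1..q+1}; \<omega> \<in> space P\<rbrakk> \<Longrightarrow> X d i \<omega> \<in> unity_roots d \<union> {0}"
  and prob_zero:
    "\<And>d i. \<lbrakk>d dvd r; i \<in> {1..q+1}\<rbrakk> \<Longrightarrow>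
       \<P>(\<omega> in P. X d i \<omega> = 0) = (real r - real r / real d) / (real q + real r - 1)"
  and prob_unity_root:
    "\<And>d i e. \<lbrakk>d dvd r; i \<in> {1..q+1}; e \<in> unity_roots d\<rbrakk> \<Longrightarrow>
       \<P>(\<omega> in P. X d i \<omega> = e) =
         (real q + real r / real d - 1) / (real d * (real q + real r - 1))"
  and indep_pairs:
    "\<And>d d' i j. \<lbrakk>d dvd r; d' dvd r; i \<in> {1..q+1}; j \<in> {1..q+1}; i \<noteq> j\<rbrakk> \<Longrightarrow>
       indep_var borel (X d i) borel (X d' j)"
  and indep_vectors:
    "indep_vars (\<lambda>_. PiM {d. d dvd r} (\<lambda>_. borel)) (\<lambda>i \<omega>. \<lambda>d\<in>{d. d dvd r}. X d i \<omega>) {1..q+1}"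
  and X_eq_prod:
    "\<And>d i \<sigma> \<omega>. \<lbrakk>d dvd r; i \<in> {1..q+1}; \<omega> \<in> space P;
        \<And>p. p \<in> prime_factors d \<Longrightarrow>
          1 \<le> \<sigma> p \<and> \<sigma> p \<le> p ^ multiplicity p d \<and>
          [\<sigma> p * (d div p ^ multiplicity p d) = 1] (mod p ^ multiplicity p d)\<rbrakk> \<Longrightarrow>
       X d i \<omega> = (\<Prod>p\<in>prime_factors d. X (p ^ multiplicity p d) i \<omega> ^ \<sigma> p)"
  and cond_prob_zero:
    "\<And>p s i. \<lbrakk>p \<in> prime_factors r; 1 < s; s \<le> multiplicity p r; i \<in> {1..q+1}\<rbrakk> \<Longrightarrow>
       \<P>(\<omega> in P. X (p ^ s) i \<omega> = 0 \<bar> X (p ^ (s - 1)) i \<omega> = 0) = 1"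
  and cond_prob_power:
    "\<And>p s i e. \<lbrakk>p \<in> prime_factors r; 1 < s; s \<le> multiplicity p r; i \<in> {1..q+1};
        e \<in> unity_roots (p ^ s)\<rbrakk> \<Longrightarrow>
       \<P>(\<omega> in P. X (p ^ (s - 1)) i \<omega> = e ^ p \<bar> X (p ^ s) i \<omega> = e) = 1"
  and joint_prob_proper:
    "\<And>d i \<epsilon>. \<lbrakk>d dvd r; d \<noteq> r; i \<in> {1..q+1}; \<And>k. k dvd r \<Longrightarrow> \<epsilon> k \<in> unity_roots k\<rbrakk> \<Longrightarrow>
       \<P>(\<omega> in P. \<forall>p\<in>prime_factors r.
            (\<forall>s\<in>{1..multiplicity p d}. X (p ^ s) i \<omega> = \<epsilon> (p ^ s) \<and> \<epsilon> (p ^ s) \<noteq> 0) \<and>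
            (\<forall>s\<in>{multiplicity p d<..multiplicity p r}. X (p ^ s) i \<omega> = 0)) =
         (if \<forall>p\<in>prime_factors r. \<forall>s\<in>{1..multiplicity p d}. \<epsilon> (p ^ (s - 1)) = \<epsilon> (p ^ s) ^ p
          then real (totient (r div d)) / (real d * (real q + real r - 1)) else 0)"
  and joint_prob_full:
    "\<And>i \<epsilon>. \<lbrakk>i \<in> {1..q+1}; \<And>k. k dvd r \<Longrightarrow> \<epsilon> k \<in> unity_roots k\<rbrakk> \<Longrightarrow>
       \<P>(\<omega> in P. \<forall>p\<in>prime_factors r. \<forall>s\<le>multiplicity p r. X (p ^ s) i \<omega> = \<epsilon> (p ^ s)) =
         (if \<forall>p\<in>prime_factors r. \<forall>s\<in>{1..multiplicity p r}. \<epsilon> (p ^ (s - 1)) = \<epsilon> (p ^ s) ^ p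
          then real q / (real r * (real q + real r - 1)) else 0)"

end

theory Submission
  imports Defs
begin

text \<open>
  A polynomial \<open>F = \<alpha> f\<^sub>1 f\<^sub>2\<^sup>2 \<cdots>\<close> is determined by \<open>\<alpha>\<close> and the tuple \<open>f\<close>, and a tuple of monic
  polynomials is admissible iff no square of an irreducible \<open>P\<close> divides \<open>\<Prod>f\<^sub>i\<close>. This is a condition
  modulo \<open>P\<^sup>2\<close> for each \<open>P\<close>, and so are the values of \<open>F\<close> at the points of \<open>\<F>\<^sub>q\<close>, with \<open>P = X - x\<close>.
  By the Chinese remainder theorem the conditions for \<open>deg P \<le> z\<close> are independent as soon as all
  degrees are large, while those with \<open>deg P > z\<close> fail for a proportion of at most \<open>r\<^sup>2 q\<^bsup>-z\<^esup>\<close> of all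
  tuples. Letting \<open>z \<rightarrow> \<infinity>\<close>, the behaviour of \<open>F\<close> at the different points of \<open>\<F>\<^sub>q\<close> becomes
  independent: the point is a root of \<open>f\<^sub>j\<close> with a weight that is \<open>1/q\<close> of the weight of being no root,
  and the unit part of the value is uniform. The point at infinity follows the same law, because
  lowering one degree by \<open>1\<close> divides the number of tuples by \<open>q\<close>.

  The joint probabilities prescribed for the limiting variables of prime power order, together with
  the product formula, force the law of each vector \<open>(X\<^bsub>d,i\<^esub>)\<^sub>d\<close>. Hence any such variables may be
  compared with the explicit model read off from this local behaviour.
\<close>

section \<open>Counting monic polynomials by residues\<close>

text \<open>The constants of the theorem come from counting local types. A type is a pair (j, u)
  with 0 <= j < r and a unit u, of weight 1 if j = 0 and 1/q otherwise, so the total weight is (q -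
  1)(q + r - 1)/q. At a point of this type the character of order d takes the value chi_d(u) if d
  divides j, and 0 otherwise. A prescribed pattern of prime power values with index d therefore says
  that gcd(j, r) = d and that chi_d(u) is a given root of unity. The first condition has phi(r/d)
  solutions 1 <= j < r if d differs from r, and only j = 0 if d = r; the second has (q - 1)/d
  solutions.

  The obstacle in the counting is that the degrees grow with no relation between their rates. The
  error from irreducibles of large degree must be bounded uniformly in all degrees, even where some
  degree is smaller than that of the divisor in question. The constants common to all types, an
  Euler product over nonlinear irreducibles and a density of units at each point, cancel in the
  ratio; only their positivity matters.\<close>

definition polys_below :: "nat \<Rightarrow> 'a::field poly set" where
  "polys_below D = {f. f = 0 \<or> degree f < D}"

definition monics :: "nat \<Rightarrow> 'a::field poly set" where
  "monics e = {f. lead_coeff f = 1 \<and> degree f = e}"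

definition monic_irreducibles :: "'a::field poly set" where
  "monic_irreducibles = {P. irreducible P \<and> lead_coeff P = 1}"

text \<open>Since \<open>f\<close> and \<open>g\<close> range over all functions, such a
  \<open>Q\<close> also ignores values outside \<open>I\<close>. It may therefore be tested on
  restrictions to \<open>I\<close> as well as on unrestricted tuples.\<close>

definition periodic :: "'i set \<Rightarrow> 'a::field poly \<Rightarrow> (('i \<Rightarrow> 'a poly) \<Rightarrow> bool) \<Rightarrow> bool" where
  "periodic I M Q \<longleftrightarrow> (\<forall>f g. (\<forall>i\<in>I. M dvd f i - g i) \<longrightarrow> Q f = Q g)"

text \<open>For nonzero \<open>M\<close>, \<open>polys_below (degree M)\<close> is a system of
  representatives of the residues modulo \<open>M\<close>, so for periodic \<open>Q\<close> this is
  the proportion of residue vectors satisfying \<open>Q\<close>.\<close>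

definition dens :: "'i set \<Rightarrow> 'a::{field,finite} poly \<Rightarrow> (('i \<Rightarrow> 'a poly) \<Rightarrow> bool) \<Rightarrow> real" where
  "dens I M Q = real (card {a \<in> PiE I (\<lambda>_. polys_below (degree M)). Q a}) /
     real CARD('a) ^ (degree M * card I)"

lemma periodicD:
  assumes "periodic I M Q" "\<And>i. i \<in> I \<Longrightarrow> M dvd f i - g i"
  shows "Q f = Q g"
  using assms by (auto simp: periodic_def)

lemma degree_lead_coeff_add_lower:
  fixes a b :: "'a::ab_group_add poly"
  assumes "a = 0 \<or> degree a < degree b"
  shows "degree (b + a) = degree b \<and> lead_coeff (b + a) = lead_coeff b"
proof (cases "a = 0")
  case False
  then have *: "degree a < degree b" using assms by simp
  then have "degree (b + a) = degree b" by (rule degree_add_eq_left)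
  moreover have "coeff a (degree b) = 0" using * by (rule coeff_eq_0)
  ultimately show ?thesis by simp
qed simp

lemma card_polys_below [simp]:
  "card (polys_below D :: 'a::{field,finite} poly set) = CARD('a) ^ D"
proof (induction D)
  case 0
  have "polys_below 0 = {0 :: 'a poly}" by (auto simp: polys_below_def)
  then show ?case by simp
next
  case (Suc D)
  have "polys_below (Suc D) = (\<lambda>(a, g). pCons a g) ` (UNIV \<times> polys_below D :: ('a \<times> 'a poly) set)"
  proof (intro equalityI subsetI)
    fix f :: "'a poly" assume "f \<in> polys_below (Suc D)"
    then show "f \<in> (\<lambda>(a, g). pCons a g) ` (UNIV \<times> polys_below D)"
      by (cases f) (force simp: polys_below_def split: if_splits)
  qed (auto simp: polys_below_def split: if_splits)
  moreover have "inj_on (\<lambda>(a, g). pCons a g) (UNIV \<times> polys_below D :: ('a \<times> 'a poly) set)"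
    by (auto simp: inj_on_def)
  ultimately show ?case
    using Suc by (simp add: card_image card_cartesian_product)
qed

text \<open>An infinite set has cardinality 0, whereas the count just obtained is positive.\<close>

lemma finite_polys_below [simp]: "finite (polys_below D :: 'a::{field,finite} poly set)"
  by (rule card_ge_0_finite) (simp add: zero_less_card_finite)

lemma monics_eq_image: "monics e = (\<lambda>g. monom 1 e + g) ` polys_below e"
proof (intro equalityI subsetI)
  fix f :: "'a poly" assume f: "f \<in> monics e"
  have "f - monom 1 e \<in> polys_below e"
  proof (cases "e = 0")
    case True
    with f have "f = 1" by (auto simp: monics_def elim!: degree_eq_zeroE)
    with True show ?thesis by (simp add: polys_below_def monom_0 one_pCons)
  next
    case False
    have "degree (f - monom 1 e) \<le> e"
      using f by (auto simp: monics_def degree_monom_eq intro!: degree_diff_le)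
    moreover have "coeff (f - monom 1 e) e = 0" using f by (auto simp: monics_def)
    ultimately show ?thesis
      using False leading_coeff_0_iff[of "f - monom 1 e"]
      unfolding polys_below_def by (cases "degree (f - monom 1 e) = e") auto
  qed
  then show "f \<in> (\<lambda>g. monom 1 e + g) ` polys_below e"
    by (intro image_eqI[of _ _ "f - monom 1 e"]) auto
next
  fix f :: "'a poly" assume "f \<in> (\<lambda>g. monom 1 e + g) ` polys_below e"
  then obtain g where g: "g \<in> polys_below e" "f = monom 1 e + g" by auto
  show "f \<in> monics e"
  proof (cases "g = 0")
    case False
    with g have *: "degree g < degree (monom (1::'a) e)" by (simp add: polys_below_def degree_monom_eq)
    then have "degree f = e" using g by (simp add: degree_add_eq_left degree_monom_eq)
    moreover have "coeff g e = 0" using * by (simp add: degree_monom_eq coeff_eq_0)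
    ultimately show ?thesis using g by (simp add: monics_def)
  qed (use g in \<open>simp add: monics_def degree_monom_eq\<close>)
qed

lemma card_monics [simp]: "card (monics e :: 'a::{field,finite} poly set) = CARD('a) ^ e"
  by (simp add: monics_eq_image card_image inj_on_def)

lemma finite_monics [simp]: "finite (monics e :: 'a::{field,finite} poly set)"
  by (simp add: monics_eq_image)

lemma monics_nonzero: "f \<in> monics e \<Longrightarrow> f \<noteq> 0"
  by (auto simp: monics_def)

section \<open>Residues modulo a monic polynomial\<close>

lemma mod_in_polys_below: "M \<noteq> 0 \<Longrightarrow> f mod M \<in> polys_below (degree M)"
  for M :: "'a::field poly"
  using degree_mod_less[of M f] by (auto simp: polys_below_def)

lemma polys_below_mod: "a \<in> polys_below (degree M) \<Longrightarrow> a mod M = a"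
  by (auto simp: polys_below_def mod_poly_less)

lemma polys_below_cong:
  assumes "a \<in> polys_below (degree M)" "b \<in> polys_below (degree M)" "M dvd a - b"
  shows "a = b"
proof -
  have "a mod M = b mod M" using assms(3) by (simp add: mod_eq_dvd_iff)
  then show ?thesis using assms by (simp add: polys_below_mod)
qed

lemma monics_divmod:
  assumes M: "lead_coeff M = 1" and f: "f \<in> monics e" and e: "degree M \<le> e"
  shows "f div M \<in> monics (e - degree M)"
proof -
  have M0: "M \<noteq> 0" using M by auto
  have f0: "f \<noteq> 0" using f monics_nonzero by auto
  have dm: "f mod M \<in> polys_below (degree M)" using M0 by (rule mod_in_polys_below)
  have eq: "f = f div M * M + f mod M" by simp
  have nz: "f div M \<noteq> 0"
  proof
    assume z: "f div M = 0"
    then have "f = f mod M" using eq by simp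
    then have "f \<in> polys_below (degree M)" using dm by simp
    then show False using f0 f e by (auto simp: polys_below_def monics_def)
  qed
  have "degree (f div M * M) = degree (f div M) + degree M" using nz M0 by (simp add: degree_mult_eq)
  moreover have "f mod M = 0 \<or> degree (f mod M) < degree (f div M * M)"
    using dm calculation by (auto simp: polys_below_def)
  ultimately have "degree (f div M * M + f mod M) = degree (f div M) + degree M \<and>
      lead_coeff (f div M * M + f mod M) = lead_coeff (f div M * M)"
    using degree_lead_coeff_add_lower[of "f mod M" "f div M * M"] by metis
  then have "degree f = degree (f div M) + degree M \<and> lead_coeff f = lead_coeff (f div M) * lead_coeff M"
    unfolding div_mult_mod_eq lead_coeff_mult .
  moreover have "lead_coeff f = 1" "degree f = e" using f by (auto simp: monics_def)
  ultimately show ?thesis using M by (auto simp: monics_def)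
qed

lemma monics_mult_add:
  assumes M: "lead_coeff M = 1" and h: "h \<in> monics k" and a: "a \<in> polys_below (degree M)"
  shows "M * h + a \<in> monics (degree M + k)"
proof -
  have nz: "M \<noteq> 0" "h \<noteq> 0" using assms monics_nonzero by auto
  have d: "degree (M * h) = degree M + k" using h nz by (simp add: degree_mult_eq monics_def)
  have l: "lead_coeff (M * h) = 1" using h M by (auto simp: lead_coeff_mult monics_def)
  show ?thesis
  proof (cases "a = 0")
    case False
    then have "degree a < degree (M * h)" using a d by (auto simp: polys_below_def)
    then have "degree (M * h + a) = degree (M * h) \<and> lead_coeff (M * h + a) = lead_coeff (M * h)"
      by (intro degree_lead_coeff_add_lower) simp
    then show ?thesis unfolding monics_def mem_Collect_eq using d l by metis
  qed (use d l in \<open>auto simp: monics_def\<close>)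
qed

text \<open>Division with remainder by \<open>M\<close> in each component is a bijection from tuples
  to pairs of a tuple of quotients and a tuple of residues. \<open>Q\<close> restricts the residues
  alone, and the quotients run through all monic polynomials of degree
  \<open>e i - degree M\<close>. The count is exact as soon as every degree reaches that of
  \<open>M\<close>.\<close>

lemma card_monics_periodic:
  fixes M :: "'a::{field,finite} poly"
  assumes M: "lead_coeff M = 1" and I: "finite I" and e: "\<And>i. i \<in> I \<Longrightarrow> degree M \<le> e i"
    and per: "periodic I M Q"
  shows "card {f \<in> PiE I (\<lambda>i. monics (e i)). Q f} =
    card {a \<in> PiE I (\<lambda>_. polys_below (degree M)). Q a} * CARD('a) ^ (\<Sum>i\<in>I. e i - degree M)"
proof -
  have M0: "M \<noteq> 0" using M by auto
  let ?H = "PiE I (\<lambda>i. monics (e i - degree M)) :: (_ \<Rightarrow> 'a poly) set" and ?A = "{a \<in> PiE I (\<lambda>_. polys_below (degree M)) :: (_ \<Rightarrow> 'a poly) set. Q a}"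
  let ?F = "{f \<in> PiE I (\<lambda>i. monics (e i)). Q f}"
  let ?to = "\<lambda>(h, a). \<lambda>i\<in>I. M * h i + a i"
  let ?from = "\<lambda>f. (\<lambda>i\<in>I. f i div M, \<lambda>i\<in>I. f i mod M)"
  have "bij_betw ?to (?H \<times> ?A) ?F"
  proof (rule bij_betw_byWitness[where f' = "?from"])
    have *: "(M * h + a) div M = h \<and> (M * h + a) mod M = a" if "a \<in> polys_below (degree M)" for h a :: "'a poly"
      using that M0 by (auto simp: polys_below_def add.commute[of "M * h"] div_poly_less mod_poly_less)
    show "\<forall>x\<in>?H \<times> ?A. ?from (?to x) = x"
    proof (rule ballI)
      fix x assume "x \<in> ?H \<times> ?A"
      then obtain h a where x: "x = (h, a)" and h: "h \<in> ?H" and a: "a \<in> ?A" by blast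
      have "(\<lambda>i\<in>I. (\<lambda>i\<in>I. M * h i + a i) i div M) = h"
        using h a by (intro ext) (auto simp: restrict_def * PiE_iff extensional_def)
      moreover have "(\<lambda>i\<in>I. (\<lambda>i\<in>I. M * h i + a i) i mod M) = a"
        using h a by (intro ext) (auto simp: restrict_def * polys_below_mod PiE_iff extensional_def)
      ultimately show "?from (?to x) = x"
        by (simp only: x prod.case)
    qed
    show "\<forall>f\<in>?F. ?to (\<lambda>i\<in>I. f i div M, \<lambda>i\<in>I. f i mod M) = f"
      by (auto simp: restrict_def PiE_iff extensional_def fun_eq_iff)
    have F: "(\<lambda>i\<in>I. M * h i + a i) \<in> ?F" if h: "h \<in> ?H" and a: "a \<in> ?A" for h a
    proof -
      have "M * h i + a i \<in> monics (e i)" if "i \<in> I" for i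
        using monics_mult_add[OF M, of "h i" "e i - degree M" "a i"] h a e[OF that] that
        by (auto simp: PiE_iff)
      moreover have "Q (\<lambda>i\<in>I. M * h i + a i) = Q a"
        by (rule periodicD[OF per]) auto
      ultimately show ?thesis using a by (auto simp: PiE_iff)
    qed
    show "?to ` (?H \<times> ?A) \<subseteq> ?F"
    proof (rule image_subsetI)
      fix x assume "x \<in> ?H \<times> ?A"
      then obtain h a where x: "x = (h, a)" and h: "h \<in> ?H" and a: "a \<in> ?A" by blast
      show "?to x \<in> ?F" using F[OF h a] by (simp only: x prod.case)
    qed
    have "((\<lambda>i\<in>I. f i div M, \<lambda>i\<in>I. f i mod M)) \<in> ?H \<times> ?A" if f: "f \<in> ?F" for f
    proof -
      have "Q (\<lambda>i\<in>I. f i mod M) = Q f"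
        by (rule periodicD[OF per]) (auto simp: mod_eq_dvd_iff[symmetric])
      then show ?thesis using f e by (auto simp: PiE_iff monics_divmod[OF M] mod_in_polys_below[OF M0])
    qed
    then show "?from ` ?F \<subseteq> ?H \<times> ?A" by blast
  qed
  then have "card ?F = card (?H \<times> ?A)" by (simp add: bij_betw_same_card)
  then show ?thesis using I by (simp add: card_cartesian_product card_PiE power_sum)
qed

lemma card_monics_dens:
  fixes M :: "'a::{field,finite} poly"
  assumes "lead_coeff M = 1" and "finite I" and "\<And>i. i \<in> I \<Longrightarrow> degree M \<le> e i"
    and "periodic I M Q"
  shows "real (card {f \<in> PiE I (\<lambda>i. monics (e i)). Q f}) = dens I M Q * real CARD('a) ^ (\<Sum>i\<in>I. e i)"
proof -
  have "(\<Sum>i\<in>I. e i) = degree M * card I + (\<Sum>i\<in>I. e i - degree M)"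
  proof -
    have "(\<Sum>i\<in>I. e i) = (\<Sum>i\<in>I. degree M + (e i - degree M))"
      using assms(3) by (intro sum.cong) auto
    then show ?thesis by (simp add: sum.distrib mult.commute)
  qed
  then show ?thesis
    by (simp add: card_monics_periodic[OF assms] dens_def power_add)
qed

text \<open>Chinese remainder theorem, with coprimality of the moduli stated as \<open>cop\<close>.
  Reduction modulo both factors is injective by \<open>cop\<close>, and both sides have equally many
  elements, so it is bijective.\<close>

lemma dens_mult:
  fixes M1 M2 :: "'a::{field,finite} poly" and I :: "'i set"
  assumes M1: "lead_coeff M1 = 1" and M2: "lead_coeff M2 = 1" and I: "finite I"
    and cop: "\<And>h. M1 dvd h \<Longrightarrow> M2 dvd h \<Longrightarrow> M1 * M2 dvd h"
    and per: "periodic I M1 Q1" "periodic I M2 Q2"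
  shows "dens I (M1 * M2) (\<lambda>f. Q1 f \<and> Q2 f) = dens I M1 Q1 * dens I M2 Q2"
proof -
  have nz: "M1 \<noteq> 0" "M2 \<noteq> 0" using M1 M2 by auto
  have deg: "degree (M1 * M2) = degree M1 + degree M2" using nz by (simp add: degree_mult_eq)
  let ?B = "\<lambda>M::'a poly. PiE I (\<lambda>_. polys_below (degree M)) :: ('i \<Rightarrow> 'a poly) set"
  let ?\<Phi> = "\<lambda>f::'i \<Rightarrow> 'a poly. (\<lambda>i\<in>I. f i mod M1, \<lambda>i\<in>I. f i mod M2)"
  have inj: "inj_on ?\<Phi> (?B (M1 * M2))"
  proof (rule inj_onI)
    fix f g :: "_ \<Rightarrow> 'a poly" assume f: "f \<in> ?B (M1 * M2)" and g: "g \<in> ?B (M1 * M2)" and eq: "?\<Phi> f = ?\<Phi> g"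
    show "f = g"
    proof (rule PiE_ext[OF f g])
      fix i assume i: "i \<in> I"
      from eq i have "f i mod M1 = g i mod M1" "f i mod M2 = g i mod M2"
        by (metis (no_types, lifting) Pair_inject restrict_apply')+
      then have "M1 * M2 dvd f i - g i" by (auto intro!: cop simp: mod_eq_dvd_iff)
      then show "f i = g i" using f g i by (auto intro!: polys_below_cong[of _ "M1 * M2"] simp: PiE_iff)
    qed
  qed
  have sub: "?\<Phi> ` ?B (M1 * M2) \<subseteq> ?B M1 \<times> ?B M2"
    using nz by (auto simp: mod_in_polys_below)
  have "?\<Phi> ` ?B (M1 * M2) = ?B M1 \<times> ?B M2"
  proof (rule card_subset_eq[OF _ sub])
    show "finite (?B M1 \<times> ?B M2)" using I by (intro finite_cartesian_product finite_PiE) auto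
    show "card (?\<Phi> ` ?B (M1 * M2)) = card (?B M1 \<times> ?B M2)"
      using I by (subst card_image[OF inj]) (simp add: card_cartesian_product card_PiE deg power_add power_mult_distrib)
  qed
  note img = this
  have Q1: "Q1 (\<lambda>i\<in>I. f i mod M1) = Q1 f" for f
    by (rule periodicD[OF per(1)]) (simp add: mod_eq_dvd_iff[symmetric])
  have Q2: "Q2 (\<lambda>i\<in>I. f i mod M2) = Q2 f" for f
    by (rule periodicD[OF per(2)]) (simp add: mod_eq_dvd_iff[symmetric])
  have "?\<Phi> ` {f \<in> ?B (M1 * M2). Q1 f \<and> Q2 f} = {a \<in> ?B M1. Q1 a} \<times> {a \<in> ?B M2. Q2 a}"
  proof (intro equalityI subsetI)
    fix x assume "x \<in> ?\<Phi> ` {f \<in> ?B (M1 * M2). Q1 f \<and> Q2 f}"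
    then obtain f where f: "f \<in> ?B (M1 * M2)" "Q1 f" "Q2 f" and x: "x = ?\<Phi> f" by blast
    have "?\<Phi> f \<in> ?B M1 \<times> ?B M2" using sub f(1) by (rule subsetD[OF _ imageI])
    moreover have "Q1 (\<lambda>i\<in>I. f i mod M1)" "Q2 (\<lambda>i\<in>I. f i mod M2)" using f unfolding Q1 Q2 by -
    ultimately show "x \<in> {a \<in> ?B M1. Q1 a} \<times> {a \<in> ?B M2. Q2 a}"
      unfolding x by blast
  next
    fix x assume x: "x \<in> {a \<in> ?B M1. Q1 a} \<times> {a \<in> ?B M2. Q2 a}"
    then have "x \<in> ?\<Phi> ` ?B (M1 * M2)" unfolding img by auto
    then obtain f where f: "f \<in> ?B (M1 * M2)" "x = ?\<Phi> f" by blast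
    from x f(2) have "Q1 (\<lambda>i\<in>I. f i mod M1)" "Q2 (\<lambda>i\<in>I. f i mod M2)" by blast+
    then have "Q1 f" "Q2 f" unfolding Q1 Q2 by -
    with f show "x \<in> ?\<Phi> ` {f \<in> ?B (M1 * M2). Q1 f \<and> Q2 f}" by blast
  qed
  then have "card {f \<in> ?B (M1 * M2). Q1 f \<and> Q2 f} = card {a \<in> ?B M1. Q1 a} * card {a \<in> ?B M2. Q2 a}"
    using card_image[OF inj_on_subset[OF inj], of "{f \<in> ?B (M1 * M2). Q1 f \<and> Q2 f}"]
    by (simp add: card_cartesian_product)
  then show ?thesis by (simp add: dens_def deg power_add algebra_simps)
qed

section \<open>A sieve for square-free products\<close>

lemma monic_irreducible_prime_elem: "P \<in> monic_irreducibles \<Longrightarrow> prime_elem P"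
  by (simp add: monic_irreducibles_def field_poly_irreducible_imp_prime)

lemma monic_irreducible_degree: "P \<in> monic_irreducibles \<Longrightarrow> degree P > 0"
  by (auto simp: monic_irreducibles_def irreducible_def is_unit_iff_degree)

lemma monic_irreducible_nonzero: "P \<in> monic_irreducibles \<Longrightarrow> P \<noteq> 0"
  by (auto simp: monic_irreducibles_def)

lemma monic_irreducible_dvd_eq:
  assumes "P \<in> monic_irreducibles" "R \<in> monic_irreducibles" "P dvd R"
  shows "P = R"
proof -
  obtain c where c: "R = P * c" using assms(3) by (elim dvdE)
  have "\<not> is_unit P" using assms(1) by (simp add: monic_irreducibles_def irreducible_def)
  then have "is_unit c" using assms(2) c by (auto simp: monic_irreducibles_def dest: irreducibleD)
  then obtain k where k: "c = [:k:]" by (elim is_unit_polyE) auto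
  have "lead_coeff R = lead_coeff P * k" by (simp add: c k lead_coeff_mult)
  then have "k = 1" using assms(1,2) by (simp add: monic_irreducibles_def)
  then show ?thesis using c k by simp
qed

lemma linear_monic_irreducible: "[:- x, 1:] \<in> monic_irreducibles"
  by (simp add: monic_irreducibles_def irreducible_linear_field_poly)

lemma monic_irreducible_linear:
  assumes "P \<in> monic_irreducibles" "degree P \<le> 1"
  shows "P \<in> range (\<lambda>x. [:- x, 1:])"
proof -
  have "degree P = 1" using monic_irreducible_degree[OF assms(1)] assms(2) by simp
  then obtain a b where P: "P = [:a, b:]" by (elim degree1_coeffs)
  with assms \<open>degree P = 1\<close> have "P = [:- (- a), 1:]" by (auto simp: monic_irreducibles_def split: if_splits)
  then show ?thesis by blast
qed

lemma exists_monic_irreducible_dvd: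
  fixes f :: "'a::field poly"
  assumes "degree f > 0"
  shows "\<exists>P\<in>monic_irreducibles. P dvd f"
  using assms
proof (induction "degree f" arbitrary: f rule: less_induct)
  case less
  have f0: "f \<noteq> 0" using less.prems by auto
  show ?case
  proof (cases "irreducible f")
    case True
    let ?P = "smult (inverse (lead_coeff f)) f"
    have "irreducible ?P"
      using True f0 irreducible_mult_unit_left[of "[:inverse (lead_coeff f):]" f]
      by (simp add: is_unit_pCons_iff)
    then have "?P \<in> monic_irreducibles" using f0 by (simp add: monic_irreducibles_def)
    moreover have "?P dvd f" using f0 by (simp add: smult_dvd)
    ultimately show ?thesis by blast
  next
    case False
    then obtain a b where ab: "f = a * b" "\<not> is_unit a" "\<not> is_unit b"
      using f0 less.prems by (auto simp: irreducible_def is_unit_iff_degree)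
    then have "a \<noteq> 0" "b \<noteq> 0" using f0 by auto
    then have "degree a > 0" "degree a < degree f"
      using ab by (auto simp: is_unit_iff_degree degree_mult_eq)
    then obtain P where "P \<in> monic_irreducibles" "P dvd a" using less.hyps by blast
    then show ?thesis using ab by (metis dvd_mult2)
  qed
qed

text \<open>Primality is used twice: \<open>P\<close> divides \<open>b\<close>, and after cancelling
  one \<open>P\<close> it divides the cofactor as well. This stands in for the coprimality of
  \<open>P\<^sup>2\<close> and \<open>a\<close>.\<close>

lemma prime_elem_square_dvd_mult:
  fixes a b :: "'a::field poly"
  assumes P: "prime_elem P" and na: "\<not> P dvd a" and d: "P\<^sup>2 dvd a * b"
  shows "P\<^sup>2 dvd b"
proof -
  have P0: "P \<noteq> 0" using P by auto
  have "P dvd a * b" using d by (metis dvd_mult_left power2_eq_square)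
  then obtain b' where b': "b = P * b'" using P na by (metis prime_elem_dvd_mult_iff dvdE)
  have "P * P dvd P * (a * b')" using d b' by (simp add: power2_eq_square mult.left_commute)
  then have "P dvd a * b'" using P0 by (auto simp only: dvd_mult_cancel_left)
  then have "P dvd b'" using P na by (simp add: prime_elem_dvd_mult_iff)
  then show ?thesis using b' by (simp add: power2_eq_square mult_dvd_mono)
qed

lemma prime_elem_dvd_prod:
  assumes "prime_elem P" "finite S" "P dvd (\<Prod>i\<in>S. g i)"
  shows "\<exists>i\<in>S. P dvd g i"
  using assms(2,3)
proof (induction S rule: finite_induct)
  case empty
  then show ?case using assms(1) by (simp add: prime_elem_def)
next
  case (insert x F)
  then show ?case using assms(1) by (auto simp: prime_elem_dvd_mult_iff)
qed

lemma finite_monic_irreducibles_le: "finite {P :: 'a::{field,finite} poly. P \<in> monic_irreducibles \<and> degree P \<le> z}"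
  by (rule finite_subset[of _ "\<Union>k\<le>z. monics k"]) (auto simp: monic_irreducibles_def, auto simp: monics_def)

section \<open>Independence of the conditions at different irreducibles\<close>

lemma dens_True:
  assumes "finite I" shows "dens I (M :: 'a::{field,finite} poly) (\<lambda>_. True) = 1"
  using assms by (simp add: dens_def card_PiE power_mult)

lemma dens_nonneg: "dens I M Q \<ge> 0" by (simp add: dens_def)

lemma dens_Not:
  fixes M :: "'a::{field,finite} poly"
  assumes "finite I" shows "dens I M (\<lambda>f. \<not> Q f) = 1 - dens I M Q"
proof -
  let ?T = "PiE I (\<lambda>_. polys_below (degree M)) :: (_ \<Rightarrow> 'a poly) set"
  have fin: "finite ?T" using assms by (intro finite_PiE) auto
  have "card ?T = card ({a \<in> ?T. Q a} \<union> {a \<in> ?T. \<not> Q a})" by (rule arg_cong[of _ _ card]) auto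
  also have "\<dots> = card {a \<in> ?T. Q a} + card {a \<in> ?T. \<not> Q a}"
    using fin by (intro card_Un_disjoint) auto
  finally have "dens I M (\<lambda>_. True) = dens I M Q + dens I M (\<lambda>f. \<not> Q f)"
    by (simp add: dens_def add_divide_distrib)
  then show ?thesis using dens_True[OF assms, of M] by simp
qed

lemma periodic_conj_finite:
  assumes "\<And>P. P \<in> S \<Longrightarrow> periodic I (N P) (Q P)" "\<And>P. P \<in> S \<Longrightarrow> N P dvd M"
  shows "periodic I M (\<lambda>f. \<forall>P\<in>S. Q P f)"
  using assms unfolding periodic_def by (meson dvd_trans)

text \<open>Induction on \<open>S\<close> by the Chinese remainder theorem: distinct monic
  irreducibles do not divide each other, so \<open>P\<close> does not divide the product of the
  squares of the others.\<close>

lemma dens_prod: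
  fixes S :: "'a::{field,finite} poly set"
  assumes I: "finite I" and S: "finite S" "S \<subseteq> monic_irreducibles"
    and per: "\<And>P. P \<in> S \<Longrightarrow> periodic I (P\<^sup>2) (Q P)"
  shows "dens I (\<Prod>P\<in>S. P\<^sup>2) (\<lambda>f. \<forall>P\<in>S. Q P f) = (\<Prod>P\<in>S. dens I (P\<^sup>2) (Q P))"
  using S per
proof (induction S rule: finite_induct)
  case empty
  then show ?case using I by (simp add: dens_True)
next
  case (insert P S)
  have P: "P \<in> monic_irreducibles" and pP: "prime_elem P"
    using insert.prems monic_irreducible_prime_elem by auto
  let ?M = "\<Prod>P\<in>S. P\<^sup>2"
  have nd: "\<not> P dvd ?M"
  proof
    assume "P dvd ?M"
    then obtain R where R: "R \<in> S" "P dvd R\<^sup>2"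
      using prime_elem_dvd_prod[OF pP insert.hyps(1)] by blast
    then have "P dvd R" using pP prime_elem_dvd_power by blast
    then show False using R insert.prems(1) insert.hyps(2) monic_irreducible_dvd_eq P by blast
  qed
  have "dens I (P\<^sup>2 * ?M) (\<lambda>f. Q P f \<and> (\<forall>P\<in>S. Q P f)) =
      dens I (P\<^sup>2) (Q P) * dens I ?M (\<lambda>f. \<forall>P\<in>S. Q P f)"
  proof (rule dens_mult[OF _ _ I])
    show "lead_coeff (P\<^sup>2) = 1" using P by (simp add: lead_coeff_power monic_irreducibles_def)
    show "lead_coeff ?M = 1"
      using insert.prems(1) by (auto simp: lead_coeff_prod lead_coeff_power monic_irreducibles_def subset_iff intro!: prod.neutral)
    show "periodic I (P\<^sup>2) (Q P)" using insert.prems by simp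
    show "periodic I ?M (\<lambda>f. \<forall>P\<in>S. Q P f)"
      using insert.prems insert.hyps by (intro periodic_conj_finite[where N = "\<lambda>P. P\<^sup>2"]) (auto intro: dvd_prodI)
    fix h assume h: "P\<^sup>2 dvd h" "?M dvd h"
    from h(2) obtain h' where h': "h = ?M * h'" by (elim dvdE)
    then have "P\<^sup>2 dvd h'" using h(1) prime_elem_square_dvd_mult[OF pP nd, of h'] by simp
    then show "P\<^sup>2 * ?M dvd h" using h' by (simp add: mult.commute mult_dvd_mono)
  qed
  then show ?case using insert by simp
qed

section \<open>Tuples whose product has a given square factor\<close>

text \<open>The multiples of \<open>M\<close> correspond to the monic cofactors if
  \<open>degree M \<le> e\<close>, and there are none otherwise. Covering both ranges by one bound
  is what makes the later error estimate uniform in the degrees.\<close>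

lemma card_monics_dvd:
  fixes M :: "'a::{field,finite} poly"
  assumes M: "lead_coeff M = 1"
  shows "real (card {f \<in> monics e. M dvd f}) \<le> real CARD('a) ^ e / real CARD('a) ^ degree M"
proof (cases "degree M \<le> e")
  case True
  have M0: "M \<noteq> 0" using M by auto
  have "{f \<in> monics e. M dvd f} \<subseteq> (\<lambda>h. M * h) ` monics (e - degree M)"
  proof
    fix f assume "f \<in> {f \<in> monics e. M dvd f}"
    then obtain h where f: "f \<in> monics e" "f = M * h" by blast
    moreover have "f div M \<in> monics (e - degree M)" using monics_divmod[OF M f(1) True] .
    ultimately show "f \<in> (\<lambda>h. M * h) ` monics (e - degree M)" using M0 by auto
  qed
  then have "card {f \<in> monics e. M dvd f} \<le> card (monics (e - degree M) :: 'a poly set)"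
    by (rule surj_card_le[rotated]) simp
  then have "real (card {f \<in> monics e. M dvd f}) \<le> real (CARD('a) ^ (e - degree M))"
    by (simp only: card_monics of_nat_le_iff)
  also have "\<dots> = real CARD('a) ^ e / real CARD('a) ^ degree M" using True by (simp only: of_nat_power) (simp add: power_diff)
  finally show ?thesis .
next
  case False
  have "\<not> M dvd f" if "f \<in> monics e" for f
    using False that monics_nonzero[OF that] dvd_imp_degree_le[of M f] by (auto simp: monics_def)
  then have "{f \<in> monics e. M dvd f} = {}" by blast
  then show ?thesis by (simp only: card.empty) simp
qed

text \<open>One pattern of divisors covers two cases: for \<open>i = j\<close> it says that
  \<open>P\<^sup>2\<close> divides \<open>f i\<close>, otherwise that \<open>P\<close> divides both
  \<open>f i\<close> and \<open>f j\<close>. In each case the degrees of the prescribed divisors add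
  up to \<open>2 * degree P\<close>.\<close>

lemma square_dvd_prod_cases:
  fixes f :: "'i \<Rightarrow> 'a::field poly"
  assumes P: "prime_elem P" and I: "finite I" and d: "P\<^sup>2 dvd (\<Prod>i\<in>I. f i)"
  shows "\<exists>i\<in>I. \<exists>j\<in>I. \<forall>k\<in>I. (if k = i then P else 1) * (if k = j then P else 1) dvd f k"
proof -
  have "P dvd (\<Prod>i\<in>I. f i)" using d by (metis dvd_mult_left power2_eq_square)
  then obtain i where i: "i \<in> I" "P dvd f i" using prime_elem_dvd_prod[OF P I] by blast
  have eq: "(\<Prod>i\<in>I. f i) = (\<Prod>j\<in>I-{i}. f j) * f i" using I i by (simp add: prod.remove mult.commute)
  show ?thesis
  proof (cases "P dvd (\<Prod>j\<in>I-{i}. f j)")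
    case True
    then obtain j where j: "j \<in> I - {i}" "P dvd f j" using prime_elem_dvd_prod[OF P, of "I - {i}"] I by blast
    have "j \<noteq> i" using j(1) by blast
    then have D: "(if k = i then P else 1) * (if k = j then P else 1) dvd f k" for k
      using i(2) j(2) by (cases "k = i"; cases "k = j") (simp_all only: if_True if_False mult_1_left mult_1_right one_dvd simp_thms)
    show ?thesis
      by (rule bexI[of _ i], rule bexI[of _ j], rule ballI, rule D) (use i(1) j(1) in blast)+
  next
    case False
    have "P\<^sup>2 dvd f i" using d unfolding eq by (rule prime_elem_square_dvd_mult[OF P False])
    then have D: "(if k = i then P else 1) * (if k = i then P else 1) dvd f k" for k
      by (cases "k = i") (simp_all only: if_True if_False mult_1_left one_dvd power2_eq_square simp_thms)
    show ?thesis
      by (rule bexI[of _ i], rule bexI[of _ i], rule ballI, rule D) (use i(1) in blast)+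
  qed
qed

text \<open>Union bound over the \<open>(card I)\<^sup>2\<close> pairs \<open>(i, j)\<close>: each
  pattern of divisors has total degree \<open>2 * degree P\<close> and so costs the factor
  \<open>CARD('a) ^ (2 * degree P)\<close>. No lower bound on the degrees \<open>e i\<close>
  enters.\<close>

lemma card_square_dvd_prod:
  fixes P :: "'a::{field,finite} poly"
  assumes P: "P \<in> monic_irreducibles" and I: "finite I"
  shows "real (card {f \<in> PiE I (\<lambda>i. monics (e i)). P\<^sup>2 dvd (\<Prod>i\<in>I. f i)}) \<le>
    real CARD('a) ^ (\<Sum>i\<in>I. e i) * ((real (card I))\<^sup>2 / real CARD('a) ^ (2 * degree P))"
proof -
  let ?q = "real CARD('a)"
  let ?D = "\<lambda>(i, j) k. (if k = i then P else 1) * (if k = j then P else 1)"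
  define T where "T = (\<lambda>ij. PiE I (\<lambda>k. {f \<in> monics (e k). ?D ij k dvd f}))"
  define B where "B = {f \<in> PiE I (\<lambda>i. monics (e i)). P\<^sup>2 dvd (\<Prod>i\<in>I. f i)}"
  have P0: "P \<noteq> 0" using monic_irreducible_nonzero[OF P] .
  have deg: "(\<Sum>k\<in>I. degree (?D (i, j) k)) = 2 * degree P" if "i \<in> I" "j \<in> I" for i j
  proof -
    have "degree (?D (i, j) k) = (if k = i then degree P else 0) + (if k = j then degree P else 0)" for k
      using P0 by (simp add: degree_mult_eq)
    then show ?thesis using that I by (simp add: sum.distrib)
  qed
  have T_le: "real (card (T (i, j))) \<le> ?q ^ (\<Sum>i\<in>I. e i) / ?q ^ (2 * degree P)" if ij: "i \<in> I" "j \<in> I" for i j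
  proof -
    have "real (card (T (i, j))) = (\<Prod>k\<in>I. real (card {f \<in> monics (e k). ?D (i, j) k dvd f}))"
      using I by (simp add: T_def card_PiE)
    also have "\<dots> \<le> (\<Prod>k\<in>I. ?q ^ e k / ?q ^ degree (?D (i, j) k))"
      using P by (intro prod_mono conjI card_monics_dvd) (auto simp: monic_irreducibles_def lead_coeff_mult)
    also have "\<dots> = ?q ^ (\<Sum>i\<in>I. e i) / ?q ^ (2 * degree P)"
      using deg[OF ij] by (simp add: prod_dividef power_sum[symmetric])
    finally show ?thesis .
  qed
  have finT: "finite (T ij)" for ij
    unfolding T_def using I by (intro finite_PiE finite_subset[OF Collect_subset finite_monics])
  have "B \<subseteq> (\<Union>ij\<in>I \<times> I. T ij)"
  proof
    fix f assume f: "f \<in> B"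
    then have "P\<^sup>2 dvd (\<Prod>i\<in>I. f i)" unfolding B_def by blast
    from square_dvd_prod_cases[OF monic_irreducible_prime_elem[OF P] I this]
    obtain i j where ij: "i \<in> I" "j \<in> I" "\<forall>k\<in>I. ?D (i, j) k dvd f k"
      unfolding prod.case by blast
    have "f \<in> T (i, j)" using f ij(3) unfolding T_def B_def PiE_iff mem_Collect_eq by blast
    then show "f \<in> (\<Union>ij\<in>I \<times> I. T ij)" using ij(1,2) by blast
  qed
  then have "card B \<le> card (\<Union>ij\<in>I \<times> I. T ij)"
    by (rule card_mono[OF finite_UN_I[OF finite_cartesian_product[OF I I] finT]])
  also have "\<dots> \<le> (\<Sum>ij\<in>I \<times> I. card (T ij))" by (rule card_UN_le[OF finite_cartesian_product[OF I I]])
  finally have "real (card B) \<le> (\<Sum>ij\<in>I \<times> I. real (card (T ij)))"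
    by (simp flip: of_nat_sum)
  also have "\<dots> \<le> (\<Sum>ij\<in>I \<times> I. ?q ^ (\<Sum>i\<in>I. e i) / ?q ^ (2 * degree P))"
    using T_le by (intro sum_mono) auto
  finally show ?thesis unfolding B_def by (simp add: card_cartesian_product power2_eq_square mult_ac)
qed

text \<open>There are at most q^k monic polynomials of degree k, each contributing q^(-2k). What
  remains is the tail of a geometric series of ratio at most 1/2.\<close>

lemma sum_monic_irreducibles_le:
  fixes S :: "'a::{field,finite} poly set"
  assumes S: "finite S" "S \<subseteq> monic_irreducibles" "\<And>P. P \<in> S \<Longrightarrow> degree P > z"
  shows "(\<Sum>P\<in>S. 1 / real CARD('a) ^ (2 * degree P)) \<le> 1 / real CARD('a) ^ z"
proof -
  let ?q = "real CARD('a)"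
  have "card {0, 1 :: 'a} \<le> CARD('a)" by (rule card_mono) auto
  then have q: "?q \<ge> 2" by simp
  obtain m where m: "\<And>P. P \<in> S \<Longrightarrow> degree P \<le> m"
    using S(1) by (meson finite_nat_set_iff_bounded_le finite_imageI imageI)
  \<comment> \<open>The subtracted term strengthens the claim so that induction works: passing to
    \<open>Suc m\<close> adds 1/q^(m+1), and 2/q^(m+1) <= 1/q^m because q >= 2.\<close>
  have geo: "(\<Sum>k\<in>{z<..m}. 1 / ?q ^ k) \<le> 1 / ?q ^ z - (if z \<le> m then 1 / ?q ^ m else 0)" for m
  proof (induction m)
    case 0
    then show ?case by (cases "z = 0") auto
  next
    case (Suc m)
    consider "Suc m < z" | "Suc m = z" | "z \<le> m" by linarith
    then show ?case
    proof cases
      case 3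
      then have "{z<..Suc m} = insert (Suc m) {z<..m}" by auto
      then have "(\<Sum>k\<in>{z<..Suc m}. 1 / ?q ^ k) = 1 / ?q ^ Suc m + (\<Sum>k\<in>{z<..m}. 1 / ?q ^ k)" by simp
      also have "\<dots> \<le> 1 / ?q ^ Suc m + (1 / ?q ^ z - 1 / ?q ^ m)" using Suc 3 by simp
      also have "2 / ?q ^ Suc m \<le> 1 / ?q ^ m" using q by (simp add: field_simps)
      then have "1 / ?q ^ Suc m + (1 / ?q ^ z - 1 / ?q ^ m) \<le> 1 / ?q ^ z - 1 / ?q ^ Suc m"
        by (simp add: add_divide_distrib)
      finally show ?thesis using 3 by simp
    qed auto
  qed
  have "(\<Sum>P\<in>S. 1 / ?q ^ (2 * degree P)) = (\<Sum>k\<in>{z<..m}. \<Sum>P\<in>{P \<in> S. degree P = k}. 1 / ?q ^ (2 * degree P))"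
    using S m by (intro sum.group[symmetric]) auto
  also have "\<dots> \<le> (\<Sum>k\<in>{z<..m}. 1 / ?q ^ k)"
  proof (rule sum_mono)
    fix k
    have "card {P \<in> S. degree P = k} \<le> card (monics k :: 'a poly set)"
      using S(2) by (intro card_mono finite_monics) (auto simp: monics_def monic_irreducibles_def)
    then have "real (card {P \<in> S. degree P = k}) \<le> real (CARD('a) ^ k)"
      by (simp only: card_monics of_nat_le_iff)
    then have "real (card {P \<in> S. degree P = k}) * (1 / ?q ^ (2 * k)) \<le> ?q ^ k * (1 / ?q ^ (2 * k))"
      by (intro mult_right_mono) auto
    also have "\<dots> = 1 / ?q ^ k" by (simp add: mult_2 power_add)
    finally show "(\<Sum>P\<in>{P \<in> S. degree P = k}. 1 / ?q ^ (2 * degree P)) \<le> 1 / ?q ^ k" by simp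
  qed
  also have "\<dots> \<le> 1 / ?q ^ z" by (rule order_trans[OF geo]) simp
  finally show ?thesis .
qed


section \<open>The Euler product over nonlinear irreducibles\<close>

text \<open>A single condition on the product covers both square-freeness of each component and
  coprimality of any two; see \<open>sqfree_tuple_iff\<close>.\<close>

definition sqfree_at :: "'i set \<Rightarrow> 'a::field poly \<Rightarrow> ('i \<Rightarrow> 'a poly) \<Rightarrow> bool" where
  "sqfree_at I P f \<longleftrightarrow> \<not> P\<^sup>2 dvd (\<Prod>i\<in>I. f i)"

lemma dvd_prod_diff:
  fixes f g :: "'i \<Rightarrow> 'a::comm_ring_1"
  assumes "\<And>i. i \<in> I \<Longrightarrow> M dvd f i - g i"
  shows "M dvd (\<Prod>i\<in>I. f i) - (\<Prod>i\<in>I. g i)"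
  using assms
proof (induction I rule: infinite_finite_induct)
  case (insert x F)
  have "(\<Prod>i\<in>insert x F. f i) - (\<Prod>i\<in>insert x F. g i) =
      (f x - g x) * (\<Prod>i\<in>F. f i) + g x * ((\<Prod>i\<in>F. f i) - (\<Prod>i\<in>F. g i))"
    using insert.hyps by (simp add: algebra_simps)
  then show ?case using insert by (metis dvd_add dvd_mult dvd_mult2 insertI1 insertI2)
qed auto

lemma periodic_sqfree_at: "periodic I (P\<^sup>2) (sqfree_at I P)"
  unfolding periodic_def sqfree_at_def
  using dvd_prod_diff[of I "P\<^sup>2"] by (metis dvd_diff_commute dvd_diffD1 dvd_diff_left_iff)

lemma periodic_Not: "periodic I M Q \<Longrightarrow> periodic I M (\<lambda>f. \<not> Q f)"
  by (simp add: periodic_def)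

lemma monic_square: "P \<in> monic_irreducibles \<Longrightarrow> lead_coeff (P\<^sup>2) = 1"
  by (simp add: lead_coeff_power monic_irreducibles_def)

text \<open>The density is realised exactly by tuples all of whose degrees equal
  \<open>degree (P\<^sup>2)\<close>, so the union bound for actual tuples applies to it.\<close>

lemma dens_not_sqfree_at_le:
  fixes P :: "'a::{field,finite} poly"
  assumes P: "P \<in> monic_irreducibles" and I: "finite I"
  shows "1 - dens I (P\<^sup>2) (sqfree_at I P) \<le> (real (card I))\<^sup>2 / real CARD('a) ^ (2 * degree P)"
proof -
  let ?e = "\<lambda>_. degree (P\<^sup>2)"
  define X where "X = real CARD('a) ^ (\<Sum>i\<in>I. ?e i)"
  define C where "C = (real (card I))\<^sup>2 / real CARD('a) ^ (2 * degree P)"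
  have "X > 0" unfolding X_def by simp
  have "dens I (P\<^sup>2) (\<lambda>f. \<not> sqfree_at I P f) * X =
      real (card {f \<in> PiE I (\<lambda>i. monics (?e i)). \<not> sqfree_at I P f})"
    unfolding X_def
    by (rule card_monics_dens[symmetric]) (auto intro: monic_square P I periodic_Not periodic_sqfree_at)
  also have "\<dots> \<le> X * C"
    unfolding X_def C_def sqfree_at_def not_not by (rule card_square_dvd_prod[OF P I])
  finally have "dens I (P\<^sup>2) (\<lambda>f. \<not> sqfree_at I P f) * X \<le> C * X" by (simp only: mult.commute)
  then have "dens I (P\<^sup>2) (\<lambda>f. \<not> sqfree_at I P f) \<le> C"
    using \<open>X > 0\<close> by (rule mult_right_le_imp_le)
  then show ?thesis unfolding C_def dens_Not[OF I] .
qed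

text \<open>The constant tuple 1 is square-free at \<open>P\<close>. Positivity of each factor,
  together with the tail estimate, keeps the Euler product away from 0.\<close>

lemma dens_sqfree_at_pos:
  fixes P :: "'a::{field,finite} poly"
  assumes P: "P \<in> monic_irreducibles" and I: "finite I"
  shows "dens I (P\<^sup>2) (sqfree_at I P) > 0"
proof -
  have d: "degree (P\<^sup>2) > 0" using monic_irreducible_degree[OF P] monic_irreducible_nonzero[OF P]
    by (simp add: degree_power_eq)
  then have "\<not> P\<^sup>2 dvd 1" by (metis is_unit_iff_degree degree_0 less_irrefl)
  then have "(\<lambda>i\<in>I. 1) \<in> {a \<in> PiE I (\<lambda>_. polys_below (degree (P\<^sup>2))). sqfree_at I P a}"
    using d by (auto simp: sqfree_at_def polys_below_def)
  moreover have "finite {a \<in> PiE I (\<lambda>_. polys_below (degree (P\<^sup>2))). sqfree_at I P a}"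
    by (rule finite_subset[OF Collect_subset finite_PiE[OF I]]) simp
  ultimately have "card {a \<in> PiE I (\<lambda>_. polys_below (degree (P\<^sup>2))). sqfree_at I P a} > 0"
    by (metis card_gt_0_iff empty_iff)
  then show ?thesis by (simp add: dens_def)
qed

lemma dens_sqfree_at_le_1:
  fixes P :: "'a::{field,finite} poly"
  assumes "finite I"
  shows "dens I (P\<^sup>2) (sqfree_at I P) \<le> 1"
  using dens_Not[OF assms, of "P\<^sup>2" "sqfree_at I P"] dens_nonneg[of I "P\<^sup>2" "\<lambda>f. \<not> sqfree_at I P f"] by simp

text \<open>The linear irreducibles are kept apart: there the condition is refined by a prescribed
  local type, whose density is computed explicitly.\<close>

definition nonlinear_upto :: "nat \<Rightarrow> 'a::field poly set" where
  "nonlinear_upto z = {P \<in> monic_irreducibles. 1 < degree P \<and> degree P \<le> z}"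

text \<open>The \<open>itself\<close> argument fixes the field, which the other arguments do not
  determine.\<close>

definition sieve_partial :: "'a::{field,finite} itself \<Rightarrow> 'i set \<Rightarrow> nat \<Rightarrow> real" where
  "sieve_partial _ I z = (\<Prod>P\<in>(nonlinear_upto z :: 'a poly set). dens I (P\<^sup>2) (sqfree_at I P))"

definition sieve_const :: "'a::{field,finite} itself \<Rightarrow> 'i set \<Rightarrow> real" where
  "sieve_const T I = lim (sieve_partial T I)"

lemma finite_nonlinear_upto: "finite (nonlinear_upto z :: 'a::{field,finite} poly set)"
  by (rule finite_subset[OF _ finite_monic_irreducibles_le[of z]]) (auto simp: nonlinear_upto_def)

lemma card_field_ge_2: "CARD('a::{field,finite}) \<ge> 2"
proof -
  have "card {0, 1 :: 'a} \<le> CARD('a)" by (rule card_mono) auto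
  then show ?thesis by simp
qed

lemma inverse_power_card_eventually_small:
  assumes "c > 0"
  shows "eventually (\<lambda>z. C / real CARD('a::{field,finite}) ^ z < c) sequentially"
proof -
  have "(\<lambda>z. C * (1 / real CARD('a)) ^ z) \<longlonglongrightarrow> C * 0"
    using card_field_ge_2[where 'a='a] by (intro tendsto_mult tendsto_const LIMSEQ_power_zero) simp
  then show ?thesis using order_tendstoD(2)[of "\<lambda>z. C * (1 / real CARD('a)) ^ z" 0 sequentially c] assms
    by (simp add: power_one_over)
qed

text \<open>Going from \<open>z0\<close> to \<open>z\<close> multiplies by factors in [0, 1].
  Writing them as 1 minus a defect, the Weierstrass product inequality bounds their product below by
  1 minus the sum of the defects, and that sum is the tail of
  \<open>sum_monic_irreducibles_le\<close>.\<close>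

lemma sieve_partial_mono:
  assumes I: "finite I" and "z0 \<le> z"
  shows "sieve_partial TYPE('a::{field,finite}) I z \<le> sieve_partial TYPE('a) I z0 \<and>
    sieve_partial TYPE('a) I z0 * (1 - (real (card I))\<^sup>2 / real CARD('a) ^ z0) \<le> sieve_partial TYPE('a) I z"
proof -
  let ?a = "\<lambda>P::'a poly. dens I (P\<^sup>2) (sqfree_at I P)"
  let ?N = "nonlinear_upto z0 :: 'a poly set" and ?N' = "nonlinear_upto z - nonlinear_upto z0 :: 'a poly set"
  have sub: "?N \<subseteq> nonlinear_upto z" using assms(2) by (auto simp: nonlinear_upto_def)
  have a01: "0 \<le> ?a P \<and> ?a P \<le> 1" for P using dens_nonneg dens_sqfree_at_le_1[OF I] by blast
  have split: "sieve_partial TYPE('a) I z = (\<Prod>P\<in>?N'. ?a P) * sieve_partial TYPE('a) I z0"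
    unfolding sieve_partial_def by (rule prod.subset_diff[OF sub finite_nonlinear_upto])
  have p0: "sieve_partial TYPE('a) I z0 \<ge> 0" unfolding sieve_partial_def using a01 by (intro prod_nonneg) auto
  have le1: "(\<Prod>P\<in>?N'. ?a P) \<le> 1" using a01 by (intro prod_le_1) auto
  have "(\<Sum>P\<in>?N'. 1 - ?a P) \<le> (\<Sum>P\<in>?N'. (real (card I))\<^sup>2 * (1 / real CARD('a) ^ (2 * degree P)))"
    using dens_not_sqfree_at_le[OF _ I] by (intro sum_mono) (auto simp: nonlinear_upto_def)
  also have "\<dots> = (real (card I))\<^sup>2 * (\<Sum>P\<in>?N'. 1 / real CARD('a) ^ (2 * degree P))"
    by (simp add: sum_distrib_left)
  also have "\<dots> \<le> (real (card I))\<^sup>2 * (1 / real CARD('a) ^ z0)"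
    by (intro mult_left_mono sum_monic_irreducibles_le) (auto simp: finite_nonlinear_upto, auto simp: nonlinear_upto_def)
  finally have "1 - (real (card I))\<^sup>2 / real CARD('a) ^ z0 \<le> 1 - (\<Sum>P\<in>?N'. 1 - ?a P)" by simp
  also have "\<dots> \<le> (\<Prod>P\<in>?N'. 1 - (1 - ?a P))"
    using a01 by (intro Weierstrass_prod_ineq) auto
  finally have ge: "1 - (real (card I))\<^sup>2 / real CARD('a) ^ z0 \<le> (\<Prod>P\<in>?N'. ?a P)" by simp
  show ?thesis unfolding split
    using mult_right_mono[OF le1 p0] mult_right_mono[OF ge p0] by (simp add: mult.commute)
qed

text \<open>The partial products decrease and are positive, hence converge. For a positive limit,
  \<open>z0\<close> is chosen with relative tail loss below 1/2; all later partial products then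
  stay above half of the one at \<open>z0\<close>.\<close>

lemma sieve_partial_LIMSEQ:
  fixes I :: "'i set"
  assumes I: "finite I"
  shows "sieve_partial TYPE('a::{field,finite}) I \<longlonglongrightarrow> sieve_const TYPE('a) I"
    and "sieve_const TYPE('a) I > 0"
proof -
  let ?A = "sieve_partial TYPE('a) I"
  have pos: "?A z > 0" for z
    unfolding sieve_partial_def using dens_sqfree_at_pos[OF _ I] by (intro prod_pos) (auto simp: nonlinear_upto_def)
  have "decseq ?A" using sieve_partial_mono[OF I] by (auto simp: decseq_def)
  then obtain L where L: "?A \<longlonglongrightarrow> L"
    using pos by (metis decseq_convergent less_imp_le)
  then show lim: "?A \<longlonglongrightarrow> sieve_const TYPE('a) I" unfolding sieve_const_def by (simp add: limI)
  have "eventually (\<lambda>z. (real (card I))\<^sup>2 / real CARD('a) ^ z < 1/2) sequentially"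
    by (rule inverse_power_card_eventually_small) simp
  then obtain z0 where z0: "(real (card I))\<^sup>2 / real CARD('a) ^ z0 < 1/2"
    by (auto simp: eventually_sequentially)
  have "?A z \<ge> ?A z0 * (1/2)" if "z \<ge> z0" for z
    using sieve_partial_mono[OF I that, where 'a='a]
      mult_left_mono[of "1/2" "1 - (real (card I))\<^sup>2 / real CARD('a) ^ z0" "?A z0"] z0 pos[of z0]
    by linarith
  then have "?A z0 * (1/2) \<le> sieve_const TYPE('a) I"
    by (intro tendsto_lowerbound[OF lim]) (auto simp: eventually_sequentially)
  then show "sieve_const TYPE('a) I > 0" using pos[of z0] by linarith
qed

text \<open>The order of the choices matters: \<open>z\<close> depends on \<epsilon> only, the
  modulus \<open>M\<close> on \<open>z\<close>, and the degrees need only reach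
  \<open>degree M\<close>. Beyond that the main term is exact and the error, relative to the number
  of all tuples, is at most \<open>(card I)\<^sup>2\<close> times q^(-z) whatever the degrees are,
  which is why they may grow independently.\<close>

theorem sieve_asymptotic:
  fixes Q :: "'a::{field,finite} poly \<Rightarrow> ('i \<Rightarrow> 'a poly) \<Rightarrow> bool"
  assumes I: "finite I"
    and per: "\<And>P. P \<in> monic_irreducibles \<Longrightarrow> periodic I (P\<^sup>2) (Q P)"
    and sqf: "\<And>P f. P \<in> monic_irreducibles \<Longrightarrow> Q P f \<Longrightarrow> sqfree_at I P f"
    and nonlinear: "\<And>P f. P \<in> monic_irreducibles \<Longrightarrow> degree P > 1 \<Longrightarrow> Q P f = sqfree_at I P f"
  shows "((\<lambda>e. real (card {f \<in> PiE I (\<lambda>i. monics (e i)). \<forall>P\<in>monic_irreducibles. Q P f}) /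
      real CARD('a) ^ (\<Sum>i\<in>I. e i)) \<longlongrightarrow>
      sieve_const TYPE('a) I * (\<Prod>x\<in>UNIV. dens I ([:- x, 1:]\<^sup>2) (Q [:- x, 1:])))
    (INF i\<in>I. filtercomap (\<lambda>e. e i) at_top)"
proof (rule tendstoI)
  let ?F = "INF i\<in>I. filtercomap (\<lambda>e::'i \<Rightarrow> nat. e i) at_top"
  let ?A = "sieve_partial TYPE('a) I" and ?K = "sieve_const TYPE('a) I" and ?q = "real CARD('a)"
  define D where "D = (\<Prod>x\<in>UNIV. dens I ([:- x, 1:]\<^sup>2) (Q [:- x, 1:]))"
  define N where "N e = {f \<in> PiE I (\<lambda>i. monics (e i)). \<forall>P\<in>monic_irreducibles. Q P f}" for e
  fix \<epsilon> :: real assume eps: "\<epsilon> > 0"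
  have "(\<lambda>z. ?A z * D) \<longlonglongrightarrow> ?K * D"
    using sieve_partial_LIMSEQ(1)[OF I] by (intro tendsto_mult tendsto_const)
  then have ev1: "eventually (\<lambda>z. dist (?A z * D) (?K * D) < \<epsilon> / 2) sequentially"
    using eps by (intro tendstoD) auto
  have ev2: "eventually (\<lambda>z. (real (card I))\<^sup>2 / ?q ^ z < \<epsilon> / 2) sequentially"
    using eps by (intro inverse_power_card_eventually_small) auto
  from eventually_conj[OF ev1 eventually_conj[OF ev2 eventually_ge_at_top[of 1]]]
  obtain z where z: "dist (?A z * D) (?K * D) < \<epsilon> / 2" "(real (card I))\<^sup>2 / ?q ^ z < \<epsilon> / 2" "z \<ge> 1"
    by (auto simp: eventually_sequentially)
  define S where "S = {P :: 'a poly. P \<in> monic_irreducibles \<and> degree P \<le> z}"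
  define M where "M = (\<Prod>P\<in>S. P\<^sup>2)"
  have finS: "finite S" unfolding S_def by (rule finite_monic_irreducibles_le)
  \<comment> \<open>Since \<open>z \<ge> 1\<close>, all linear irreducibles lie in \<open>S\<close>.
    Those outside \<open>S\<close> are then nonlinear, where \<open>Q P\<close> is plain
    square-freeness.\<close>
  have lin: "S = range (\<lambda>x. [:- x, 1:]) \<union> nonlinear_upto z"
  proof (intro equalityI subsetI)
    fix P assume "P \<in> S"
    then show "P \<in> range (\<lambda>x. [:- x, 1:]) \<union> nonlinear_upto z"
      using monic_irreducible_linear[of P] by (cases "degree P \<le> 1") (auto simp: S_def nonlinear_upto_def)
  qed (use z(3) in \<open>auto simp: S_def nonlinear_upto_def linear_monic_irreducible\<close>)
  have "(\<Prod>P\<in>S. dens I (P\<^sup>2) (Q P)) =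
      (\<Prod>P\<in>range (\<lambda>x. [:- x, 1:]). dens I (P\<^sup>2) (Q P)) * (\<Prod>P\<in>nonlinear_upto z. dens I (P\<^sup>2) (Q P))"
    unfolding lin by (rule prod.union_disjoint) (auto simp: finite_nonlinear_upto, auto simp: nonlinear_upto_def)
  also have "(\<Prod>P\<in>range (\<lambda>x. [:- x, 1:]). dens I (P\<^sup>2) (Q P)) = D"
    unfolding D_def by (subst prod.reindex) (auto simp: inj_on_def o_def)
  also have "(\<Prod>P\<in>nonlinear_upto z. dens I (P\<^sup>2) (Q P)) = ?A z"
    unfolding sieve_partial_def
  proof (rule prod.cong)
    fix P :: "'a poly" assume "P \<in> nonlinear_upto z"
    then have "Q P = sqfree_at I P" using nonlinear by (auto simp: nonlinear_upto_def fun_eq_iff)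
    then show "dens I (P\<^sup>2) (Q P) = dens I (P\<^sup>2) (sqfree_at I P)" by simp
  qed simp
  finally have dens: "dens I M (\<lambda>f. \<forall>P\<in>S. Q P f) = ?A z * D"
    unfolding M_def using dens_prod[OF I finS, of Q] per by (simp add: S_def subset_iff mult.commute)
  have main: "dist (real (card (N e)) / ?q ^ (\<Sum>i\<in>I. e i)) (?K * D) < \<epsilon>"
    if e: "\<And>i. i \<in> I \<Longrightarrow> degree M \<le> e i" for e
  proof -
    let ?s = "\<Sum>i\<in>I. e i"
    define NS where "NS = {f \<in> PiE I (\<lambda>i. monics (e i)). \<forall>P\<in>S. Q P f}"
    \<comment> \<open>A square dividing a product of degree \<open>?s\<close> comes from an
      irreducible of degree at most \<open>?s\<close>, so the union bound runs over a finite
      set.\<close>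
    define R where "R = {P :: 'a poly. P \<in> monic_irreducibles \<and> z < degree P \<and> degree P \<le> ?s}"
    define B where "B P = {f \<in> PiE I (\<lambda>i. monics (e i)). P\<^sup>2 dvd (\<Prod>i\<in>I. f i)}" for P :: "'a poly"
    have finT: "finite (PiE I (\<lambda>i. monics (e i)) :: ('i \<Rightarrow> 'a poly) set)" using I by (intro finite_PiE) auto
    have finR: "finite R" unfolding R_def by (rule finite_subset[OF _ finite_monic_irreducibles_le[of ?s]]) auto
    have NS: "real (card NS) = ?A z * D * ?q ^ ?s"
      unfolding NS_def dens[symmetric]
    proof (rule card_monics_dens[OF _ I e])
      show "lead_coeff M = 1"
        by (auto simp: M_def lead_coeff_prod monic_square S_def intro!: prod.neutral)
      show "periodic I M (\<lambda>f. \<forall>P\<in>S. Q P f)"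
        using finS per by (intro periodic_conj_finite[where N = "\<lambda>P. P\<^sup>2"])
          (auto simp: M_def S_def intro: dvd_prodI)
    qed
    have sub: "N e \<subseteq> NS" by (auto simp: N_def NS_def S_def)
    have sub2: "NS - N e \<subseteq> (\<Union>P\<in>R. B P)"
    proof
      fix f assume f: "f \<in> NS - N e"
      then have fT: "f \<in> PiE I (\<lambda>i. monics (e i))" by (simp add: NS_def)
      from f obtain P where P: "P \<in> monic_irreducibles" "\<not> Q P f" by (auto simp: N_def NS_def)
      with f have "degree P > z" by (auto simp: NS_def S_def not_le[symmetric])
      then have d: "P\<^sup>2 dvd (\<Prod>i\<in>I. f i)" using nonlinear[OF P(1)] z(3) P(2) by (simp add: sqfree_at_def)
      have nz: "f i \<noteq> 0" "degree (f i) = e i" if "i \<in> I" for i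
        using fT that by (auto simp: PiE_iff monics_def)
      have "degree (P\<^sup>2) \<le> degree (\<Prod>i\<in>I. f i)" using d nz I by (intro dvd_imp_degree_le) auto
      also have "\<dots> = ?s" using nz by (simp add: degree_prod_eq_sum_degree)
      finally have "degree P \<le> ?s"
        using monic_irreducible_nonzero[OF P(1)] by (simp add: degree_power_eq)
      then show "f \<in> (\<Union>P\<in>R. B P)" using P d fT \<open>degree P > z\<close> by (auto simp: R_def B_def)
    qed
    have "card NS - card (N e) = card (NS - N e)"
      using sub finT by (intro card_Diff_subset[symmetric] finite_subset[OF sub]) (auto simp: NS_def)
    then have "real (card NS) - real (card (N e)) = real (card (NS - N e))"
      using card_mono[OF _ sub] finT by (simp add: NS_def)
    also have "\<dots> \<le> real (card (\<Union>P\<in>R. B P))"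
      using sub2 finR finT by (intro of_nat_mono card_mono) (auto simp: B_def)
    also have "\<dots> \<le> real (\<Sum>P\<in>R. card (B P))" by (intro of_nat_mono card_UN_le finR)
    also have "\<dots> \<le> (\<Sum>P\<in>R. ?q ^ ?s * (real (card I))\<^sup>2 * (1 / ?q ^ (2 * degree P)))"
      unfolding of_nat_sum
    proof (rule sum_mono)
      fix P assume "P \<in> R"
      then show "real (card (B P)) \<le> ?q ^ ?s * (real (card I))\<^sup>2 * (1 / ?q ^ (2 * degree P))"
        using card_square_dvd_prod[of P, OF _ I, of e] by (simp add: R_def B_def)
    qed
    also have "\<dots> = ?q ^ ?s * (real (card I))\<^sup>2 * (\<Sum>P\<in>R. 1 / ?q ^ (2 * degree P))"
      by (simp add: sum_distrib_left)
    also have "\<dots> \<le> ?q ^ ?s * (real (card I))\<^sup>2 * (1 / ?q ^ z)"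
      using finR by (intro mult_left_mono sum_monic_irreducibles_le) (auto simp: R_def)
    also have "\<dots> = ?q ^ ?s * ((real (card I))\<^sup>2 / ?q ^ z)" by simp
    also have "\<dots> \<le> ?q ^ ?s * (\<epsilon> / 2)" using z(2) by (intro mult_left_mono) auto
    finally have "real (card NS) / ?q ^ ?s - real (card (N e)) / ?q ^ ?s \<le> \<epsilon> / 2"
      by (simp add: diff_divide_distrib[symmetric] divide_le_eq mult.commute)
    moreover have "real (card (N e)) / ?q ^ ?s \<le> real (card NS) / ?q ^ ?s"
      using card_mono[OF _ sub] finT by (intro divide_right_mono) (auto simp: NS_def)
    moreover have "real (card NS) / ?q ^ ?s = ?A z * D" using NS by simp
    ultimately show ?thesis using z(1) unfolding dist_real_def by linarith
  qed
  have "eventually (\<lambda>e. degree M \<le> e i) ?F" if i: "i \<in> I" for i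
  proof (rule filter_leD[OF INF_lower[OF i]])
    show "eventually (\<lambda>e. degree M \<le> e i) (filtercomap (\<lambda>e. e i) at_top)"
      by (rule eventually_filtercomapI) (rule eventually_ge_at_top)
  qed
  then have "eventually (\<lambda>e. \<forall>i\<in>I. degree M \<le> e i) ?F" using I by (intro eventually_ball_finite) auto
  then show "eventually (\<lambda>e. dist (real (card {f \<in> PiE I (\<lambda>i. monics (e i)). \<forall>P\<in>monic_irreducibles. Q P f}) /
      ?q ^ (\<Sum>i\<in>I. e i)) (?K * (\<Prod>x\<in>UNIV. dens I ([:- x, 1:]\<^sup>2) (Q [:- x, 1:]))) < \<epsilon>) ?F"
    by eventually_elim (use main in \<open>auto simp: N_def D_def\<close>)
qed

section \<open>Unique decomposition and local types\<close>

text \<open>A repeated factor of one component and a common factor of two components both show up as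
  a square of an irreducible in the product. This turns the global definition into the family of
  local conditions that the sieve handles.\<close>

lemma sqfree_tuple_iff:
  fixes f :: "nat \<Rightarrow> 'a::field poly"
  shows "sqfree_tuple r f \<longleftrightarrow>
    (\<forall>i\<in>{1..<r}. lead_coeff (f i) = 1) \<and> (\<forall>P\<in>monic_irreducibles. sqfree_at {1..<r} P f)"
proof (intro iffI conjI ballI)
  fix i assume "sqfree_tuple r f" "i \<in> {1..<r}"
  then show "lead_coeff (f i) = 1" by (simp add: sqfree_tuple_def)
next
  fix P :: "'a poly" assume f: "sqfree_tuple r f" and P: "P \<in> monic_irreducibles"
  have nu: "\<not> is_unit P" using P by (simp add: monic_irreducibles_def irreducible_def)
  show "sqfree_at {1..<r} P f"
    unfolding sqfree_at_def
  proof
    assume "P\<^sup>2 dvd (\<Prod>i\<in>{1..<r}. f i)"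
    from square_dvd_prod_cases[OF monic_irreducible_prime_elem[OF P] _ this]
    obtain i j where i: "i \<in> {1..<r}" and j: "j \<in> {1..<r}"
      and D: "\<forall>k\<in>{1..<r}. (if k = i then P else 1) * (if k = j then P else 1) dvd f k"
      by blast
    show False
    proof (cases "i = j")
      case True
      have "P\<^sup>2 dvd f i" using bspec[OF D i] True by (simp add: power2_eq_square)
      moreover have "squarefree (f i)" using f i by (simp add: sqfree_tuple_def)
      ultimately show False using nu by (simp add: squarefree_def)
    next
      case False
      have "P dvd f i" "P dvd f j" using bspec[OF D i] bspec[OF D j] False by auto
      moreover have "coprime (f i) (f j)" using f i j False by (simp add: sqfree_tuple_def)
      ultimately show False using nu by (meson coprime_common_divisor)
    qed
  qed
next
  assume A: "(\<forall>i\<in>{1..<r}. lead_coeff (f i) = 1) \<and> (\<forall>P\<in>monic_irreducibles. sqfree_at {1..<r} P f)"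
  have nz: "f i \<noteq> 0" if "i \<in> {1..<r}" for i using A that by fastforce
  \<comment> \<open>Used for \<open>c\<close> with \<open>c\<^sup>2\<close> dividing one component
    and for a common divisor \<open>c\<close> of two: a nonunit would contain an irreducible whose
    square divides the product.\<close>
  have unit: "is_unit c"
    if c0: "c \<noteq> 0" and c: "\<And>P. P \<in> monic_irreducibles \<Longrightarrow> P dvd c \<Longrightarrow> P\<^sup>2 dvd (\<Prod>i\<in>{1..<r}. f i)" for c
  proof (rule ccontr)
    assume "\<not> is_unit c"
    then have "degree c > 0" using c0 by (simp add: is_unit_iff_degree)
    then obtain P where "P \<in> monic_irreducibles" "P dvd c" using exists_monic_irreducible_dvd by blast
    then show False using c A by (auto simp: sqfree_at_def)
  qed
  have sq: "squarefree (f i)" if i: "i \<in> {1..<r}" for i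
    unfolding squarefree_def
  proof (intro allI impI)
    fix c assume c: "c\<^sup>2 dvd f i"
    show "is_unit c"
    proof (rule unit)
      show "c \<noteq> 0" using c nz[OF i] by auto
      fix P assume "P dvd c"
      then have "P\<^sup>2 dvd f i" using c by (meson dvd_power_same dvd_trans)
      moreover have "f i dvd (\<Prod>i\<in>{1..<r}. f i)" using i by (intro dvd_prodI) auto
      ultimately show "P\<^sup>2 dvd (\<Prod>i\<in>{1..<r}. f i)" by (rule dvd_trans)
    qed
  qed
  have cop: "coprime (f i) (f j)" if i: "i \<in> {1..<r}" and j: "j \<in> {1..<r}" and ij: "i \<noteq> j" for i j
    unfolding coprime_def
  proof (intro allI impI)
    fix c assume c: "c dvd f i" "c dvd f j"
    show "is_unit c"
    proof (rule unit)
      show "c \<noteq> 0" using c nz[OF i] by auto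
      fix P assume "P dvd c"
      then have "P * P dvd f i * f j" using c by (intro mult_dvd_mono) (auto intro: dvd_trans)
      moreover have "(\<Prod>k\<in>{1..<r}. f k) = f i * (f j * (\<Prod>k\<in>{1..<r}-{i}-{j}. f k))"
        using i j ij by (subst prod.remove[of _ i], simp, simp, subst prod.remove[of _ j]) auto
      ultimately show "P\<^sup>2 dvd (\<Prod>i\<in>{1..<r}. f i)"
        by (metis power2_eq_square dvd_mult2 mult.assoc)
    qed
  qed
  show "sqfree_tuple r f" using A sq cop by (simp add: sqfree_tuple_def)
qed

text \<open>Induction on the degree: split one irreducible \<open>P\<close> off both sides. By
  square-freeness \<open>P\<close> does not divide the cofactor of \<open>a\<close>, so every
  irreducible factor of that cofactor differs from \<open>P\<close> and still divides the cofactor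
  of \<open>b\<close>.\<close>

lemma squarefree_dvd_if_monic_irreducibles:
  fixes a b :: "'a::field poly"
  assumes "a \<noteq> 0" "squarefree a" "\<And>P. P \<in> monic_irreducibles \<Longrightarrow> P dvd a \<Longrightarrow> P dvd b"
  shows "a dvd b"
  using assms
proof (induction "degree a" arbitrary: a b rule: less_induct)
  case less
  show ?case
  proof (cases "degree a = 0")
    case True
    then have "is_unit a" using less.prems(1) by (simp add: is_unit_iff_degree)
    then show ?thesis by (rule unit_imp_dvd)
  next
    case False
    then obtain P where P: "P \<in> monic_irreducibles" "P dvd a" using exists_monic_irreducible_dvd[of a] by auto
    obtain a' where a': "a = P * a'" using P(2) by (elim dvdE)
    obtain b' where b': "b = P * b'" using less.prems(3)[OF P] by (elim dvdE)
    have nz: "P \<noteq> 0" "a' \<noteq> 0" using less.prems(1) a' by auto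
    have "a' dvd b'"
    proof (rule less.hyps)
      show "degree a' < degree a" using a' nz monic_irreducible_degree[OF P(1)] by (simp add: degree_mult_eq)
      show "a' \<noteq> 0" by fact
      have "a' dvd a" using a' by simp
      then show "squarefree a'" using less.prems(2) unfolding squarefree_def by (meson dvd_trans)
      fix R assume R: "R \<in> monic_irreducibles" "R dvd a'"
      have "R \<noteq> P"
      proof
        assume "R = P"
        then have "P\<^sup>2 dvd a" using R(2) a' by (simp add: power2_eq_square)
        then show False using less.prems(2) P(1)
          by (auto simp: squarefree_def monic_irreducibles_def irreducible_def)
      qed
      then have "\<not> R dvd P" using monic_irreducible_dvd_eq R P by blast
      moreover have "R dvd P * b'" using less.prems(3)[OF R(1)] R(2) a' b' by auto
      ultimately show "R dvd b'" using monic_irreducible_prime_elem[OF R(1)] by (simp add: prime_elem_dvd_mult_iff)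
    qed
    then show ?thesis using a' b' by (simp add: mult_dvd_mono)
  qed
qed

lemma monic_dvd_antisym:
  fixes a b :: "'a::field poly"
  assumes "a dvd b" "b dvd a" "lead_coeff a = 1" "lead_coeff b = 1"
  shows "a = b"
proof -
  obtain h where h: "b = a * h" using assms(1) by (elim dvdE)
  have nz: "a \<noteq> 0" "h \<noteq> 0" using assms(3,4) h by auto
  have "degree b \<le> degree a" using assms(2) nz by (intro dvd_imp_degree_le)
  then have "degree h = 0" using h nz by (simp add: degree_mult_eq)
  then obtain c where c: "h = [:c:]" by (elim degree_eq_zeroE)
  have "lead_coeff b = lead_coeff a * c" unfolding h c lead_coeff_mult by simp
  then have "c = 1" unfolding assms(3,4) by simp
  then show ?thesis using h c by simp
qed

text \<open>Coprimality lets \<open>P\<close> divide no other component, and square-freeness lets it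
  divide \<open>f j\<close> only once. So the index \<open>j\<close> is the exact multiplicity of
  \<open>P\<close> in the whole product.\<close>

lemma monic_irreducible_multiplicity:
  fixes f :: "nat \<Rightarrow> 'a::field poly"
  assumes f: "sqfree_tuple r f" and al: "\<alpha> \<noteq> 0" and P: "P \<in> monic_irreducibles"
    and j: "j \<in> {1..<r}" and d: "P dvd f j"
  shows "P ^ j dvd smult \<alpha> (\<Prod>i=1..<r. f i ^ i)" "\<not> P ^ Suc j dvd smult \<alpha> (\<Prod>i=1..<r. f i ^ i)"
proof -
  have pP: "prime_elem P" using monic_irreducible_prime_elem[OF P] .
  have nu: "\<not> is_unit P" using P by (simp add: monic_irreducibles_def irreducible_def)
  have P0: "P \<noteq> 0" using monic_irreducible_nonzero[OF P] .
  have nd: "\<not> P dvd f i" if "i \<in> {1..<r}" "i \<noteq> j" for i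
  proof
    assume "P dvd f i"
    moreover have "coprime (f i) (f j)" using f j that by (simp add: sqfree_tuple_def)
    ultimately show False using nu d by (meson coprime_common_divisor)
  qed
  obtain h where h: "f j = P * h" using d by (elim dvdE)
  have nh: "\<not> P dvd h"
  proof
    assume "P dvd h"
    then have "P\<^sup>2 dvd f j" using h by (simp add: power2_eq_square)
    then show False using f j nu by (auto simp: sqfree_tuple_def squarefree_def)
  qed
  define R where "R = (\<Prod>i\<in>{1..<r}-{j}. f i ^ i)"
  have nR: "\<not> P dvd R"
  proof
    assume "P dvd R"
    then obtain i where "i \<in> {1..<r} - {j}" "P dvd f i ^ i"
      unfolding R_def using prime_elem_dvd_prod[OF pP, of "{1..<r}-{j}"] by blast
    then show False using nd prime_elem_dvd_power[OF pP] by blast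
  qed
  have eq: "(\<Prod>i=1..<r. f i ^ i) = P ^ j * (h ^ j * R)"
    unfolding R_def using j by (subst prod.remove[of _ j]) (auto simp: h power_mult_distrib mult.assoc)
  show "P ^ j dvd smult \<alpha> (\<Prod>i=1..<r. f i ^ i)" unfolding eq by (simp add: dvd_smult)
  show "\<not> P ^ Suc j dvd smult \<alpha> (\<Prod>i=1..<r. f i ^ i)"
  proof
    assume "P ^ Suc j dvd smult \<alpha> (\<Prod>i=1..<r. f i ^ i)"
    then have "P ^ j * P dvd P ^ j * (h ^ j * R)" using al unfolding eq by (simp add: dvd_smult_iff mult.commute)
    then have "P dvd h ^ j * R" using P0 by (auto simp only: dvd_mult_cancel_left power_eq_0_iff)
    then have "P dvd h ^ j" using nR pP by (simp add: prime_elem_dvd_mult_iff)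
    then show False using nh prime_elem_dvd_power[OF pP] by blast
  qed
qed

text \<open>The right-hand side mentions \<open>F\<close> alone, so the irreducible factors of each
  component can be read off from \<open>F\<close>; uniqueness of the decomposition follows.\<close>

lemma monic_irreducible_dvd_component_iff:
  fixes f :: "nat \<Rightarrow> 'a::field poly"
  assumes f: "sqfree_tuple r f" and al: "\<alpha> \<noteq> 0" and P: "P \<in> monic_irreducibles" and j: "j \<in> {1..<r}"
    and F: "F = smult \<alpha> (\<Prod>i=1..<r. f i ^ i)"
  shows "P dvd f j \<longleftrightarrow> P ^ j dvd F \<and> \<not> P ^ Suc j dvd F"
proof
  assume "P dvd f j"
  then show "P ^ j dvd F \<and> \<not> P ^ Suc j dvd F"
    using monic_irreducible_multiplicity[OF f al P j] F by blast
next
  assume a: "P ^ j dvd F \<and> \<not> P ^ Suc j dvd F"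
  have pP: "prime_elem P" using monic_irreducible_prime_elem[OF P] .
  have "P dvd P ^ j" using j by (intro dvd_power) auto
  then have "P dvd F" using a dvd_trans by blast
  then have "P dvd (\<Prod>i=1..<r. f i ^ i)" using al by (simp add: F dvd_smult_iff)
  then obtain i where i: "i \<in> {1..<r}" "P dvd f i ^ i" using prime_elem_dvd_prod[OF pP, of "{1..<r}"] by blast
  then have Pi: "P dvd f i" using prime_elem_dvd_power[OF pP] by blast
  then have b: "P ^ i dvd F" "\<not> P ^ Suc i dvd F"
    using monic_irreducible_multiplicity[OF f al P i(1)] F by blast+
  have "i = j"
  proof (rule ccontr)
    assume "i \<noteq> j"
    then have "Suc i \<le> j \<or> Suc j \<le> i" by linarith
    then show False using a b by (meson le_imp_power_dvd dvd_trans)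
  qed
  then show "P dvd f j" using Pi by simp
qed

lemma lead_coeff_decomposition:
  assumes "sqfree_tuple r h"
  shows "lead_coeff (smult c (\<Prod>i=1..<r. h i ^ i)) = c"
  unfolding lead_coeff_smult lead_coeff_prod lead_coeff_power
  using assms by (simp add: sqfree_tuple_def)

lemma decomposition_unique:
  fixes f g :: "nat \<Rightarrow> 'a::field poly"
  assumes f: "sqfree_tuple r f" and g: "sqfree_tuple r g" and al: "\<alpha> \<noteq> 0" "\<beta> \<noteq> 0"
    and eq: "smult \<alpha> (\<Prod>i=1..<r. f i ^ i) = smult \<beta> (\<Prod>i=1..<r. g i ^ i)"
  shows "\<alpha> = \<beta>" "\<And>i. i \<in> {1..<r} \<Longrightarrow> f i = g i"
proof -
  show "\<alpha> = \<beta>"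
    using lead_coeff_decomposition[OF f, of \<alpha>] lead_coeff_decomposition[OF g, of \<beta>]
    unfolding eq by (rule trans[OF sym])
  fix i assume i: "i \<in> {1..<r}"
  have dvd: "P dvd f i \<longleftrightarrow> P dvd g i" if "P \<in> monic_irreducibles" for P
    using monic_irreducible_dvd_component_iff[OF f al(1) that i refl]
      monic_irreducible_dvd_component_iff[OF g al(2) that i eq] by blast
  have fi: "lead_coeff (f i) = 1" "squarefree (f i)" and gi: "lead_coeff (g i) = 1" "squarefree (g i)"
    using f g i by (auto simp: sqfree_tuple_def)
  then have nz: "f i \<noteq> 0" "g i \<noteq> 0" by auto
  have "f i dvd g i" "g i dvd f i"
    using squarefree_dvd_if_monic_irreducibles[OF nz(1) fi(2)] squarefree_dvd_if_monic_irreducibles[OF nz(2) gi(2)] dvd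
    by blast+
  then show "f i = g i" using fi gi by (intro monic_dvd_antisym)
qed

text \<open>Uniqueness of the decomposition makes the definite description in
  \<open>F_red_def\<close> meaningful.\<close>

lemma F_red_eq:
  fixes f :: "nat \<Rightarrow> 'a::field poly"
  assumes f: "sqfree_tuple r f" and al: "\<alpha> \<noteq> 0"
  shows "F_red r d (smult \<alpha> (\<Prod>i=1..<r. f i ^ i)) = smult \<alpha> (\<Prod>i=1..<r. f i ^ (i mod d))"
  unfolding F_red_def
proof (rule the_equality)
  show "\<exists>\<alpha>' f'. \<alpha>' \<noteq> 0 \<and> sqfree_tuple r f' \<and> smult \<alpha> (\<Prod>i=1..<r. f i ^ i) = smult \<alpha>' (\<Prod>i=1..<r. f' i ^ i) \<and>
    smult \<alpha> (\<Prod>i=1..<r. f i ^ (i mod d)) = smult \<alpha>' (\<Prod>i=1..<r. f' i ^ (i mod d))"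
    using f al by blast
  fix G assume "\<exists>\<alpha>' f'. \<alpha>' \<noteq> 0 \<and> sqfree_tuple r f' \<and> smult \<alpha> (\<Prod>i=1..<r. f i ^ i) = smult \<alpha>' (\<Prod>i=1..<r. f' i ^ i) \<and>
    G = smult \<alpha>' (\<Prod>i=1..<r. f' i ^ (i mod d))"
  then obtain \<alpha>' f' where *: "\<alpha>' \<noteq> 0" "sqfree_tuple r f'"
    "smult \<alpha> (\<Prod>i=1..<r. f i ^ i) = smult \<alpha>' (\<Prod>i=1..<r. f' i ^ i)"
    "G = smult \<alpha>' (\<Prod>i=1..<r. f' i ^ (i mod d))" by blast
  have "\<alpha> = \<alpha>'" and ff: "\<And>i. i \<in> {1..<r} \<Longrightarrow> f i = f' i"
    using decomposition_unique[OF f *(2) al *(1,3)] by auto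
  moreover have "(\<Prod>i=1..<r. f i ^ (i mod d)) = (\<Prod>i=1..<r. f' i ^ (i mod d))"
    using ff by (intro prod.cong) auto
  ultimately show "G = smult \<alpha> (\<Prod>i=1..<r. f i ^ (i mod d))" using *(4) by simp
qed

section \<open>Local types at a point of the field\<close>

definition local_coeff :: "('i \<Rightarrow> 'a::field poly) \<Rightarrow> 'a \<Rightarrow> 'i \<Rightarrow> 'i \<Rightarrow> 'a" where
  "local_coeff f x j i = (if i = j then poly (pderiv (f i)) x else poly (f i) x)"

text \<open>
  The local type \<open>(j, u)\<close> of a tuple at \<open>x\<close> records which \<open>f\<^sub>j\<close> vanishes at \<open>x\<close> (none if \<open>j = 0\<close>) and the
  product of the \<open>f\<^sub>i(x)\<^sup>i\<close>. At a simple zero of \<open>f\<^sub>j\<close> the value is replaced by the derivative: then \<open>u\<close>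
  is equidistributed in all cases, and the extra factor is a \<open>j\<close>-th power, hence invisible to
  \<open>\<chi>\<^sub>d\<close> when \<open>d\<close> divides \<open>j\<close>; when it does not, \<open>\<chi>\<^sub>d\<close> vanishes anyway.
\<close>

definition local_type :: "nat set \<Rightarrow> 'a::field \<Rightarrow> nat \<Rightarrow> 'a \<Rightarrow> (nat \<Rightarrow> 'a poly) \<Rightarrow> bool" where
  "local_type I x j u f \<longleftrightarrow> (j \<in> I \<longrightarrow> poly (f j) x = 0) \<and> (\<forall>i\<in>I. local_coeff f x j i \<noteq> 0) \<and>
     (\<Prod>i\<in>I. local_coeff f x j i ^ i) = u"

text \<open>The residue of \<open>f\<close> modulo the square amounts to the pair of value and
  derivative at \<open>x\<close>. Hence local types are periodic modulo the square, and value and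
  derivative can be prescribed independently.\<close>

lemma linear_square_dvd_iff:
  fixes f :: "'a::field poly"
  shows "[:- x, 1:]\<^sup>2 dvd f \<longleftrightarrow> poly f x = 0 \<and> poly (pderiv f) x = 0"
proof
  assume "[:- x, 1:]\<^sup>2 dvd f"
  then obtain h where f: "f = [:- x, 1:] * ([:- x, 1:] * h)" by (metis dvdE power2_eq_square mult.assoc)
  have "poly [:- x, 1:] x = 0" by simp
  then show "poly f x = 0 \<and> poly (pderiv f) x = 0"
    unfolding f pderiv_mult poly_mult poly_add by simp
next
  assume a: "poly f x = 0 \<and> poly (pderiv f) x = 0"
  then obtain h where h: "f = [:- x, 1:] * h" by (metis poly_eq_0_iff_dvd dvdE)
  have "poly (pderiv f) x = poly h x" unfolding h pderiv_mult poly_mult poly_add by (simp add: pderiv_pCons)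
  then obtain h' where "h = [:- x, 1:] * h'" using a by (metis poly_eq_0_iff_dvd dvdE)
  then show "[:- x, 1:]\<^sup>2 dvd f" using h by (metis dvd_triv_left mult.assoc power2_eq_square)
qed

lemma periodic_local_type: "periodic I ([:- x, 1:]\<^sup>2) (local_type I x j u)"
proof -
  have *: "local_type I x j u g"
    if fg: "\<And>i. i \<in> I \<Longrightarrow> [:- x, 1:]\<^sup>2 dvd f i - g i" and f: "local_type I x j u f" for f g :: "nat \<Rightarrow> 'a poly"
  proof -
    have v: "poly (f i) x = poly (g i) x" "poly (pderiv (f i)) x = poly (pderiv (g i)) x" if "i \<in> I" for i
      using fg[OF that] by (auto simp: linear_square_dvd_iff pderiv_diff)
    then have "local_coeff f x j i = local_coeff g x j i" if "i \<in> I" for i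
      using v[OF that] by (cases "i = j") (auto simp: local_coeff_def)
    then show ?thesis using f v by (auto simp: local_type_def)
  qed
  show ?thesis unfolding periodic_def
    using * by (metis dvd_diff_commute)
qed

lemma local_type_imp_sqfree_at:
  assumes I: "finite I" and lt: "local_type I x j u f"
  shows "sqfree_at I [:- x, 1:] f"
proof -
  have nz: "poly (f i) x \<noteq> 0" if "i \<in> I" "i \<noteq> j" for i
    using lt that by (auto simp: local_type_def local_coeff_def)
  show ?thesis
  proof (cases "j \<in> I")
    case False
    then have "poly (f i) x \<noteq> 0" if "i \<in> I" for i using nz[OF that] that by blast
    then have "poly (\<Prod>i\<in>I. f i) x \<noteq> 0" using I by (simp add: poly_prod)
    then show ?thesis by (simp add: sqfree_at_def linear_square_dvd_iff)
  next
    case True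
    have "(\<Prod>i\<in>I. f i) = f j * (\<Prod>i\<in>I-{j}. f i)" using I True by (rule prod.remove)
    moreover have "poly (\<Prod>i\<in>I-{j}. f i) x \<noteq> 0" using nz I by (simp add: poly_prod)
    moreover have "poly (f j) x = 0" "poly (pderiv (f j)) x \<noteq> 0"
      using lt True by (auto simp: local_type_def local_coeff_def)
    ultimately show ?thesis by (simp add: sqfree_at_def linear_square_dvd_iff pderiv_mult)
  qed
qed

text \<open>At most one component vanishes at \<open>x\<close>, and only simply. Together with
  \<open>local_type_unique\<close> this splits the tuples that are square-free at \<open>x\<close>
  into disjoint classes.\<close>

lemma local_type_exists:
  assumes I: "finite I" "0 \<notin> I" and sq: "sqfree_at I [:- x, 1:] f"
  shows "\<exists>j\<in>insert 0 I. \<exists>u. u \<noteq> 0 \<and> local_type I x j u f"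
proof -
  have *: "\<exists>u. u \<noteq> 0 \<and> local_type I x j u f"
    if "\<forall>i\<in>I. local_coeff f x j i \<noteq> 0" "j \<in> I \<longrightarrow> poly (f j) x = 0" for j
    using that I by (intro exI[of _ "\<Prod>i\<in>I. local_coeff f x j i ^ i"]) (auto simp: local_type_def)
  show ?thesis
  proof (cases "\<exists>j\<in>I. poly (f j) x = 0")
    case False
    then show ?thesis using I by (intro bexI[of _ 0] *) (auto simp: local_coeff_def)
  next
    case True
    then obtain j where j: "j \<in> I" "poly (f j) x = 0" by blast
    have eq: "(\<Prod>i\<in>I. f i) = f j * (\<Prod>i\<in>I-{j}. f i)" using I j by (intro prod.remove) auto
    have "poly (pderiv (f j)) x \<noteq> 0 \<and> poly (\<Prod>i\<in>I-{j}. f i) x \<noteq> 0"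
      using sq j(2) unfolding sqfree_at_def eq linear_square_dvd_iff by (auto simp: pderiv_mult)
    then have "\<forall>i\<in>I. local_coeff f x j i \<noteq> 0" using I by (auto simp: local_coeff_def poly_prod)
    then show ?thesis using j by (intro bexI[of _ j] *) auto
  qed
qed

lemma local_type_unique:
  assumes "0 \<notin> I" "local_type I x j u f" "local_type I x j' u' f" "j \<in> insert 0 I" "j' \<in> insert 0 I"
  shows "j = j' \<and> u = u'"
proof -
  have "j = j'"
    using assms by (fastforce simp: local_type_def local_coeff_def split: if_splits)
  then show ?thesis using assms by (auto simp: local_type_def)
qed

text \<open>The unit 1 stands for any unit, by \<open>card_prod_powers_eq\<close>. The density is
  common to all types at a point and cancels in the ratio.\<close>

definition local_density :: "'a::{field,finite} itself \<Rightarrow> nat set \<Rightarrow> real" where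
  "local_density _ I = real (card {c \<in> PiE I (\<lambda>_. UNIV - {0 :: 'a}). (\<Prod>i\<in>I. c i ^ i) = 1}) /
     real CARD('a) ^ card I"

lemma local_density_pos: "finite I \<Longrightarrow> local_density TYPE('a::{field,finite}) I > 0"
proof -
  assume I: "finite I"
  have "(\<lambda>i\<in>I. 1) \<in> {c \<in> PiE I (\<lambda>_. UNIV - {0 :: 'a}). (\<Prod>i\<in>I. c i ^ i) = 1}"
    by simp
  moreover have "finite {c \<in> PiE I (\<lambda>_. UNIV - {0 :: 'a}). (\<Prod>i\<in>I. c i ^ i) = 1}"
    by (rule finite_subset[OF Collect_subset finite_PiE[OF I]]) simp
  ultimately have "card {c \<in> PiE I (\<lambda>_. UNIV - {0 :: 'a}). (\<Prod>i\<in>I. c i ^ i) = 1} > 0"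
    unfolding card_gt_0_iff by blast
  then show ?thesis by (simp add: local_density_def)
qed

text \<open>The coordinate with index 1 enters with exponent 1, so rescaling it moves the product to
  any prescribed unit. For the index set \<open>{1..<r}\<close> the condition
  \<open>1 \<in> I\<close> is \<open>r \<ge> 2\<close>.\<close>

lemma card_prod_powers_eq:
  fixes u :: "'a::{field,finite}"
  assumes I: "finite I" "1 \<in> I" and u: "u \<noteq> 0"
  shows "card {c \<in> PiE I (\<lambda>_. UNIV - {0}). (\<Prod>i\<in>I. c i ^ i) = u} =
    card {c \<in> PiE I (\<lambda>_. UNIV - {0 :: 'a}). (\<Prod>i\<in>I. c i ^ i) = 1}"
proof -
  have pr: "(\<Prod>i\<in>I. (c(1 := c 1 * v)) i ^ i) = v * (\<Prod>i\<in>I. c i ^ i)" for c and v :: 'a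
  proof -
    have "(\<Prod>i\<in>I-{1}. (c(1 := c 1 * v)) i ^ i) = (\<Prod>i\<in>I-{1}. c i ^ i)" by (intro prod.cong) auto
    then show ?thesis using I by (simp add: prod.remove[of I 1])
  qed
  have "bij_betw (\<lambda>c. c(1 := c 1 * inverse u)) {c \<in> PiE I (\<lambda>_. UNIV - {0}). (\<Prod>i\<in>I. c i ^ i) = u}
      {c \<in> PiE I (\<lambda>_. UNIV - {0}). (\<Prod>i\<in>I. c i ^ i) = 1}"
  proof (rule bij_betw_byWitness[where f' = "\<lambda>c. c(1 := c 1 * u)"])
    have im: "c(1 := c 1 * v) \<in> {c \<in> PiE I (\<lambda>_. UNIV - {0}). (\<Prod>i\<in>I. c i ^ i) = v * w}"
      if "c \<in> {c \<in> PiE I (\<lambda>_. UNIV - {0}). (\<Prod>i\<in>I. c i ^ i) = w}" "v \<noteq> 0" for c and v w :: 'a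
    proof -
      have "c 1 * v \<in> UNIV - {0}" using that I(2) by (auto simp: PiE_iff)
      then have "c(1 := c 1 * v) \<in> PiE (insert 1 I) (\<lambda>_. UNIV - {0})" using that(1) by (intro PiE_fun_upd) auto
      then show ?thesis using pr[of c v] that(1) I(2) by (simp add: insert_absorb)
    qed
    show "(\<lambda>c. c(1 := c 1 * inverse u)) ` {c \<in> PiE I (\<lambda>_. UNIV - {0}). (\<Prod>i\<in>I. c i ^ i) = u}
        \<subseteq> {c \<in> PiE I (\<lambda>_. UNIV - {0}). (\<Prod>i\<in>I. c i ^ i) = 1}"
      using im[of _ u "inverse u"] u by (intro image_subsetI) simp
    show "(\<lambda>c. c(1 := c 1 * u)) ` {c \<in> PiE I (\<lambda>_. UNIV - {0}). (\<Prod>i\<in>I. c i ^ i) = 1}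
        \<subseteq> {c \<in> PiE I (\<lambda>_. UNIV - {0}). (\<Prod>i\<in>I. c i ^ i) = u}"
      using im[of _ 1 u] u by (intro image_subsetI) simp
  qed (use u in auto)
  then show ?thesis by (rule bij_betw_same_card)
qed

text \<open>Modulo the square each component is a pair of value and derivative. For
  \<open>i \<noteq> j\<close> the value carries the unit and the derivative is free; for
  \<open>i = j\<close> the value must be 0 and the derivative carries the unit. So the units are
  counted in the same way for all \<open>j\<close>, and a zero costs exactly one free coordinate,
  hence a factor 1/q.\<close>

lemma dens_local_type:
  fixes x u :: "'a::{field,finite}"
  assumes I: "finite I" "1 \<in> I" "0 \<notin> I" and j: "j \<in> insert 0 I" and u: "u \<noteq> 0"
  shows "dens I ([:- x, 1:]\<^sup>2) (local_type I x j u) =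
    local_density TYPE('a) I * (if j = 0 then 1 else 1 / real CARD('a))"
proof -
  let ?q = "real CARD('a)"
  \<comment> \<open>The polynomial v + w (X - x), with value \<open>v\<close> and derivative
    \<open>w\<close> at \<open>x\<close>.\<close>
  define pt where "pt v w = [:v - w * x, w:]" for v w :: 'a
  have pt: "poly (pt v w) x = v" "poly (pderiv (pt v w)) x = w" for v w
    by (simp_all add: pt_def pderiv_pCons algebra_simps)
  have ptB: "pt v w \<in> polys_below 2" for v w by (simp add: pt_def polys_below_def)
  have pt_eq: "pt (poly f x) (poly (pderiv f) x) = f" if f: "f \<in> polys_below 2" for f
  proof -
    have "degree f \<le> 1" using f by (auto simp: polys_below_def)
    then have "f = [:coeff f 0, coeff f 1:]"
      by (intro poly_eqI) (auto simp: coeff_pCons coeff_eq_0 split: nat.split)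
    then obtain a b where "f = [:a, b:]" by blast
    then show ?thesis by (simp add: pt_def pderiv_pCons algebra_simps)
  qed
  let ?C = "{c \<in> PiE I (\<lambda>_. UNIV - {0 :: 'a}). (\<Prod>i\<in>I. c i ^ i) = u}"
  \<comment> \<open>The free derivatives. The coordinate \<open>j\<close> is pinned to 0 because its
    derivative is already recorded among the units.\<close>
  let ?B = "PiE I (\<lambda>i. if i = j then {0 :: 'a} else UNIV)"
  let ?L = "{f \<in> PiE I (\<lambda>_. polys_below 2). local_type I x j u f}"
  let ?to = "\<lambda>(c, b). \<lambda>i\<in>I. if i = j then pt 0 (c i) else pt (c i) (b i)"
  let ?from = "\<lambda>f. (\<lambda>i\<in>I. local_coeff f x j i, \<lambda>i\<in>I. if i = j then 0 else poly (pderiv (f i)) x)"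
  have "bij_betw ?to (?C \<times> ?B) ?L"
  proof (rule bij_betw_byWitness[where f' = "?from"])
    have lc: "local_coeff (\<lambda>i\<in>I. if i = j then pt 0 (c i) else pt (c i) (b i)) x j i = c i" if "i \<in> I" for c b i
      using that by (cases "i = j") (auto simp: local_coeff_def pt)
    show "\<forall>a\<in>?C \<times> ?B. ?from
        (?to a) = a"
    proof (rule ballI)
      fix a assume "a \<in> ?C \<times> ?B"
      then obtain c b where a: "a = (c, b)" and c: "c \<in> ?C" and b: "b \<in> ?B" by blast
      let ?f = "\<lambda>i\<in>I. if i = j then pt 0 (c i) else pt (c i) (b i)"
      have "(\<lambda>i\<in>I. local_coeff ?f x j i) = c"
        using c by (intro ext) (auto simp: lc PiE_iff extensional_def)
      moreover have "(\<lambda>i\<in>I. if i = j then 0 else poly (pderiv (?f i)) x) = b"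
        using b by (intro ext) (auto simp: pt PiE_iff extensional_def split: if_splits)
      ultimately show "?from
        (?to a) = a"
        by (simp only: a prod.case)
    qed
    show "\<forall>f\<in>?L. ?to
        (\<lambda>i\<in>I. local_coeff f x j i, \<lambda>i\<in>I. if i = j then 0 else poly (pderiv (f i)) x) = f"
    proof (rule ballI)
      fix f assume f: "f \<in> ?L"
      have "(\<lambda>i\<in>I. if i = j then pt 0 ((\<lambda>i\<in>I. local_coeff f x j i) i) else
          pt ((\<lambda>i\<in>I. local_coeff f x j i) i) ((\<lambda>i\<in>I. if i = j then 0 else poly (pderiv (f i)) x) i)) i = f i" for i
        using f pt_eq[of "f i"] by (cases "i \<in> I"; cases "i = j")
          (auto simp: local_coeff_def local_type_def PiE_iff extensional_def)
      then show "?to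
        (\<lambda>i\<in>I. local_coeff f x j i, \<lambda>i\<in>I. if i = j then 0 else poly (pderiv (f i)) x) = f"
        unfolding prod.case by (rule ext)
    qed
    show "?to ` (?C \<times> ?B) \<subseteq> ?L"
    proof (rule image_subsetI)
      fix a assume "a \<in> ?C \<times> ?B"
      then obtain c b where a: "a = (c, b)" and c: "c \<in> ?C" and b: "b \<in> ?B" by blast
      let ?f = "\<lambda>i\<in>I. if i = j then pt 0 (c i) else pt (c i) (b i)"
      have "?f \<in> PiE I (\<lambda>_. polys_below 2)" by (simp add: ptB)
      moreover have "local_type I x j u ?f"
        unfolding local_type_def
      proof (intro conjI)
        show "j \<in> I \<longrightarrow> poly (?f j) x = 0" by (simp add: pt)
        show "\<forall>i\<in>I. local_coeff ?f x j i \<noteq> 0" using c by (auto simp: lc PiE_iff)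
        show "(\<Prod>i\<in>I. local_coeff ?f x j i ^ i) = u" using c by (simp add: lc cong: prod.cong)
      qed
      ultimately show "?to a \<in> ?L"
        unfolding a prod.case by blast
    qed
    show "?from ` ?L \<subseteq> ?C \<times> ?B"
      by (auto simp: local_type_def cong: prod.cong)
  qed
  then have "card ?L = card ?C * card ?B"
    unfolding card_cartesian_product[symmetric] by (rule bij_betw_same_card[symmetric])
  moreover have "real (card ?B) = ?q ^ card I * (if j = 0 then 1 else 1 / ?q)"
  proof (cases "j = 0")
    case True
    then have "card ?B = (\<Prod>i\<in>I. CARD('a))"
      unfolding card_PiE[OF I(1)] using True I(3) by (intro prod.cong) auto
    then show ?thesis using True by simp
  next
    case False
    then have jI: "j \<in> I" using j by simp
    have "card ?B = (\<Prod>i\<in>I. if i = j then 1 else CARD('a))"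
      unfolding card_PiE[OF I(1)] by (intro prod.cong) auto
    also have "\<dots> = 1 * (\<Prod>i\<in>I-{j}. if i = j then 1 else CARD('a))"
      unfolding prod.remove[OF I(1) jI] by (simp only: simp_thms if_True)
    also have "\<dots> = 1 * (\<Prod>i\<in>I-{j}. CARD('a))"
      by (intro arg_cong2[of _ _ _ _ "(*)"] prod.cong) auto
    finally have "real (card ?B) = ?q ^ (card I - 1)" using jI by simp
    moreover have "card I \<ge> 1" using jI I by (auto simp: Suc_le_eq card_gt_0_iff)
    ultimately show ?thesis using False by (simp add: power_diff)
  qed
  ultimately have "real (card ?L) = real (card {c \<in> PiE I (\<lambda>_. UNIV - {0 :: 'a}). (\<Prod>i\<in>I. c i ^ i) = 1}) *
      (?q ^ card I * (if j = 0 then 1 else 1 / ?q))"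
    using card_prod_powers_eq[OF I(1,2) u] by simp
  moreover have "degree ([:- x, 1:]\<^sup>2) = 2" by (simp add: degree_power_eq)
  ultimately show ?thesis
    by (simp add: dens_def local_density_def mult_2 power_add)
qed

section \<open>The distribution of the character sums\<close>

lemma mult_character_power: "mult_character \<psi> \<Longrightarrow> \<psi> (x ^ n) = \<psi> x ^ n"
  by (induction n) (auto simp: mult_character_def)

lemma mult_character_prod: "mult_character \<psi> \<Longrightarrow> \<psi> (\<Prod>i\<in>I. g i) = (\<Prod>i\<in>I. \<psi> (g i))"
  by (induction I rule: infinite_finite_induct) (auto simp: mult_character_def)

lemma mult_character_nonzero:
  assumes "mult_character \<psi>" "x \<noteq> 0" shows "\<psi> x \<noteq> 0"
proof -
  have "\<psi> x * \<psi> (inverse x) = \<psi> (x * inverse x)" using assms(1) by (simp add: mult_character_def)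
  also have "\<dots> = 1" using assms by (simp add: mult_character_def)
  finally show ?thesis by auto
qed

text \<open>Multiplication by \<open>z\<close> permutes \<open>H\<close>, so it leaves the product
  over \<open>H\<close> unchanged while multiplying it by \<open>z ^ card H\<close>.\<close>

lemma power_card_mult_closed:
  fixes H :: "complex set"
  assumes H: "finite H" "0 \<notin> H" "\<And>z w. z \<in> H \<Longrightarrow> w \<in> H \<Longrightarrow> z * w \<in> H" and z: "z \<in> H"
  shows "z ^ card H = 1"
proof -
  have z0: "z \<noteq> 0" using H z by auto
  have inj: "inj_on ((*) z) H" using z0 by (auto simp: inj_on_def)
  have "(*) z ` H = H" using H z inj by (intro endo_inj_surj) auto
  then have "(\<Prod>w\<in>H. w) = (\<Prod>w\<in>(*) z ` H. w)" by simp
  also have "\<dots> = z ^ card H * (\<Prod>w\<in>H. w)" by (simp add: prod.reindex[OF inj] prod.distrib)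
  finally show ?thesis using H(1,2) by (simp add: prod_zero_iff)
qed

text \<open>The image \<open>?H\<close> consists of \<open>card ?H\<close>-th roots of unity, so the
  order is at most \<open>card ?H\<close>. Conversely \<open>?H\<close> lies in the set of roots of
  unity of that order, which has as many elements as the order; hence equality.\<close>

lemma mult_character_image:
  fixes \<psi> :: "'a::{field,finite} \<Rightarrow> complex"
  assumes "mult_character \<psi>"
  shows "char_order \<psi> > 0" "x \<noteq> 0 \<Longrightarrow> \<psi> x ^ char_order \<psi> = 1"
    "\<psi> ` (UNIV - {0}) = unity_roots (char_order \<psi>)"
proof -
  let ?H = "\<psi> ` (UNIV - {0})" and ?d = "char_order \<psi>"
  have fin: "finite ?H" by simp
  have "z * w \<in> ?H" if zw: "z \<in> ?H" "w \<in> ?H" for z w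
  proof -
    from zw obtain x y where "x \<noteq> 0" "y \<noteq> 0" "z = \<psi> x" "w = \<psi> y" by auto
    then have "z * w = \<psi> (x * y)" "x * y \<in> UNIV - {0}" using assms by (auto simp: mult_character_def)
    then show ?thesis by blast
  qed
  then have pow: "z ^ card ?H = 1" if "z \<in> ?H" for z
    using power_card_mult_closed[OF fin _ _ that] mult_character_nonzero[OF assms] by fastforce
  have "\<psi> 1 \<in> ?H" by auto
  then have cH: "card ?H > 0" using fin by (metis card_gt_0_iff empty_iff)
  have P: "card ?H > 0 \<and> (\<forall>x. x \<noteq> 0 \<longrightarrow> \<psi> x ^ card ?H = 1)" using pow cH by auto
  have L: "?d > 0 \<and> (\<forall>x. x \<noteq> 0 \<longrightarrow> \<psi> x ^ ?d = 1)" unfolding char_order_def by (rule LeastI, rule P)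
  have le: "?d \<le> card ?H" unfolding char_order_def by (rule Least_le, rule P)
  show d0: "?d > 0" using L by blast
  show "x \<noteq> 0 \<Longrightarrow> \<psi> x ^ ?d = 1" using L by blast
  have "card (unity_roots ?d) = ?d" using d0 unfolding unity_roots_def by (rule card_roots_unity_eq)
  moreover have "finite (unity_roots ?d)" using calculation d0 by (metis card_gt_0_iff)
  moreover have "?H \<subseteq> unity_roots ?d" using L by (auto simp: unity_roots_def)
  ultimately show "?H = unity_roots ?d" using le by (metis card_seteq)
qed

text \<open>All fibres over roots of unity are translates of the fibre over 1, and by surjectivity
  there are \<open>char_order \<psi>\<close> of them.\<close>

lemma card_char_fiber:
  fixes \<psi> :: "'a::{field,finite} \<Rightarrow> complex"
  assumes \<psi>: "mult_character \<psi>" and e: "e \<in> unity_roots (char_order \<psi>)"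
  shows "char_order \<psi> * card {u. u \<noteq> 0 \<and> \<psi> u = e} = CARD('a) - 1"
proof -
  let ?d = "char_order \<psi>" and ?fib = "\<lambda>e. {u \<in> UNIV - {0}. \<psi> u = e}"
  have fib: "card (?fib z) = card (?fib 1)" if z: "z \<in> unity_roots ?d" for z
  proof -
    obtain v where v: "v \<noteq> 0" "\<psi> v = z" using z mult_character_image(3)[OF \<psi>] by force
    have "bij_betw ((*) v) (?fib 1) (?fib z)"
    proof (rule bij_betw_byWitness[where f' = "\<lambda>u. u / v"])
      show "(*) v ` ?fib 1 \<subseteq> ?fib z" using v \<psi> by (auto simp: mult_character_def)
      have "\<psi> (u / v) = 1" if "\<psi> u = z" for u
      proof -
        have "\<psi> (u / v * v) = \<psi> (u / v) * \<psi> v" using \<psi> unfolding mult_character_def by blast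
        then show ?thesis using that v mult_character_nonzero[OF \<psi> v(1)] by simp
      qed
      then show "(\<lambda>u. u / v) ` ?fib z \<subseteq> ?fib 1" using v by auto
    qed (use v in auto)
    then show ?thesis by (simp add: bij_betw_same_card)
  qed
  have fin: "finite (unity_roots ?d)" unfolding mult_character_image(3)[OF \<psi>, symmetric] by simp
  have "card (UNIV - {0 :: 'a}) = (\<Sum>z\<in>unity_roots ?d. card (?fib z))"
    unfolding card_eq_sum
    by (rule sum.group[symmetric]) (use fin mult_character_image(3)[OF \<psi>] in auto)
  also have "\<dots> = (\<Sum>z\<in>unity_roots ?d. card (?fib e))"
    by (intro sum.cong refl trans[OF fib fib[OF e, symmetric]])
  also have "\<dots> = ?d * card (?fib e)"
    using card_roots_unity_eq[of ?d] mult_character_image(1)[OF \<psi>] by (simp add: unity_roots_def)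
  finally show ?thesis by (simp add: card_Diff_singleton)
qed

section \<open>Character sums as functions of the local types\<close>

text \<open>The value of the character of order \<open>d\<close> at a point of type
  \<open>(j, u)\<close>: the vanishing factor has exponent \<open>j mod d\<close>, which is 0
  exactly when \<open>d\<close> divides \<open>j\<close>.\<close>

definition limit_value :: "(nat \<Rightarrow> 'a::field \<Rightarrow> complex) \<Rightarrow> nat \<Rightarrow> nat \<times> 'a \<Rightarrow> complex" where
  "limit_value chi d t = (if d dvd fst t then chi d (snd t) else 0)"

lemma chi_F_red:
  fixes f :: "nat \<Rightarrow> 'a::{field,finite} poly"
  assumes chi: "mult_character (chi d)" "char_order (chi d) = d"
    and f: "sqfree_tuple r f" and al: "\<alpha> \<noteq> 0" and lt: "local_type {1..<r} x j u f" and j: "j < r"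
  shows "chi d (poly (F_red r d (smult \<alpha> (\<Prod>i=1..<r. f i ^ i))) x) = limit_value chi d (j, \<alpha> * u)"
proof -
  let ?I = "{1..<r}"
  have eq: "poly (F_red r d (smult \<alpha> (\<Prod>i=1..<r. f i ^ i))) x = \<alpha> * (\<Prod>i\<in>?I. poly (f i) x ^ (i mod d))"
    unfolding F_red_eq[OF f al] by (simp add: poly_prod)
  show ?thesis
  proof (cases "d dvd j")
    case False
    then have jI: "j \<in> ?I" using j by (cases "j = 0") auto
    then have "poly (f j) x ^ (j mod d) = 0" using lt False by (simp add: local_type_def mod_greater_zero_iff_not_dvd)
    then have z: "(\<Prod>i\<in>?I. poly (f i) x ^ (i mod d)) = 0" using jI by (intro prod_zero) auto
    show ?thesis using chi False unfolding eq z by (simp add: mult_character_def limit_value_def)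
  next
    case True
    have pow: "chi d y ^ (i mod d) = chi d y ^ i" if "y \<noteq> 0" for y i
    proof -
      have "chi d y ^ i = (chi d y ^ d) ^ (i div d) * chi d y ^ (i mod d)"
        by (metis power_add power_mult mult_div_mod_eq)
      then show ?thesis using mult_character_image(2)[OF chi(1) that] chi(2) by simp
    qed
    have "(\<Prod>i\<in>?I. chi d (poly (f i) x) ^ (i mod d)) = (\<Prod>i\<in>?I. chi d (local_coeff f x j i) ^ i)"
    proof (rule prod.cong)
      fix i assume i: "i \<in> ?I"
      then have nz: "local_coeff f x j i \<noteq> 0" using lt by (simp add: local_type_def)
      \<comment> \<open>For \<open>i = j\<close> the bases may differ, value against derivative, but
        the exponent \<open>j mod d\<close> is 0 and both powers are 1.\<close>
      have "chi d (poly (f i) x) ^ (i mod d) = chi d (local_coeff f x j i) ^ (i mod d)"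
        using True by (cases "i = j") (auto simp: local_coeff_def)
      then show "chi d (poly (f i) x) ^ (i mod d) = chi d (local_coeff f x j i) ^ i" using pow[OF nz] by simp
    qed simp
    also have "\<dots> = chi d u" using lt
      by (simp add: local_type_def mult_character_power[OF chi(1), symmetric] mult_character_prod[OF chi(1), symmetric])
    finally have "chi d (\<Prod>i\<in>?I. poly (f i) x ^ (i mod d)) = chi d u"
      by (simp add: mult_character_power[OF chi(1)] mult_character_prod[OF chi(1)])
    then show ?thesis using chi(1) True unfolding eq by (simp add: mult_character_def limit_value_def)
  qed
qed

text \<open>Index 0 stands for lowering no degree, so that \<open>F_hat\<close> and all
  \<open>F_hat_minus\<close> form one family indexed by \<open>{0..<r}\<close>.\<close>

definition shift_degree :: "(nat \<Rightarrow> nat) \<Rightarrow> nat \<Rightarrow> nat \<Rightarrow> nat" where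
  "shift_degree ds j = (if j = 0 then ds else ds(j := ds j - 1))"

definition power_product :: "nat \<Rightarrow> 'a \<Rightarrow> (nat \<Rightarrow> 'a::field poly) \<Rightarrow> 'a poly" where
  "power_product r \<alpha> f = smult \<alpha> (\<Prod>i=1..<r. f i ^ i)"

definition local_types :: "nat \<Rightarrow> (nat \<times> 'a::field) set" where
  "local_types r = {0..<r} \<times> (UNIV - {0})"

definition type_maps :: "nat \<Rightarrow> ('a option \<Rightarrow> nat \<times> 'a::field) set" where
  "type_maps r = PiE UNIV (\<lambda>_. local_types r)"

text \<open>
  In \<open>t None = (j, \<alpha>)\<close>, \<open>j\<close> is the index whose root is missing (\<open>0\<close> for none) and \<open>\<alpha>\<close> the leading
  coefficient. The \<open>f\<^sub>i\<close> are monic, so the units prescribed at finite points are divided by \<open>\<alpha>\<close>.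
\<close>

definition typed_tuples :: "nat \<Rightarrow> (nat \<Rightarrow> nat) \<Rightarrow> ('a option \<Rightarrow> nat \<times> 'a::field) \<Rightarrow> (nat \<Rightarrow> 'a poly) set" where
  "typed_tuples r ds t = {f \<in> PiE {1..<r} (\<lambda>i. monics (shift_degree ds (fst (t None)) i)).
     \<forall>P\<in>monic_irreducibles. sqfree_at {1..<r} P f \<and>
       (\<forall>x. P = [:- x, 1:] \<longrightarrow> local_type {1..<r} x (fst (t (Some x))) (snd (t (Some x)) / snd (t None)) f)}"

lemma type_mapsD:
  assumes "t \<in> type_maps r" shows "fst (t p) < r" "snd (t p) \<noteq> 0"
  using assms by (auto simp: type_maps_def local_types_def PiE_iff mem_Times_iff)

lemma typed_tuplesD:
  assumes f: "f \<in> typed_tuples r ds t"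
  shows "sqfree_tuple r f" "f \<in> extensional {1..<r}"
    "i \<in> {1..<r} \<Longrightarrow> degree (f i) = shift_degree ds (fst (t None)) i"
    "local_type {1..<r} x (fst (t (Some x))) (snd (t (Some x)) / snd (t None)) f"
  using f linear_monic_irreducible[of x]
  by (auto simp: typed_tuples_def sqfree_tuple_iff PiE_iff monics_def)

text \<open>The degrees of the components are determined by the polynomial, and the shifted degree
  vectors are pairwise distinct because all degrees are at least 1. The families in
  \<open>F_hat_full\<close> are therefore disjoint.\<close>

lemma F_hat_shift_iff:
  fixes f :: "nat \<Rightarrow> 'a::field poly"
  assumes f: "sqfree_tuple r f" and deg: "\<And>i. i \<in> {1..<r} \<Longrightarrow> degree (f i) = shift_degree ds j i"
    and ds: "\<And>i. i \<in> {1..<r} \<Longrightarrow> ds i \<ge> 1" and jk: "j < r" "k < r" and al: "\<alpha> \<noteq> 0"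
  shows "power_product r \<alpha> f \<in> F_hat r (shift_degree ds k) \<longleftrightarrow> k = j"
proof
  assume "power_product r \<alpha> f \<in> F_hat r (shift_degree ds k)"
  then obtain \<beta> g where g: "\<beta> \<noteq> 0" "sqfree_tuple r g" "\<And>i. i \<in> {1..<r} \<Longrightarrow> degree (g i) = shift_degree ds k i"
    "power_product r \<alpha> f = power_product r \<beta> g"
    by (auto simp: F_hat_def F_set_def power_product_def)
  have "f i = g i" if "i \<in> {1..<r}" for i
    using decomposition_unique(2)[OF f g(2) al g(1) g(4)[unfolded power_product_def] that] .
  then have eq: "shift_degree ds j i = shift_degree ds k i" if "i \<in> {1..<r}" for i
    using deg g(3) that by metis
  show "k = j"
  proof (rule ccontr)
    assume "k \<noteq> j"
    then show False
      using eq[of j] eq[of k] ds[of j] ds[of k] jk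
      by (cases "j = 0"; cases "k = 0") (auto simp: shift_degree_def)
  qed
next
  assume "k = j"
  then show "power_product r \<alpha> f \<in> F_hat r (shift_degree ds k)"
    using f deg al unfolding F_hat_def F_set_def power_product_def by blast
qed

lemma F_hat_full_eq:
  assumes ds: "\<And>i. i \<in> {1..<r} \<Longrightarrow> ds i \<ge> 1" and r: "r \<ge> 1"
  shows "F_hat_full r ds = (\<Union>j\<in>{0..<r}. F_hat r (shift_degree ds j) :: 'a::field poly set)"
proof -
  have 0: "{0..<r} = insert 0 {1..<r}" using r by auto
  have "F_hat_minus r ds j = (F_hat r (shift_degree ds j) :: 'a poly set)" if "j \<in> {1..<r}" for j
    using ds[OF that] that by (simp add: F_hat_minus_def shift_degree_def)
  then have "(\<Union>j\<in>{1..<r}. F_hat_minus r ds j) = (\<Union>j\<in>{1..<r}. F_hat r (shift_degree ds j) :: 'a poly set)"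
    by (rule SUP_cong[OF refl])
  then show ?thesis unfolding F_hat_full_def 0 UN_insert by (simp only: shift_degree_def if_True simp_thms)
qed

text \<open>Scalar and components are recovered from the polynomial by unique decomposition, the
  index at infinity from the degrees of the components, and the types at finite points by uniqueness
  of the local type. This sorts the whole family by type maps.\<close>

lemma bij_betw_typed_tuples:
  fixes ds :: "nat \<Rightarrow> nat"
  assumes ds: "\<And>i. i \<in> {1..<r} \<Longrightarrow> ds i \<ge> 1" and r: "r \<ge> 1"
  shows "bij_betw (\<lambda>(t, f). power_product r (snd (t None)) f)
    (SIGMA t:type_maps r. typed_tuples r ds t) (F_hat_full r ds :: 'a::{field,finite} poly set)"
  unfolding bij_betw_def
proof
  have full: "F_hat_full r ds = (\<Union>j\<in>{0..<r}. F_hat r (shift_degree ds j) :: 'a poly set)"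
    by (rule F_hat_full_eq) (fact ds r)+
  show "inj_on (\<lambda>(t, f). power_product r (snd (t None)) f)
    (SIGMA t:type_maps r. typed_tuples r ds (t :: 'a option \<Rightarrow> nat \<times> 'a))"
  proof (rule inj_onI, clarify)
    fix t f t' f' assume t: "t \<in> type_maps r" "t' \<in> type_maps r"
      and f: "f \<in> typed_tuples r ds t" "f' \<in> typed_tuples r ds t'"
      and eq: "power_product r (snd (t None)) f = power_product r (snd (t' None)) (f' :: nat \<Rightarrow> 'a poly)"
    note D = typed_tuplesD[OF f(1)] and D' = typed_tuplesD[OF f(2)]
    have al: "snd (t None) = snd (t' None)" and ff: "\<And>i. i \<in> {1..<r} \<Longrightarrow> f i = f' i"
      using decomposition_unique[OF D(1) D'(1) type_mapsD(2)[OF t(1)] type_mapsD(2)[OF t(2)] eq[unfolded power_product_def]]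
      by auto
    have feq: "f = f'" using D(2) D'(2) ff by (rule extensionalityI)
    have "power_product r (snd (t None)) f \<in> F_hat r (shift_degree ds (fst (t None)))"
      using F_hat_shift_iff[OF D(1) D(3) ds] type_mapsD[OF t(1)] by blast
    moreover have "power_product r (snd (t None)) f \<in> F_hat r (shift_degree ds (fst (t None))) \<longleftrightarrow> fst (t None) = fst (t' None)"
      unfolding eq using F_hat_shift_iff[OF D'(1) D'(3) ds] type_mapsD[OF t(1)] type_mapsD[OF t(2)] by blast
    ultimately have None: "t None = t' None" using al by (simp add: prod_eq_iff)
    have "t p = t' p" for p
    proof (cases p)
      case (Some x)
      have "fst (t (Some x)) = fst (t' (Some x)) \<and> snd (t (Some x)) / snd (t None) = snd (t' (Some x)) / snd (t' None)"
        using type_mapsD(1)[OF t(1), of "Some x"] type_mapsD(1)[OF t(2), of "Some x"]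
        by (intro local_type_unique[OF _ D(4) D'(4)[folded feq]]) auto
      then show ?thesis using Some None type_mapsD(2)[OF t(2), of None] by (simp add: prod_eq_iff)
    qed (use None in simp)
    then show "t = t' \<and> f = f'" using feq by blast
  qed
  show "(\<lambda>(t, f). power_product r (snd (t None)) f) ` (SIGMA t:type_maps r. typed_tuples r ds t) = (F_hat_full r ds :: 'a poly set)"
    (is "?L = ?R")
  proof (intro equalityI subsetI)
    fix F assume "F \<in> ?L"
    then obtain t f where t: "t \<in> type_maps r" and f: "f \<in> typed_tuples r ds t"
      and F: "F = power_product r (snd (t None)) f" by auto
    have "F \<in> F_hat r (shift_degree ds (fst (t None)))"
      unfolding F using F_hat_shift_iff[OF typed_tuplesD(1,3)[OF f] ds] type_mapsD[OF t] by blast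
    then show "F \<in> ?R" using type_mapsD(1)[OF t, of None] unfolding full by auto
  next
    fix F assume "F \<in> ?R"
    then obtain j where j: "j < r" "F \<in> F_hat r (shift_degree ds j)" by (auto simp: full)
    then obtain \<alpha> g where \<alpha>: "\<alpha> \<noteq> 0" and g: "sqfree_tuple r g" "\<And>i. i \<in> {1..<r} \<Longrightarrow> degree (g i) = shift_degree ds j i"
      and F: "F = power_product r \<alpha> g"
      by (auto simp: F_hat_def F_set_def power_product_def)
    define f where "f = restrict g {1..<r}"
    have f: "sqfree_tuple r f" using g(1) by (simp add: f_def sqfree_tuple_def)
    have Ff: "F = power_product r \<alpha> f" unfolding F power_product_def by (simp add: f_def)
    have "\<exists>J U. J < r \<and> U \<noteq> 0 \<and> local_type {1..<r} x J U f" for x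
    proof -
      have "sqfree_at {1..<r} [:- x, 1:] f"
        using f linear_monic_irreducible[of x] unfolding sqfree_tuple_iff by blast
      then have "\<exists>j\<in>insert 0 {1..<r}. \<exists>u. u \<noteq> 0 \<and> local_type {1..<r} x j u f"
        by (intro local_type_exists) auto
      then obtain J U where "J \<in> insert 0 {1..<r}" "U \<noteq> 0" "local_type {1..<r} x J U f" by blast
      moreover have "J < r" using calculation(1) r by auto
      ultimately show ?thesis by blast
    qed
    then obtain J U where JU: "\<And>x. J x < r" "\<And>x. U x \<noteq> 0" "\<And>x. local_type {1..<r} x (J x) (U x) f" by metis
    \<comment> \<open>The unit of \<open>F\<close> at \<open>x\<close> is that of the monic tuple
      times the leading coefficient; the quotient in \<open>typed_tuples\<close> undoes the
      factor.\<close>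
    define t where "t p = (case p of None \<Rightarrow> (j, \<alpha>) | Some x \<Rightarrow> (J x, \<alpha> * U x))" for p
    have "t \<in> type_maps r" using j JU \<alpha> by (simp add: t_def type_maps_def local_types_def PiE_iff split: option.split)
    moreover have "f \<in> typed_tuples r ds t"
      unfolding typed_tuples_def mem_Collect_eq
    proof (intro conjI ballI allI impI)
      show "f \<in> PiE {1..<r} (\<lambda>i. monics (shift_degree ds (fst (t None)) i))"
        using g by (simp add: f_def t_def monics_def sqfree_tuple_def)
      fix P :: "'a poly" assume "P \<in> monic_irreducibles"
      then show "sqfree_at {1..<r} P f" using f unfolding sqfree_tuple_iff by blast
      fix x
      have "snd (t (Some x)) / snd (t None) = U x" "fst (t (Some x)) = J x" using \<alpha> by (simp_all add: t_def)
      then show "local_type {1..<r} x (fst (t (Some x))) (snd (t (Some x)) / snd (t None)) f"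
        using JU(3) by simp
    qed
    moreover have "F = power_product r (snd (t None)) f" using Ff by (simp add: t_def)
    ultimately show "F \<in> ?L" by (intro image_eqI[of _ _ "(t, f)"]) auto
  qed
qed

text \<open>Membership in \<open>F_hat\<close> accounts for \<open>j = 0\<close>, which every
  \<open>d\<close> divides, and the lowered families account for the positive multiples of
  \<open>d\<close>.\<close>

lemma infinity_condition_iff:
  fixes d j n :: nat
  assumes A: "A \<longleftrightarrow> j = 0" and B: "\<And>k. 1 \<le> k \<Longrightarrow> k \<le> n \<Longrightarrow> B k \<longleftrightarrow> k * d = j"
    and ex: "d dvd j \<Longrightarrow> j \<noteq> 0 \<Longrightarrow> \<exists>k. 1 \<le> k \<and> k \<le> n \<and> k * d = j"
  shows "(A \<or> (\<exists>k. 1 \<le> k \<and> k \<le> n \<and> B k)) \<longleftrightarrow> d dvd j"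
proof
  assume "A \<or> (\<exists>k. 1 \<le> k \<and> k \<le> n \<and> B k)"
  then show "d dvd j" using A B by auto
next
  assume "d dvd j"
  then show "A \<or> (\<exists>k. 1 \<le> k \<and> k \<le> n \<and> B k)" using A B ex by (cases "j = 0") blast+
qed

text \<open>At finite points this is \<open>chi_F_red\<close>; at infinity the value is the leading
  coefficient or 0 according to the lowered index. So the sum depends on the type map alone, and
  infinity is just one more point.\<close>

lemma char_sum_typed:
  fixes chi :: "nat \<Rightarrow> 'a::{field,finite} \<Rightarrow> complex"
  assumes ds: "\<And>i. i \<in> {1..<r} \<Longrightarrow> ds i \<ge> 1" and r: "r \<ge> 1"
    and chi: "mult_character (chi d)" "char_order (chi d) = d" and d: "d dvd r"
    and t: "t \<in> type_maps r" and f: "f \<in> typed_tuples r ds t"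
  shows "char_sum r ds chi d (power_product r (snd (t None)) f) = (\<Sum>p\<in>UNIV. limit_value chi d (t p))"
proof -
  let ?F = "power_product r (snd (t None)) f" and ?j = "fst (t None)" and ?\<alpha> = "snd (t None)"
  note D = typed_tuplesD[OF f] and T = type_mapsD[OF t]
  have mem: "?F \<in> F_hat r (shift_degree ds k) \<longleftrightarrow> k = ?j" if "k < r" for k
    using F_hat_shift_iff[OF D(1,3) ds T(1) that T(2)] by blast
  have d0: "d > 0" using d r by (cases "d = 0") auto
  have "(?F \<in> F_hat r ds \<or> (\<exists>k. 1 \<le> k \<and> k \<le> r div d - 1 \<and> ?F \<in> F_hat_minus r ds (k * d))) \<longleftrightarrow> d dvd ?j"
  proof -
    have 0: "?F \<in> F_hat r ds \<longleftrightarrow> ?j = 0" using mem[of 0] r by (auto simp: shift_degree_def)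
    have k: "?F \<in> F_hat_minus r ds (k * d) \<longleftrightarrow> k * d = ?j" if k: "1 \<le> k" "k \<le> r div d - 1" for k
    proof -
      have "k * d < r div d * d" using k d0 by simp
      then have "k * d < r" using d by simp
      moreover have "k * d > 0" using k d0 by simp
      ultimately show ?thesis using mem[of "k * d"] ds[of "k * d"] by (auto simp: F_hat_minus_def shift_degree_def)
    qed
    have ex: "\<exists>k. 1 \<le> k \<and> k \<le> r div d - 1 \<and> k * d = ?j" if "d dvd ?j" "?j \<noteq> 0"
    proof -
      from that(1) obtain k where "?j = d * k" by (elim dvdE)
      then have k: "?j = k * d" by (simp only: mult.commute)
      have "k * d < r div d * d" using k T(1)[of None] d by simp
      then have "k < r div d" by simp
      then show ?thesis using k that by (intro exI[of _ k]) (auto simp: Suc_le_eq)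
    qed
    show ?thesis by (rule infinity_condition_iff[OF 0 k ex])
  qed
  moreover have "lead_coeff ?F = ?\<alpha>" unfolding power_product_def by (rule lead_coeff_decomposition[OF D(1)])
  ultimately have None: "chi d (F_red_value r ds d ?F None) = limit_value chi d (t None)"
    using chi(1) by (simp add: limit_value_def mult_character_def)
  have Some: "chi d (F_red_value r ds d ?F (Some x)) = limit_value chi d (t (Some x))" for x
  proof -
    have "chi d (poly (F_red r d (smult ?\<alpha> (\<Prod>i=1..<r. f i ^ i))) x) =
        limit_value chi d (fst (t (Some x)), ?\<alpha> * (snd (t (Some x)) / ?\<alpha>))"
      by (rule chi_F_red) (fact chi D(1) T(2) D(4) T(1))+
    then show ?thesis using T(2)[of None] by (simp add: power_product_def)
  qed
  show ?thesis unfolding char_sum_def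
  proof (rule sum.cong)
    fix p show "chi d (F_red_value r ds d ?F p) = limit_value chi d (t p)"
      using None Some by (cases p) (simp_all only:)
  qed simp
qed


section \<open>Limiting frequencies of the type maps\<close>

definition type_weight :: "nat \<times> 'a::{field,finite} \<Rightarrow> real" where
  "type_weight t = (if fst t = 0 then 1 else 1 / real CARD('a))"

lemma type_weight_pos: "type_weight (t :: nat \<times> 'a::{field,finite}) > 0"
  by (simp add: type_weight_def)

lemma finite_local_types: "finite (local_types r :: (nat \<times> 'a::{field,finite}) set)"
  by (simp add: local_types_def)

lemma finite_type_maps: "finite (type_maps r :: ('a option \<Rightarrow> nat \<times> 'a::{field,finite}) set)"
  unfolding type_maps_def by (intro finite_PiE finite finite_local_types)

lemma type_maps_nonempty: "r \<ge> 1 \<Longrightarrow> (\<lambda>_. (0, 1)) \<in> type_maps r"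
  by (auto simp: type_maps_def local_types_def)

lemma eventually_degrees_ge: "eventually (\<lambda>ds. \<forall>i\<in>{1..<r}. ds i \<ge> N) (degrees_at_top r)"
proof -
  have "eventually (\<lambda>ds. ds i \<ge> N) (degrees_at_top r)" if i: "i \<in> {1..<r}" for i
    unfolding degrees_at_top_def
  proof (rule filter_leD[OF INF_lower[OF i]])
    show "eventually (\<lambda>ds. N \<le> ds i) (filtercomap (\<lambda>ds. ds i) at_top)"
      by (rule eventually_filtercomapI) (rule eventually_ge_at_top)
  qed
  then show ?thesis by (intro eventually_ball_finite) auto
qed

lemma filterlim_shift_degree: "filterlim (\<lambda>ds. shift_degree ds j) (degrees_at_top r) (degrees_at_top r)"
proof -
  have "filterlim (\<lambda>ds. shift_degree ds j) (filtercomap (\<lambda>ds. ds i) at_top) (degrees_at_top r)"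
    if i: "i \<in> {1..<r}" for i
    unfolding filterlim_filtercomap_iff filterlim_at_top o_def
  proof
    fix Z
    show "eventually (\<lambda>ds. Z \<le> shift_degree ds j i) (degrees_at_top r)"
      using eventually_degrees_ge[where N = "Z + 1"]
    proof eventually_elim
      case (elim ds)
      then have "Z + 1 \<le> ds i" using i by blast
      then show ?case by (auto simp: shift_degree_def)
    qed
  qed
  then have "filterlim (\<lambda>ds. shift_degree ds j) (INF i\<in>{1..<r}. filtercomap (\<lambda>ds. ds i) at_top) (degrees_at_top r)"
    by (simp add: filterlim_INF)
  then show ?thesis unfolding degrees_at_top_def .
qed

lemma typed_tuples_LIMSEQ:
  fixes t :: "'a option \<Rightarrow> nat \<times> 'a::{field,finite}"
  assumes r: "r \<ge> 2" and t: "t \<in> type_maps r"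
  shows "((\<lambda>ds. real (card (typed_tuples r ds t)) / real CARD('a) ^ (\<Sum>i\<in>{1..<r}. ds i)) \<longlongrightarrow>
    sieve_const TYPE('a) {1..<r} * local_density TYPE('a) {1..<r} ^ CARD('a) * (\<Prod>p\<in>UNIV. type_weight (t p)))
    (degrees_at_top r)"
proof -
  let ?I = "{1..<r}" and ?q = "real CARD('a)" and ?j = "fst (t None)"
  note T = type_mapsD[OF t]
  define Q where "Q P f \<longleftrightarrow> sqfree_at ?I P f \<and>
       (\<forall>x. P = [:- x, 1:] \<longrightarrow> local_type ?I x (fst (t (Some x))) (snd (t (Some x)) / snd (t None)) f)" for P f
  \<comment> \<open>A local type already forces square-freeness at \<open>x\<close>, so at linear
    irreducibles the first conjunct of \<open>Q\<close> is absorbed.\<close>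
  have Qlin: "Q [:- x, 1:] = local_type ?I x (fst (t (Some x))) (snd (t (Some x)) / snd (t None))" for x
    using local_type_imp_sqfree_at[of ?I x] by (auto simp: Q_def fun_eq_iff)
  have lim: "((\<lambda>e. real (card {f \<in> PiE ?I (\<lambda>i. monics (e i)). \<forall>P\<in>monic_irreducibles. Q P f}) / ?q ^ (\<Sum>i\<in>?I. e i)) \<longlongrightarrow>
      sieve_const TYPE('a) ?I * (\<Prod>x\<in>UNIV. dens ?I ([:- x, 1:]\<^sup>2) (Q [:- x, 1:]))) (degrees_at_top r)"
    unfolding degrees_at_top_def
  proof (rule sieve_asymptotic)
    fix P :: "'a poly" assume P: "P \<in> monic_irreducibles"
    show "periodic ?I (P\<^sup>2) (Q P)"
    proof (cases "P \<in> range (\<lambda>x. [:- x, 1:])")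
      case True
      then show ?thesis by (auto simp: Qlin periodic_local_type)
    next
      case False
      then have "Q P = sqfree_at ?I P" by (auto simp: Q_def fun_eq_iff)
      then show ?thesis by (simp add: periodic_sqfree_at)
    qed
    show "sqfree_at ?I P f" if "Q P f" for f using that by (simp add: Q_def)
    show "Q P f = sqfree_at ?I P f" if "degree P > 1" for f using that by (auto simp: Q_def)
  qed simp
  have "dens ?I ([:- x, 1:]\<^sup>2) (Q [:- x, 1:]) = local_density TYPE('a) ?I * type_weight (t (Some x))" for x
    unfolding Qlin type_weight_def using T[of "Some x"] T[of None] r by (intro dens_local_type) auto
  then have prod: "(\<Prod>x\<in>UNIV. dens ?I ([:- x, 1:]\<^sup>2) (Q [:- x, 1:])) =
      local_density TYPE('a) ?I ^ CARD('a) * (\<Prod>x\<in>UNIV. type_weight (t (Some x)))"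
    by (simp add: prod.distrib)
  have "((\<lambda>ds. real (card {f \<in> PiE ?I (\<lambda>i. monics (shift_degree ds ?j i)). \<forall>P\<in>monic_irreducibles. Q P f}) /
      ?q ^ (\<Sum>i\<in>?I. shift_degree ds ?j i) * type_weight (t None)) \<longlongrightarrow>
      sieve_const TYPE('a) ?I * (\<Prod>x\<in>UNIV. dens ?I ([:- x, 1:]\<^sup>2) (Q [:- x, 1:])) * type_weight (t None)) (degrees_at_top r)"
    by (intro tendsto_mult tendsto_const filterlim_compose[OF lim filterlim_shift_degree])
  also have "sieve_const TYPE('a) ?I * (\<Prod>x\<in>UNIV. dens ?I ([:- x, 1:]\<^sup>2) (Q [:- x, 1:])) * type_weight (t None) =
    sieve_const TYPE('a) ?I * local_density TYPE('a) ?I ^ CARD('a) * (\<Prod>p\<in>UNIV. type_weight (t p))"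
    unfolding prod by (simp add: UNIV_option_conv prod.reindex)
  finally show ?thesis
  proof (rule Lim_transform_eventually)
    show "eventually (\<lambda>ds. real (card {f \<in> PiE ?I (\<lambda>i. monics (shift_degree ds ?j i)). \<forall>P\<in>monic_irreducibles. Q P f}) /
      ?q ^ (\<Sum>i\<in>?I. shift_degree ds ?j i) * type_weight (t None) =
      real (card (typed_tuples r ds t)) / ?q ^ (\<Sum>i\<in>?I. ds i)) (degrees_at_top r)"
      using eventually_degrees_ge[where N = 1]
    proof eventually_elim
      case (elim ds)
      \<comment> \<open>The sieve normalises by the shifted degrees. Their total is smaller by
        exactly 1 when the index at infinity is positive, and \<open>type_weight (t None)\<close>
        compensates this.\<close>
      have "type_weight (t None) / ?q ^ (\<Sum>i\<in>?I. shift_degree ds ?j i) = 1 / ?q ^ (\<Sum>i\<in>?I. ds i)"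
      proof (cases "?j = 0")
        case True
        then show ?thesis by (simp add: type_weight_def shift_degree_def)
      next
        case False
        then have jI: "?j \<in> ?I" using T(1)[of None] by auto
        have "(\<Sum>i\<in>?I. ds i) = ds ?j + (\<Sum>i\<in>?I-{?j}. ds i)" by (rule sum.remove) (use jI in auto)
        moreover have "(\<Sum>i\<in>?I. shift_degree ds ?j i) = shift_degree ds ?j ?j + (\<Sum>i\<in>?I-{?j}. shift_degree ds ?j i)"
          by (rule sum.remove) (use jI in auto)
        moreover have "(\<Sum>i\<in>?I-{?j}. shift_degree ds ?j i) = (\<Sum>i\<in>?I-{?j}. ds i)"
          by (intro sum.cong) (auto simp: shift_degree_def)
        moreover have "ds ?j \<ge> 1" using elim jI by blast
        ultimately have "(\<Sum>i\<in>?I. ds i) = Suc (\<Sum>i\<in>?I. shift_degree ds ?j i)"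
          using False by (simp add: shift_degree_def)
        then show ?thesis using False by (simp add: type_weight_def)
      qed
      moreover have "typed_tuples r ds t = {f \<in> PiE ?I (\<lambda>i. monics (shift_degree ds ?j i)). \<forall>P\<in>monic_irreducibles. Q P f}"
        unfolding typed_tuples_def Q_def ..
      moreover have "x / a * w = x / b" if "w / a = 1 / b" for x a b w :: real
      proof -
        have "x / a * w = x * (w / a)" by simp
        then show ?thesis unfolding that by simp
      qed
      ultimately show ?case by (simp only:)
    qed
  qed
qed

definition type_sum_cond :: "nat \<Rightarrow> (nat \<Rightarrow> 'a::{field,finite} \<Rightarrow> complex) \<Rightarrow> (nat \<Rightarrow> complex) \<Rightarrow> ('a option \<Rightarrow> nat \<times> 'a) \<Rightarrow> bool" where
  "type_sum_cond r chi M t \<longleftrightarrow> (\<forall>d. d dvd r \<and> d \<noteq> 1 \<longrightarrow> (\<Sum>p\<in>UNIV. limit_value chi d (t p)) = M d)"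

lemma card_char_sum_eq:
  fixes chi :: "nat \<Rightarrow> 'a::{field,finite} \<Rightarrow> complex"
  assumes ds: "\<And>i. i \<in> {1..<r} \<Longrightarrow> ds i \<ge> 1" and r: "r \<ge> 1"
    and chi: "character_system r chi"
  shows "card {F \<in> F_hat_full r ds. \<forall>d. d dvd r \<and> d \<noteq> 1 \<longrightarrow> char_sum r ds chi d F = M d} =
      (\<Sum>t\<in>{t \<in> type_maps r. type_sum_cond r chi M t}. card (typed_tuples r ds t))"
    and "card (F_hat_full r ds :: 'a poly set) =
      (\<Sum>t\<in>(type_maps r :: ('a option \<Rightarrow> nat \<times> 'a) set). card (typed_tuples r ds t))"
proof -
  let ?\<Phi> = "\<lambda>(t, f). power_product r (snd (t None)) f :: 'a poly"
  let ?S = "SIGMA t:type_maps r. typed_tuples r ds t"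
  let ?C = "SIGMA t:{t \<in> type_maps r. type_sum_cond r chi M t}. typed_tuples r ds t"
  let ?E = "{F \<in> F_hat_full r ds. \<forall>d. d dvd r \<and> d \<noteq> 1 \<longrightarrow> char_sum r ds chi d F = M d}"
  have bij: "bij_betw ?\<Phi> ?S (F_hat_full r ds)" by (rule bij_betw_typed_tuples) (fact ds r)+
  have fin: "finite (typed_tuples r ds t)" for t :: "'a option \<Rightarrow> nat \<times> 'a"
    unfolding typed_tuples_def by (rule finite_subset[OF Collect_subset finite_PiE]) auto
  show "card (F_hat_full r ds :: 'a poly set) =
      (\<Sum>t\<in>(type_maps r :: ('a option \<Rightarrow> nat \<times> 'a) set). card (typed_tuples r ds t))"
    unfolding bij_betw_same_card[OF bij, symmetric] by (rule card_SigmaI) (use fin finite_type_maps in auto)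
  have cs: "char_sum r ds chi d (power_product r (snd (t None)) f) = (\<Sum>p\<in>UNIV. limit_value chi d (t p))"
    if "t \<in> type_maps r" "f \<in> typed_tuples r ds t" "d dvd r" for t f d
  proof -
    have "mult_character (chi d)" "char_order (chi d) = d"
      using chi that(3) unfolding character_system_def by blast+
    then show ?thesis using ds r that by (intro char_sum_typed)
  qed
  have cond: "(\<forall>d. d dvd r \<and> d \<noteq> 1 \<longrightarrow> char_sum r ds chi d (power_product r (snd (t None)) f) = M d) \<longleftrightarrow> type_sum_cond r chi M t"
    if "t \<in> type_maps r" "f \<in> typed_tuples r ds t" for t f
    unfolding type_sum_cond_def using cs[OF that] by auto
  have "?E = ?\<Phi> ` ?C"
  proof (intro equalityI subsetI)
    fix F assume F: "F \<in> ?E"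
    then have "F \<in> ?\<Phi> ` ?S" using bij by (simp add: bij_betw_def)
    then obtain t f where t: "t \<in> type_maps r" "f \<in> typed_tuples r ds t" "F = power_product r (snd (t None)) f" by auto
    then have "type_sum_cond r chi M t" using F cond[OF t(1,2)] by blast
    then show "F \<in> ?\<Phi> ` ?C" using t by (intro image_eqI[of _ _ "(t, f)"]) auto
  next
    fix F assume "F \<in> ?\<Phi> ` ?C"
    then obtain t f where t: "t \<in> type_maps r" "type_sum_cond r chi M t" "f \<in> typed_tuples r ds t"
      "F = power_product r (snd (t None)) f" by auto
    have "?\<Phi> (t, f) \<in> ?\<Phi> ` ?S" using t by (intro imageI) auto
    then have "F \<in> F_hat_full r ds" using bij t(4) by (simp add: bij_betw_def)
    then show "F \<in> ?E" using cond[OF t(1,3)] t(2,4) by blast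
  qed
  moreover have "inj_on ?\<Phi> ?C" using bij unfolding bij_betw_def by (auto elim: inj_on_subset)
  ultimately have "card ?E = card ?C" by (simp only: card_image)
  then show "card ?E = (\<Sum>t\<in>{t \<in> type_maps r. type_sum_cond r chi M t}. card (typed_tuples r ds t))"
    using finite_type_maps[of r, where 'a='a] fin by (simp only:) (intro card_SigmaI, auto)
qed

text \<open>The constant \<open>K\<close> and the normalising power of q are the same for all type
  maps and cancel. As all weights are positive, the limit is 0 only if no type map satisfies the
  conditions, which leads to the two cases.\<close>

theorem char_sum_distribution:
  fixes chi :: "nat \<Rightarrow> 'a::{field,finite} \<Rightarrow> complex"
  assumes r: "r \<ge> 2" and chi: "character_system r chi"
  shows "(\<lambda>ds. real (card {F \<in> F_hat_full r ds. \<forall>d. d dvd r \<and> d \<noteq> 1 \<longrightarrow> char_sum r ds chi d F = M d}) /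
             real (card (F_hat_full r ds :: 'a poly set)))
     \<sim>[degrees_at_top r]
     (\<lambda>_. (\<Sum>t\<in>{t \<in> type_maps r. type_sum_cond r chi M t}. \<Prod>p\<in>UNIV. type_weight (t p)) /
       (\<Sum>t\<in>(type_maps r :: ('a option \<Rightarrow> nat \<times> 'a) set). \<Prod>p\<in>UNIV. type_weight (t p)))"
    (is "?ratio \<sim>[_] (\<lambda>_. ?num / ?den)")
proof -
  let ?TC = "{t \<in> type_maps r. type_sum_cond r chi M t}"
  define K where "K = sieve_const TYPE('a) {1..<r} * local_density TYPE('a) {1..<r} ^ CARD('a)"
  define N where "N T ds = (\<Sum>t\<in>T. card (typed_tuples r ds t))" for T :: "('a option \<Rightarrow> nat \<times> 'a) set" and ds
  define s where "s ds = real CARD('a) ^ (\<Sum>i\<in>{1..<r}. ds i)" for ds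
  have s0: "s ds > 0" for ds by (simp add: s_def)
  have K: "K > 0"
    using sieve_partial_LIMSEQ(2)[of "{1..<r}", where 'a='a] local_density_pos[of "{1..<r}", where 'a='a]
    unfolding K_def by simp
  have w: "(\<Prod>p\<in>UNIV. type_weight (t p)) > 0" for t :: "'a option \<Rightarrow> nat \<times> 'a"
    by (intro prod_pos type_weight_pos)
  have lim: "((\<lambda>ds. real (N T ds) / s ds) \<longlongrightarrow> K * (\<Sum>t\<in>T. \<Prod>p\<in>UNIV. type_weight (t p))) (degrees_at_top r)"
    if "T \<subseteq> type_maps r" for T
    unfolding N_def s_def K_def of_nat_sum sum_divide_distrib sum_distrib_left
    by (intro tendsto_sum typed_tuples_LIMSEQ r) (use that in blast)
  have den: "?den > 0" using type_maps_nonempty[of r] r w finite_type_maps by (intro sum_pos) auto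
  have ev: "eventually (\<lambda>ds. real (N ?TC ds) / real (N (type_maps r) ds) = ?ratio ds) (degrees_at_top r)"
    using eventually_degrees_ge[where N = 1]
  proof eventually_elim
    case (elim ds)
    then have ds: "ds i \<ge> 1" if "i \<in> {1..<r}" for i using that by blast
    have r1: "r \<ge> 1" using r by simp
    have 1: "card {F \<in> F_hat_full r ds. \<forall>d. d dvd r \<and> d \<noteq> 1 \<longrightarrow> char_sum r ds chi d F = M d} = N ?TC ds"
      unfolding N_def by (rule card_char_sum_eq(1)) (fact ds r1 chi)+
    have 2: "card (F_hat_full r ds :: 'a poly set) = N (type_maps r) ds"
      unfolding N_def by (rule card_char_sum_eq(2)) (fact ds r1 chi)+
    show ?case unfolding 1 2 ..
  qed
  show ?thesis
  proof (cases "?TC = {}")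
    case True
    \<comment> \<open>Asymptotic equivalence to \<open>0\<close> demands that the ratio eventually is exactly \<open>0\<close>.\<close>
    have z: "N ?TC ds = 0" for ds unfolding N_def True by simp
    have num: "?num = 0" unfolding True by simp
    have "eventually (\<lambda>ds. ?ratio ds = ?num / ?den) (degrees_at_top r)"
      using ev
    proof eventually_elim
      case (elim ds)
      show ?case unfolding elim[symmetric] z num by simp
    qed
    then show ?thesis by (rule asymp_equiv_refl_ev)
  next
    case False
    have "((\<lambda>ds. (real (N ?TC ds) / s ds) / (real (N (type_maps r) ds) / s ds)) \<longlongrightarrow> (K * ?num) / (K * ?den)) (degrees_at_top r)"
      using K den by (intro tendsto_divide lim) auto
    then have "((\<lambda>ds. real (N ?TC ds) / real (N (type_maps r) ds)) \<longlongrightarrow> ?num / ?den) (degrees_at_top r)"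
      using K s0 by (simp add: less_imp_neq[THEN not_sym])
    then have "(?ratio \<longlongrightarrow> ?num / ?den) (degrees_at_top r)" using ev by (rule Lim_transform_eventually)
    moreover have "?num > 0"
      using False by (intro sum_pos finite_subset[OF Collect_subset finite_type_maps] w)
    ultimately show ?thesis using den by (intro tendsto_imp_asymp_equiv_const) auto
  qed
qed

section \<open>Characters and prime power divisors\<close>

definition exponents_ok :: "nat \<Rightarrow> (nat \<Rightarrow> nat) \<Rightarrow> bool" where
  "exponents_ok d \<sigma> \<longleftrightarrow> (\<forall>p\<in>prime_factors d. 1 \<le> \<sigma> p \<and> \<sigma> p \<le> p ^ multiplicity p d \<and>
     [\<sigma> p * (d div p ^ multiplicity p d) = 1] (mod p ^ multiplicity p d))"

lemma coprime_prime_power_cofactor: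
  fixes d p :: nat
  assumes "d > 0" "prime p"
  shows "coprime (d div p ^ multiplicity p d) (p ^ multiplicity p d)"
proof -
  have "\<not> p dvd d div p ^ multiplicity p d"
    using assms by (intro multiplicity_decompose) auto
  then have "coprime p (d div p ^ multiplicity p d)" using assms(2) by (simp add: prime_imp_coprime)
  then show ?thesis by (simp add: coprime_commute)
qed

lemma exponents_exist:
  assumes "d > 0" shows "\<exists>\<sigma>. exponents_ok d \<sigma>"
proof -
  have "\<exists>x. 1 \<le> x \<and> x \<le> p ^ multiplicity p d \<and>
      [x * (d div p ^ multiplicity p d) = 1] (mod p ^ multiplicity p d)" if p: "p \<in> prime_factors d" for p
  proof -
    let ?m = "p ^ multiplicity p d" and ?c = "d div p ^ multiplicity p d"
    have pp: "prime p" using p by auto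
    have "multiplicity p d > 0" using p by (auto simp: prime_factors_multiplicity)
    then have m1: "?m > 1" using prime_gt_1_nat[OF pp] by (intro one_less_power)
    obtain y where y: "[?c * y = 1] (mod ?m)"
      using cong_solve_coprime_nat[of ?c ?m] coprime_prime_power_cofactor[OF assms pp] by auto
    have "[(y mod ?m) * ?c = ?c * y] (mod ?m)" by (simp add: cong_def mod_mult_right_eq mult.commute)
    then have c: "[(y mod ?m) * ?c = 1] (mod ?m)" using y cong_trans by blast
    \<comment> \<open>This secures the lower bound 1 on the exponent, which later makes a vanishing
      factor stay 0 after taking powers.\<close>
    have "y mod ?m \<noteq> 0"
    proof
      assume "y mod ?m = 0"
      then have "[0 = 1] (mod ?m)" using c by simp
      moreover have "\<not> [0 = 1] (mod m)" if "m > 1" for m :: nat using that by (simp add: cong_def)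
      ultimately show False using m1 by blast
    qed
    moreover have "y mod ?m < ?m" using m1 by (intro mod_less_divisor less_trans[OF zero_less_one])
    ultimately show ?thesis using c by (intro exI[of _ "y mod ?m"] conjI) auto
  qed
  then have "\<forall>p\<in>prime_factors d. \<exists>x. 1 \<le> x \<and> x \<le> p ^ multiplicity p d \<and>
      [x * (d div p ^ multiplicity p d) = 1] (mod p ^ multiplicity p d)" by blast
  then show ?thesis unfolding exponents_ok_def by (rule bchoice)
qed

lemma cong_prime_powers:
  fixes d x y :: nat
  assumes "d > 0" "\<And>p. p \<in> prime_factors d \<Longrightarrow> [x = y] (mod p ^ multiplicity p d)"
  shows "[x = y] (mod d)"
proof -
  have "[x = y] (mod (\<Prod>p\<in>prime_factors d. p ^ multiplicity p d))"
    using assms(2) by (intro coprime_cong_prod_nat) (auto intro: primes_coprime)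
  then show ?thesis using prime_factorization_nat[OF assms(1)] by simp
qed

lemma prime_power_dvd_cofactor:
  fixes d p p' :: nat
  assumes d: "d > 0" and p: "p \<in> prime_factors d" "p' \<in> prime_factors d" "p \<noteq> p'"
  shows "p ^ multiplicity p d dvd d div p' ^ multiplicity p' d"
proof -
  have "coprime (p ^ multiplicity p d) (p' ^ multiplicity p' d)"
    using p by (auto intro: primes_coprime)
  moreover have "p ^ multiplicity p d dvd (d div p' ^ multiplicity p' d) * p' ^ multiplicity p' d"
    by (simp add: multiplicity_dvd)
  ultimately show ?thesis by (simp add: coprime_dvd_mult_left_iff)
qed

text \<open>Modulo the full power of \<open>p\<close> in \<open>d\<close>, the terms of the other
  primes vanish, since that power divides their cofactors; the term at \<open>p\<close> is 1 by the
  choice of \<open>\<sigma> p\<close>.\<close>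

lemma sum_exponents:
  assumes d: "d > 0" and \<sigma>: "exponents_ok d \<sigma>"
  shows "[(\<Sum>p\<in>prime_factors d. \<sigma> p * (d div p ^ multiplicity p d)) = 1] (mod d)"
proof (rule cong_prime_powers[OF d])
  fix p assume p: "p \<in> prime_factors d"
  let ?m = "p ^ multiplicity p d"
  have "[(\<Sum>p'\<in>prime_factors d - {p}. \<sigma> p' * (d div p' ^ multiplicity p' d)) = 0] (mod ?m)"
  proof -
    have "?m dvd (\<Sum>p'\<in>prime_factors d - {p}. \<sigma> p' * (d div p' ^ multiplicity p' d))"
      using prime_power_dvd_cofactor[OF d p] by (intro dvd_sum dvd_mult) auto
    then show ?thesis by (simp add: cong_0_iff)
  qed
  then have "[\<sigma> p * (d div ?m) + (\<Sum>p'\<in>prime_factors d - {p}. \<sigma> p' * (d div p' ^ multiplicity p' d)) = 1 + 0] (mod ?m)"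
    using \<sigma> p by (intro cong_add) (auto simp: exponents_ok_def)
  then show "[(\<Sum>p\<in>prime_factors d. \<sigma> p * (d div p ^ multiplicity p d)) = 1] (mod ?m)"
    using p by (subst sum.remove[of _ p]) auto
qed

lemma unity_root_power_cong:
  assumes "z \<in> unity_roots n" "[a = b] (mod n)"
  shows "z ^ a = z ^ b"
proof -
  have "z ^ a = z ^ (a mod n)" for a
  proof -
    have "z ^ a = (z ^ n) ^ (a div n) * z ^ (a mod n)" by (metis power_add power_mult mult_div_mod_eq)
    then show ?thesis using assms(1) by (simp add: unity_roots_def)
  qed
  then show ?thesis using assms(2) by (metis cong_def)
qed

lemma unity_roots_nonzero: "n > 0 \<Longrightarrow> z \<in> unity_roots n \<Longrightarrow> z \<noteq> 0"
  by (auto simp: unity_roots_def power_0_left)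

section \<open>Compatible systems of characters\<close>

locale compatible_characters =
  fixes r :: nat and chi :: "nat \<Rightarrow> 'a::{field,finite} \<Rightarrow> complex"
  assumes r: "r \<ge> 2" and chi: "character_system r chi"
begin

lemma chi_mult: "d dvd r \<Longrightarrow> mult_character (chi d)"
  and chi_order: "d dvd r \<Longrightarrow> char_order (chi d) = d"
  using chi unfolding character_system_def by blast+

lemma divisor_pos: "d dvd r \<Longrightarrow> d > 0"
  using r by (auto intro: Nat.gr0I)

lemma chi_power_dvd: "a dvd d \<Longrightarrow> d dvd r \<Longrightarrow> chi a x = chi d x ^ (d div a)"
proof -
  assume a: "a dvd d" "d dvd r"
  then have "a dvd r" using dvd_trans by blast
  then have "chi a x = chi r x ^ (r div a)" using chi unfolding character_system_def by blast
  moreover have "chi d x = chi r x ^ (r div d)" using chi a unfolding character_system_def by blast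
  moreover have "r div a = (r div d) * (d div a)"
  proof -
    obtain k l where kl: "d = a * k" "r = d * l" using a by (elim dvdE)
    then have "a > 0" "d > 0" using r by (auto intro!: Nat.gr0I)
    then show ?thesis using kl by simp
  qed
  ultimately show ?thesis by (simp add: power_mult)
qed

lemma chi_unity_root: "d dvd r \<Longrightarrow> u \<noteq> 0 \<Longrightarrow> chi d u \<in> unity_roots d"
  using mult_character_image(2)[OF chi_mult, of d u] chi_order[of d] by (simp add: unity_roots_def)

lemma chi_nonzero: "d dvd r \<Longrightarrow> u \<noteq> 0 \<Longrightarrow> chi d u \<noteq> 0"
  using mult_character_nonzero[OF chi_mult] .

text \<open>Each character of prime power order is a power of \<open>chi d\<close>, with the
  cofactor as exponent. The product is thus \<open>chi d u\<close> raised to the sum of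
  \<open>sum_exponents\<close>, which is 1 modulo \<open>d\<close>.\<close>

lemma chi_prod_prime_powers:
  assumes d: "d dvd r" and u: "u \<noteq> 0" and \<sigma>: "exponents_ok d \<sigma>"
  shows "chi d u = (\<Prod>p\<in>prime_factors d. chi (p ^ multiplicity p d) u ^ \<sigma> p)"
proof -
  have "(\<Prod>p\<in>prime_factors d. chi (p ^ multiplicity p d) u ^ \<sigma> p) =
      (\<Prod>p\<in>prime_factors d. chi d u ^ (\<sigma> p * (d div p ^ multiplicity p d)))"
    using chi_power_dvd[OF multiplicity_dvd d] by (intro prod.cong) (simp_all add: power_mult[symmetric] mult.commute)
  also have "\<dots> = chi d u ^ (\<Sum>p\<in>prime_factors d. \<sigma> p * (d div p ^ multiplicity p d))"
    by (simp add: power_sum)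
  also have "\<dots> = chi d u ^ 1"
    using unity_root_power_cong[OF chi_unity_root[OF d u] sum_exponents[OF divisor_pos[OF d] \<sigma>]] .
  finally show ?thesis by simp
qed

text \<open>When \<open>d\<close> divides the index this is the formula for characters. Otherwise
  some full prime power of \<open>d\<close> fails to divide the index, and its factor is 0 because
  the exponent is at least 1.\<close>

lemma limit_value_prod_prime_powers:
  assumes d: "d dvd r" and u: "snd t \<noteq> 0" and \<sigma>: "exponents_ok d \<sigma>"
  shows "limit_value chi d t = (\<Prod>p\<in>prime_factors d. limit_value chi (p ^ multiplicity p d) t ^ \<sigma> p)"
proof (cases "d dvd fst t")
  case True
  have "limit_value chi (p ^ multiplicity p d) t = chi (p ^ multiplicity p d) (snd t)" for p
    using dvd_trans[OF multiplicity_dvd True, of p] unfolding limit_value_def by (rule if_P)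
  moreover have "limit_value chi d t = chi d (snd t)" using True unfolding limit_value_def by (rule if_P)
  ultimately show ?thesis using chi_prod_prime_powers[OF d u \<sigma>] by (simp only:)
next
  case False
  have "\<exists>p\<in>prime_factors d. \<not> p ^ multiplicity p d dvd fst t"
    using cong_prime_powers[OF divisor_pos[OF d], of "fst t" 0] False unfolding cong_0_iff by blast
  then obtain p where p: "p \<in> prime_factors d" "\<not> p ^ multiplicity p d dvd fst t" by blast
  then have "limit_value chi (p ^ multiplicity p d) t ^ \<sigma> p = 0"
  proof -
    have "limit_value chi (p ^ multiplicity p d) t = 0" using p(2) unfolding limit_value_def by (rule if_not_P)
    moreover have "\<sigma> p \<ge> 1" using \<sigma> p(1) unfolding exponents_ok_def by blast
    ultimately show ?thesis by (simp add: power_0_left)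
  qed
  then have "(\<Prod>p\<in>prime_factors d. limit_value chi (p ^ multiplicity p d) t ^ \<sigma> p) = 0"
    using p(1) by (intro prod_zero) auto
  then show ?thesis using False by (simp add: limit_value_def)
qed

lemma limit_value_1:
  assumes "snd t \<noteq> 0" shows "limit_value chi 1 t = 1"
proof -
  have "chi 1 (snd t) \<in> unity_roots 1" by (rule chi_unity_root[OF one_dvd assms])
  then show ?thesis unfolding limit_value_def unity_roots_def by simp
qed

lemma limit_value_eq_0_iff: "d dvd r \<Longrightarrow> snd t \<noteq> 0 \<Longrightarrow> limit_value chi d t = 0 \<longleftrightarrow> \<not> d dvd fst t"
  using chi_nonzero[of d "snd t"] unfolding limit_value_def by presburger

lemma limit_value_eq_unity_root_iff:
  "d dvd r \<Longrightarrow> e \<in> unity_roots d \<Longrightarrow> limit_value chi d t = e \<longleftrightarrow> d dvd fst t \<and> chi d (snd t) = e"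
  using unity_roots_nonzero[OF divisor_pos, of d e] unfolding limit_value_def by presburger

lemma prime_power_dvd_r: "p \<in> prime_factors r \<Longrightarrow> s \<le> multiplicity p r \<Longrightarrow> p ^ s dvd r"
  by (rule multiplicity_dvd')

lemma prime_power_dvd_iff:
  assumes "d dvd r" "p \<in> prime_factors r"
  shows "p ^ s dvd d \<longleftrightarrow> s \<le> multiplicity p d"
  using assms divisor_pos[OF assms(1)] prime_gt_1_nat[of p] by (intro power_dvd_iff_le_multiplicity) auto

lemma multiplicity_le: "d dvd r \<Longrightarrow> multiplicity p d \<le> multiplicity p r"
  using divisor_pos[of r] by (intro dvd_imp_multiplicity_le) auto

lemma chi_prime_power_step:
  assumes "p \<in> prime_factors r" "1 \<le> s" "s \<le> multiplicity p r"
  shows "chi (p ^ (s - 1)) u = chi (p ^ s) u ^ p"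
proof -
  have "p > 0" using prime_gt_0_nat[OF in_prime_factors_imp_prime[OF assms(1)]] .
  moreover have "p ^ s = p ^ (s - 1) * p" using assms(2) by (metis power_minus_mult Suc_le_eq One_nat_def)
  ultimately have "p ^ s div p ^ (s - 1) = p" by simp
  then show ?thesis
    using chi_power_dvd[of "p ^ (s - 1)" "p ^ s" u] prime_power_dvd_r[OF assms(1,3)] by (simp add: le_imp_power_dvd)
qed

text \<open>The vanishing pattern of all prime power characters at index \<open>j\<close> amounts to
  the single number \<open>gcd j r\<close>; in this form the indices are counted by Euler's
  function.\<close>

lemma gcd_eq_iff_prime_powers:
  assumes d: "d dvd r"
  shows "(\<forall>p\<in>prime_factors r. (\<forall>s\<in>{1..multiplicity p d}. p ^ s dvd j) \<and>
      (\<forall>s\<in>{multiplicity p d<..multiplicity p r}. \<not> p ^ s dvd j)) \<longleftrightarrow> gcd j r = d"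
    (is "?L \<longleftrightarrow> ?R")
proof
  assume g: ?R
  have iff: "p ^ s dvd j \<longleftrightarrow> s \<le> multiplicity p d" if "p \<in> prime_factors r" "s \<le> multiplicity p r" for p s
    using prime_power_dvd_iff[OF d that(1)] prime_power_dvd_r[OF that] g by (metis gcd_greatest gcd_dvd1 dvd_trans)
  show ?L
  proof (intro ballI conjI)
    fix p s assume p: "p \<in> prime_factors r"
    show "p ^ s dvd j" if "s \<in> {1..multiplicity p d}"
      using iff[OF p, of s] multiplicity_le[OF d, of p] that by simp
    show "\<not> p ^ s dvd j" if "s \<in> {multiplicity p d<..multiplicity p r}"
      using iff[OF p, of s] that by simp
  qed
next
  assume L: ?L
  have d0: "d > 0" using divisor_pos[OF d] .
  have pf: "prime_factors d \<subseteq> prime_factors r" using d r by (intro dvd_prime_factors) auto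
  have "[j = 0] (mod d)"
  proof (rule cong_prime_powers[OF d0])
    fix p assume p: "p \<in> prime_factors d"
    then have "multiplicity p d \<ge> 1" by (simp add: prime_factors_multiplicity Suc_le_eq)
    then have "multiplicity p d \<in> {1..multiplicity p d}" by simp
    then have "p ^ multiplicity p d dvd j" using L pf p by blast
    then show "[j = 0] (mod p ^ multiplicity p d)" by (simp add: cong_0_iff)
  qed
  then have "d dvd gcd j r" using d by (simp add: cong_0_iff)
  then obtain k where k: "gcd j r = d * k" by (elim dvdE)
  \<comment> \<open>A prime factor \<open>p\<close> of \<open>k\<close> would give one more power of
    \<open>p\<close> dividing both \<open>j\<close> and \<open>r\<close>, against the second half of
    the pattern.\<close>
  have "k = 1"
  proof (rule ccontr)
    assume "k \<noteq> 1"
    then obtain p where p: "prime p" "p dvd k" using prime_factor_nat by blast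
    have "d * p dvd gcd j r" using k p by (simp add: mult_dvd_mono)
    moreover have "p ^ Suc (multiplicity p d) dvd d * p"
      using multiplicity_dvd[of p d] by (simp add: mult_dvd_mono mult.commute)
    ultimately have *: "p ^ Suc (multiplicity p d) dvd gcd j r" by (rule dvd_trans[rotated])
    then have 1: "p ^ Suc (multiplicity p d) dvd j" "p ^ Suc (multiplicity p d) dvd r" by auto
    have "p dvd p ^ Suc (multiplicity p d)" by simp
    then have pr: "p \<in> prime_factors r" using p(1) 1(2) r by (auto simp: prime_factors_dvd intro: dvd_trans)
    then have "Suc (multiplicity p d) \<le> multiplicity p r" using prime_power_dvd_iff[OF dvd_refl pr] 1(2) by blast
    then have "Suc (multiplicity p d) \<in> {multiplicity p d<..multiplicity p r}" by simp
    then show False using L pr 1(1) by blast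
  qed
  then show ?R using k by simp
qed

lemma card_chi_fiber:
  assumes "d dvd r" "e \<in> unity_roots d"
  shows "d * card {u. u \<noteq> 0 \<and> chi d u = e} = CARD('a) - 1"
  using card_char_fiber[OF chi_mult[OF assms(1)], of e] chi_order[OF assms(1)] assms(2) by simp

text \<open>A compatible family of prescribed values is the same as one \<open>d\<close>-th root of
  unity \<open>z\<close>, glued from the values at the full prime powers of \<open>d\<close>. The
  conditions on \<open>u\<close> then become \<open>chi d u = z\<close>, and the fibre of
  \<open>z\<close> is known.\<close>

lemma card_chi_compatible:
  assumes d: "d dvd r" and \<epsilon>: "\<And>k. k dvd r \<Longrightarrow> \<epsilon> k \<in> unity_roots k"
    and compat: "\<And>p s. p \<in> prime_factors r \<Longrightarrow> s \<in> {1..multiplicity p d} \<Longrightarrow> \<epsilon> (p ^ (s - 1)) = \<epsilon> (p ^ s) ^ p"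
  shows "d * card {u. u \<noteq> 0 \<and> (\<forall>p\<in>prime_factors r. \<forall>s\<in>{1..multiplicity p d}. chi (p ^ s) u = \<epsilon> (p ^ s))} = CARD('a) - 1"
proof -
  have d0: "d > 0" using divisor_pos[OF d] .
  have pf: "prime_factors d \<subseteq> prime_factors r" using d r by (intro dvd_prime_factors) auto
  obtain \<sigma> where \<sigma>: "exponents_ok d \<sigma>" using exponents_exist[OF d0] by blast
  \<comment> \<open>The only candidate for \<open>chi d u\<close>, by the product formula for
    characters.\<close>
  define z where "z = (\<Prod>p\<in>prime_factors d. \<epsilon> (p ^ multiplicity p d) ^ \<sigma> p)"
  have pd: "p ^ multiplicity p d dvd r" for p using multiplicity_dvd d dvd_trans by blast
  have eps: "\<epsilon> (p ^ multiplicity p d) ^ (p ^ multiplicity p d * m) = 1" for p m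
    using \<epsilon>[OF pd, of p] by (simp add: unity_roots_def power_mult)
  have "z ^ d = 1"
  proof -
    have "\<epsilon> (p ^ multiplicity p d) ^ (\<sigma> p * d) = 1" for p
    proof -
      have "p ^ multiplicity p d dvd \<sigma> p * d" using multiplicity_dvd by (rule dvd_mult)
      then obtain m where "\<sigma> p * d = p ^ multiplicity p d * m" by (elim dvdE)
      then show ?thesis using eps[of p m] by (simp only:)
    qed
    then show ?thesis by (simp add: z_def prod_power_distrib power_mult[symmetric])
  qed
  then have zd: "z \<in> unity_roots d" by (simp add: unity_roots_def)
  \<comment> \<open>Raising to this exponent makes the factors of the other primes trivial, since
    their orders divide it; at \<open>p\<close> itself the exponent is inverse to
    \<open>\<sigma> p\<close>.\<close>
  have zp: "z ^ (d div p ^ multiplicity p d) = \<epsilon> (p ^ multiplicity p d)" if p: "p \<in> prime_factors d" for p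
  proof -
    let ?c = "d div p ^ multiplicity p d"
    have "z ^ ?c = (\<Prod>p'\<in>prime_factors d. \<epsilon> (p' ^ multiplicity p' d) ^ (\<sigma> p' * ?c))"
      by (simp add: z_def prod_power_distrib power_mult[symmetric])
    also have "\<dots> = \<epsilon> (p ^ multiplicity p d) ^ (\<sigma> p * ?c) *
        (\<Prod>p'\<in>prime_factors d - {p}. \<epsilon> (p' ^ multiplicity p' d) ^ (\<sigma> p' * ?c))"
      using p by (intro prod.remove) auto
    also have "(\<Prod>p'\<in>prime_factors d - {p}. \<epsilon> (p' ^ multiplicity p' d) ^ (\<sigma> p' * ?c)) = 1"
    proof (intro prod.neutral ballI)
      fix p' assume "p' \<in> prime_factors d - {p}"
      then have "p' ^ multiplicity p' d dvd ?c" using p by (intro prime_power_dvd_cofactor d0) auto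
      then obtain m where "?c = p' ^ multiplicity p' d * m" by (elim dvdE)
      then show "\<epsilon> (p' ^ multiplicity p' d) ^ (\<sigma> p' * ?c) = 1"
        using eps[of p' "m * \<sigma> p'"] by (simp only: mult.assoc mult.commute[of "\<sigma> p'"])
    qed
    also have "\<epsilon> (p ^ multiplicity p d) ^ (\<sigma> p * ?c) = \<epsilon> (p ^ multiplicity p d) ^ 1"
      using \<sigma> p by (intro unity_root_power_cong[OF \<epsilon>[OF pd]]) (auto simp: exponents_ok_def)
    finally show ?thesis by simp
  qed
  have "(\<forall>p\<in>prime_factors r. \<forall>s\<in>{1..multiplicity p d}. chi (p ^ s) u = \<epsilon> (p ^ s)) \<longleftrightarrow> chi d u = z"
    if u: "u \<noteq> 0" for u
  proof
    assume L: "\<forall>p\<in>prime_factors r. \<forall>s\<in>{1..multiplicity p d}. chi (p ^ s) u = \<epsilon> (p ^ s)"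
    have "chi (p ^ multiplicity p d) u = \<epsilon> (p ^ multiplicity p d)" if p: "p \<in> prime_factors d" for p
    proof -
      have "multiplicity p d \<ge> 1" using p by (simp add: prime_factors_multiplicity Suc_le_eq)
      then have "multiplicity p d \<in> {1..multiplicity p d}" by simp
      then show ?thesis using L pf p by blast
    qed
    then show "chi d u = z" unfolding chi_prod_prime_powers[OF d u \<sigma>] z_def by (intro prod.cong) auto
  next
    assume R: "chi d u = z"
    show "\<forall>p\<in>prime_factors r. \<forall>s\<in>{1..multiplicity p d}. chi (p ^ s) u = \<epsilon> (p ^ s)"
    proof (intro ballI)
      fix p s assume p: "p \<in> prime_factors r" and s: "s \<in> {1..multiplicity p d}"
      let ?v = "multiplicity p d"
      have pfd: "p \<in> prime_factors d" using p s by (auto simp: prime_factors_multiplicity)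
      have "s \<le> ?v" using s by simp
      \<comment> \<open>Downward induction from the top exponent, where the equation comes from
        \<open>z\<close>; each step down takes \<open>p\<close>-th powers on both sides.\<close>
      then show "chi (p ^ s) u = \<epsilon> (p ^ s)"
      proof (induction s rule: inc_induct)
        case base
        then show ?case using zp[OF pfd] R chi_power_dvd[OF multiplicity_dvd d, of p u] by simp
      next
        case (step n)
        have "Suc n \<in> {1..?v}" using step.hyps by simp
        then show ?case using step.IH compat[OF p, of "Suc n"] chi_prime_power_step[OF p, of "Suc n" u] multiplicity_le[OF d, of p]
          by simp
      qed
    qed
  qed
  then have "{u. u \<noteq> 0 \<and> (\<forall>p\<in>prime_factors r. \<forall>s\<in>{1..multiplicity p d}. chi (p ^ s) u = \<epsilon> (p ^ s))} =
      {u. u \<noteq> 0 \<and> chi d u = z}" by blast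
  then show ?thesis using card_chi_fiber[OF d zd] by simp
qed

text \<open>Values of characters at one unit are always compatible, so an incompatible family is
  attained by no unit. This is the case of probability 0.\<close>

lemma chi_compatible:
  assumes d: "d dvd r" and u: "u \<noteq> 0" and \<epsilon>: "\<And>k. k dvd r \<Longrightarrow> \<epsilon> k \<in> unity_roots k"
    and eq: "\<forall>p\<in>prime_factors r. \<forall>s\<in>{1..multiplicity p d}. chi (p ^ s) u = \<epsilon> (p ^ s)"
    and p: "p \<in> prime_factors r" and s: "s \<in> {1..multiplicity p d}"
  shows "\<epsilon> (p ^ (s - 1)) = \<epsilon> (p ^ s) ^ p"
proof -
  have "s \<le> multiplicity p r" using s multiplicity_le[OF d, of p] by simp
  then have step: "chi (p ^ (s - 1)) u = chi (p ^ s) u ^ p" using s p by (intro chi_prime_power_step) auto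
  have "chi (p ^ (s - 1)) u = \<epsilon> (p ^ (s - 1))"
  \<comment> \<open>For \<open>s = 1\<close> the left side belongs to order 1, where both the
    character and the prescribed value are 1.\<close>
  proof (cases "s = 1")
    case True
    then show ?thesis using \<epsilon>[of 1] chi_unity_root[of 1 u] u by (simp add: unity_roots_def)
  next
    case False
    then have "s - 1 \<in> {1..multiplicity p d}" using s by auto
    then show ?thesis using eq p by blast
  qed
  then show ?thesis using step eq p s by metis
qed

end

section \<open>The limiting random variables\<close>

text \<open>The hypothesis \<open>total\<close> confines each variable to \<open>S\<close> almost
  surely. Up to a null set the event is then a finite disjoint union of the sets where all values
  are fixed, and independence evaluates these. Arguing almost surely allows variables with other
  values on a null set.\<close>

lemma (in prob_space) prob_partition:
  assumes I: "finite I" and S: "finite S"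
    and ev: "\<And>i s. i \<in> I \<Longrightarrow> s \<in> S \<Longrightarrow> {\<omega> \<in> space M. Z i \<omega> = s} \<in> events"
    and total: "\<And>i. i \<in> I \<Longrightarrow> (\<Sum>s\<in>S. prob {\<omega> \<in> space M. Z i \<omega> = s}) = 1"
    and indep: "\<And>s. s \<in> PiE I (\<lambda>_. S) \<Longrightarrow>
      prob {\<omega> \<in> space M. \<forall>i\<in>I. Z i \<omega> = s i} = (\<Prod>i\<in>I. prob {\<omega> \<in> space M. Z i \<omega> = s i})"
    and C: "{\<omega> \<in> space M. C \<omega>} \<in> events"
    and D: "\<And>\<omega> s. \<omega> \<in> space M \<Longrightarrow> s \<in> PiE I (\<lambda>_. S) \<Longrightarrow> (\<And>i. i \<in> I \<Longrightarrow> Z i \<omega> = s i) \<Longrightarrow> C \<omega> \<longleftrightarrow> D s"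
  shows "prob {\<omega> \<in> space M. C \<omega>} = (\<Sum>s\<in>{s \<in> PiE I (\<lambda>_. S). D s}. \<Prod>i\<in>I. prob {\<omega> \<in> space M. Z i \<omega> = s i})"
proof -
  define E where "E s = {\<omega> \<in> space M. \<forall>i\<in>I. Z i \<omega> = s i}" for s
  let ?T = "{s \<in> PiE I (\<lambda>_. S). D s}"
  have finT: "finite ?T" by (rule finite_subset[OF Collect_subset finite_PiE[OF I S]])
  have E_ev: "E s \<in> events" if s: "s \<in> PiE I (\<lambda>_. S)" for s
    unfolding E_def using ev s by (intro sets.sets_Collect_finite_All[OF _ I]) (auto simp: PiE_iff)
  have ae: "AE \<omega> in M. Z i \<omega> \<in> S" if i: "i \<in> I" for i
  proof -
    have "prob (\<Union>s\<in>S. {\<omega> \<in> space M. Z i \<omega> = s}) = (\<Sum>s\<in>S. prob {\<omega> \<in> space M. Z i \<omega> = s})"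
      using S ev[OF i] by (intro finite_measure_finite_Union) (auto simp: disjoint_family_on_def)
    then have "prob (\<Union>s\<in>S. {\<omega> \<in> space M. Z i \<omega> = s}) = 1" using total[OF i] by simp
    then have "AE \<omega> in M. \<omega> \<in> (\<Union>s\<in>S. {\<omega> \<in> space M. Z i \<omega> = s})" by (rule AE_prob_1)
    then show ?thesis by eventually_elim auto
  qed
  have "AE \<omega> in M. \<forall>i\<in>I. Z i \<omega> \<in> S" using ae I by (intro AE_finite_allI)
  then have "AE \<omega> in M. \<omega> \<in> {\<omega> \<in> space M. C \<omega>} \<longleftrightarrow> \<omega> \<in> (\<Union>s\<in>?T. E s)"
    using AE_space
  proof eventually_elim
    case (elim \<omega>)
    define s where "s = restrict (\<lambda>i. Z i \<omega>) I"
    have s: "s \<in> PiE I (\<lambda>_. S)" using elim by (simp add: s_def)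
    have "s' = s" if "s' \<in> PiE I (\<lambda>_. S)" "\<omega> \<in> E s'" for s'
      using that by (auto simp: s_def E_def PiE_iff extensional_def fun_eq_iff)
    moreover have "\<omega> \<in> E s" using elim(2) by (simp add: E_def s_def)
    ultimately have "\<omega> \<in> (\<Union>s\<in>?T. E s) \<longleftrightarrow> D s" using s by blast
    moreover have "C \<omega> \<longleftrightarrow> D s" using D[OF elim(2) s] by (simp add: s_def)
    ultimately show ?case using elim(2) by blast
  qed
  then have "prob {\<omega> \<in> space M. C \<omega>} = prob (\<Union>s\<in>?T. E s)"
    using C E_ev finT by (intro finite_measure_eq_AE sets.finite_UN) auto
  also have "\<dots> = (\<Sum>s\<in>?T. prob (E s))"
  proof (intro finite_measure_finite_Union finT)
    show "E ` ?T \<subseteq> events" using E_ev by blast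
    show "disjoint_family_on E ?T"
      unfolding disjoint_family_on_def
    proof (intro ballI impI)
      fix s s' assume s: "s \<in> ?T" "s' \<in> ?T" "s \<noteq> s'"
      then obtain i where "i \<in> I" "s i \<noteq> s' i" by (metis (mono_tags, lifting) PiE_ext mem_Collect_eq)
      then show "E s \<inter> E s' = {}" by (auto simp: E_def)
    qed
  qed
  also have "\<dots> = (\<Sum>s\<in>?T. \<Prod>i\<in>I. prob {\<omega> \<in> space M. Z i \<omega> = s i})"
    unfolding E_def using indep by (intro sum.cong) auto
  finally show ?thesis .
qed

section \<open>The law of a single local type\<close>

lemma sum_type_weight:
  fixes A :: "nat \<Rightarrow> bool" and B :: "'a::{field,finite} \<Rightarrow> bool"
  assumes r: "r \<ge> 1"
  shows "(\<Sum>t\<in>{t \<in> local_types r. A (fst t) \<and> B (snd t)}. type_weight t) =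
    (of_bool (A 0) + real (card {j \<in> {1..<r}. A j}) / real CARD('a)) * real (card {u :: 'a. u \<noteq> 0 \<and> B u})"
proof -
  let ?w = "\<lambda>j::nat. if j = 0 then 1 else 1 / real CARD('a)"
  have "{t \<in> local_types r. A (fst t) \<and> B (snd t)} = {j \<in> {0..<r}. A j} \<times> {u :: 'a. u \<noteq> 0 \<and> B u}"
    by (auto simp: local_types_def)
  then have "(\<Sum>t\<in>{t \<in> local_types r. A (fst t) \<and> B (snd t)}. type_weight t) =
      (\<Sum>(j, u)\<in>{j \<in> {0..<r}. A j} \<times> {u :: 'a. u \<noteq> 0 \<and> B u}. ?w j)"
    by (simp add: type_weight_def case_prod_unfold)
  also have "\<dots> = (\<Sum>j\<in>{j \<in> {0..<r}. A j}. ?w j) * real (card {u :: 'a. u \<noteq> 0 \<and> B u})"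
    unfolding sum.cartesian_product[symmetric] sum_distrib_right by (simp add: mult.commute)
  also have "(\<Sum>j\<in>{j \<in> {0..<r}. A j}. ?w j) = (\<Sum>j\<in>{0..<r}. if A j then ?w j else 0)"
    by (rule sum.inter_filter) simp
  also have "\<dots> = (if A 0 then 1 else 0) + (\<Sum>j\<in>{1..<r}. if A j then ?w j else 0)"
    using r by (subst sum.atLeast_Suc_lessThan) auto
  also have "(\<Sum>j\<in>{1..<r}. if A j then ?w j else 0) = (\<Sum>j\<in>{j \<in> {1..<r}. A j}. ?w j)"
    by (rule sum.inter_filter[symmetric]) simp
  also have "\<dots> = (\<Sum>j\<in>{j \<in> {1..<r}. A j}. 1 / real CARD('a))" by (rule sum.cong) auto
  finally show ?thesis by simp
qed

lemma total_type_weight: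
  assumes r: "r \<ge> 1"
  shows "(\<Sum>t\<in>(local_types r :: (nat \<times> 'a::{field,finite}) set). type_weight t) =
    (real CARD('a) - 1) * (real CARD('a) + real r - 1) / real CARD('a)"
proof -
  have "card {u :: 'a. u \<noteq> 0} = CARD('a) - 1" by (simp add: Collect_neg_eq Compl_eq_Diff_UNIV card_Diff_singleton)
  then have "real (card {u :: 'a. u \<noteq> 0}) = real CARD('a) - 1" using card_field_ge_2[where 'a='a] by simp
  then have u: "real (card {u :: 'a. u \<noteq> 0 \<and> True}) = real CARD('a) - 1" by simp
  have "{j \<in> {1..<r}. True} = {1..<r}" by blast
  then have j: "real (card {j \<in> {1..<r}. True}) = real r - 1" using r by (simp only: card_atLeastLessThan)
  have "(local_types r :: (nat \<times> 'a) set) = {t \<in> local_types r. True \<and> True}" by blast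
  then have "(\<Sum>t\<in>(local_types r :: (nat \<times> 'a) set). type_weight t) = (of_bool True + (real r - 1) / real CARD('a)) * (real CARD('a) - 1)"
    using sum_type_weight[OF r, of "\<lambda>_. True" "\<lambda>_::'a. True", unfolded u j] by (simp only:)
  then show ?thesis by (simp add: field_simps)
qed

definition type_pmf :: "nat \<Rightarrow> (nat \<times> 'a::{field,finite}) pmf" where
  "type_pmf r = embed_pmf (\<lambda>t. if t \<in> local_types r then type_weight t / (\<Sum>t\<in>(local_types r :: (nat \<times> 'a) set). type_weight t) else 0)"

lemma total_type_weight_pos:
  assumes "r \<ge> 1" shows "(\<Sum>t\<in>(local_types r :: (nat \<times> 'a::{field,finite}) set). type_weight t) > 0"
proof -
  have "(0, 1) \<in> (local_types r :: (nat \<times> 'a) set)" using assms by (simp add: local_types_def)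
  then show ?thesis by (intro sum_pos finite_local_types type_weight_pos) blast
qed

lemma pmf_type_pmf:
  assumes r: "r \<ge> 1"
  shows "pmf (type_pmf r :: (nat \<times> 'a::{field,finite}) pmf) t =
    (if t \<in> local_types r then type_weight t / (\<Sum>t\<in>(local_types r :: (nat \<times> 'a) set). type_weight t) else 0)"
  unfolding type_pmf_def
proof (rule pmf_embed_pmf)
  let ?W = "\<Sum>t\<in>(local_types r :: (nat \<times> 'a) set). type_weight t"
  let ?f = "\<lambda>t :: nat \<times> 'a. if t \<in> local_types r then type_weight t / ?W else 0"
  note W = total_type_weight_pos[OF r, where 'a='a]
  show "0 \<le> ?f t" for t using W type_weight_pos[of t] by (simp add: less_imp_le)
  have "(\<integral>\<^sup>+t. ennreal (?f t) \<partial>count_space UNIV) = (\<Sum>t\<in>local_types r. ennreal (?f t))"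
    by (rule nn_integral_count_space'[OF finite_local_types]) auto
  also have "\<dots> = (\<Sum>t\<in>(local_types r :: (nat \<times> 'a) set). ennreal (type_weight t / ?W))" by (intro sum.cong) auto
  also have "\<dots> = ennreal (\<Sum>t\<in>(local_types r :: (nat \<times> 'a) set). type_weight t / ?W)"
    by (intro sum_ennreal divide_nonneg_pos less_imp_le[OF type_weight_pos] W)
  also have "(\<Sum>t\<in>(local_types r :: (nat \<times> 'a) set). type_weight t / ?W) = 1"
    using W by (simp add: sum_divide_distrib[symmetric])
  finally show "(\<integral>\<^sup>+t. ennreal (?f t) \<partial>count_space UNIV) = 1" by simp
qed

lemma set_type_pmf: "r \<ge> 1 \<Longrightarrow> set_pmf (type_pmf r) \<subseteq> local_types r"
  by (auto simp: set_pmf_eq pmf_type_pmf split: if_splits)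

text \<open>Multiplying all weights by q leaves index 0 with weight q and every other index with
  weight 1. The set \<open>S\<close> need have the product form only on
  \<open>local_types r\<close>, where the distribution is supported.\<close>

lemma measure_type_pmf:
  fixes A :: "nat \<Rightarrow> bool" and B :: "'a::{field,finite} \<Rightarrow> bool"
  assumes r: "r \<ge> 1" and S: "\<And>t. t \<in> local_types r \<Longrightarrow> t \<in> S \<longleftrightarrow> A (fst t) \<and> B (snd t)"
  shows "measure_pmf.prob (type_pmf r) S =
    (of_bool (A 0) * real CARD('a) + real (card {j \<in> {1..<r}. A j})) * real (card {u :: 'a. u \<noteq> 0 \<and> B u}) /
    ((real CARD('a) - 1) * (real CARD('a) + real r - 1))"
proof -
  let ?W = "\<Sum>t\<in>(local_types r :: (nat \<times> 'a) set). type_weight t"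
  have "measure_pmf.prob (type_pmf r) S = measure_pmf.prob (type_pmf r) (S \<inter> local_types r)"
    using set_type_pmf[OF r] by (intro measure_prob_cong_0) (auto simp: pmf_type_pmf[OF r])
  also have "S \<inter> local_types r = {t \<in> local_types r. A (fst t) \<and> B (snd t)}" using S by auto
  also have "measure_pmf.prob (type_pmf r) \<dots> = (\<Sum>t\<in>{t \<in> local_types r. A (fst t) \<and> B (snd t)}. pmf (type_pmf r) t)"
    by (rule measure_measure_pmf_finite) (rule finite_subset[OF Collect_subset finite_local_types])
  also have "\<dots> = (\<Sum>t\<in>{t \<in> local_types r. A (fst t) \<and> B (snd t)}. type_weight t) / ?W"
    unfolding sum_divide_distrib by (intro sum.cong) (auto simp: pmf_type_pmf[OF r])
  also have "\<dots> = (of_bool (A 0) + real (card {j \<in> {1..<r}. A j}) / real CARD('a)) * real (card {u :: 'a. u \<noteq> 0 \<and> B u}) /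
     ((real CARD('a) - 1) * (real CARD('a) + real r - 1) / real CARD('a))"
    by (simp only: sum_type_weight[OF r] total_type_weight[OF r])
  also have "\<dots> = (of_bool (A 0) * real CARD('a) + real (card {j \<in> {1..<r}. A j})) * real (card {u :: 'a. u \<noteq> 0 \<and> B u}) /
    ((real CARD('a) - 1) * (real CARD('a) + real r - 1))"
  proof -
    have "(a + b / c) * d / (e / c) = (a * c + b) * d / e" if "c > 0" for a b c d e :: real
    proof -
      have "(a + b / c) * c = a * c + b" using that by (simp add: distrib_right)
      moreover have "(a + b / c) * d / (e / c) = ((a + b / c) * c) * d / e" by simp
      ultimately show ?thesis by (simp only:)
    qed
    note eq = this
    show ?thesis by (rule eq) simp
  qed
  finally show ?thesis .
qed

lemma card_multiples:
  fixes d r :: nat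
  assumes "d dvd r" "r > 0"
  shows "card {j \<in> {1..<r}. d dvd j} = r div d - 1"
proof -
  obtain k where k: "r = d * k" using assms(1) by (elim dvdE)
  then have d0: "d > 0" using assms(2) by auto
  have "{j \<in> {1..<r}. d dvd j} = (\<lambda>i. d * i) ` {1..<k}"
    using k d0 by (auto elim!: dvdE)
  then show ?thesis using k d0 by (simp add: card_image inj_on_def)
qed

text \<open>
  The axioms on the values of the limiting variables and on their products hold at every point of
  the sample space, not just almost everywhere, so types outside the support must be avoided.
\<close>

definition normalize_type :: "nat \<Rightarrow> nat \<times> 'a::field \<Rightarrow> nat \<times> 'a" where
  "normalize_type r t = (if t \<in> local_types r then t else (0, 1))"

lemma normalize_type_in: "r \<ge> 1 \<Longrightarrow> normalize_type r t \<in> local_types r"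
  by (simp add: normalize_type_def local_types_def)

section \<open>The explicit model of the limit variables\<close>

context compatible_characters
begin

lemma r1: "r \<ge> 1" using r by simp

text \<open>All prescribed probabilities reduce to \<open>prob\<close>, which multiplies a weighted
  count of indices by a count of units: multiples of \<open>d\<close> or the indices with given gcd
  on one side, fibres of a character on the other.\<close>

lemma limit_variables_model:
  fixes P :: "'b pmf" and Y :: "nat \<Rightarrow> 'b \<Rightarrow> nat \<times> 'a"
  assumes indep: "prob_space.indep_vars (measure_pmf P) (\<lambda>_. count_space UNIV) Y {1..CARD('a) + 1}"
    and dist: "\<And>i. i \<in> {1..CARD('a) + 1} \<Longrightarrow> map_pmf (Y i) P = type_pmf r"
  shows "limit_variables CARD('a) r (measure_pmf P) (\<lambda>d i \<omega>. limit_value chi d (normalize_type r (Y i \<omega>)))"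
proof -
  let ?N = "normalize_type r" and ?q = "real CARD('a)"
  let ?R = "\<lambda>A B. (of_bool (A 0) * ?q + real (card {j \<in> {1..<r}. A j})) * real (card {u :: 'a. u \<noteq> 0 \<and> B u}) /
    ((?q - 1) * (?q + real r - 1))"
  let ?X = "\<lambda>d i \<omega>. limit_value chi d (?N (Y i \<omega>))"
  have q2: "?q \<ge> 2" using card_field_ge_2[where 'a='a] by simp
  have q1: "?q - 1 > 0" using q2 by simp
  have nz: "snd (?N t) \<noteq> 0" for t using normalize_type_in[OF r1, of t] by (auto simp: local_types_def)
  have prob: "measure_pmf.prob P {\<omega> \<in> space P. \<Phi> (?N (Y i \<omega>))} =
      ?R A B"
    if i: "i \<in> {1..CARD('a) + 1}" and \<Phi>: "\<And>t. snd t \<noteq> 0 \<Longrightarrow> \<Phi> t \<longleftrightarrow> A (fst t) \<and> B (snd t)" for i \<Phi> A B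
  proof -
    have "{\<omega> \<in> space P. \<Phi> (?N (Y i \<omega>))} = Y i -` {t. \<Phi> (?N t)}" by auto
    then have "measure_pmf.prob P {\<omega> \<in> space P. \<Phi> (?N (Y i \<omega>))} = measure_pmf.prob (type_pmf r) {t. \<Phi> (?N t)}"
      using dist[OF i] by (metis measure_map_pmf)
    also have "\<dots> = ?R A B"
      by (rule measure_type_pmf[OF r1]) (use \<Phi> in \<open>auto simp: normalize_type_def local_types_def\<close>)
    finally show ?thesis .
  qed
  have card_all: "real (card {u :: 'a. u \<noteq> 0 \<and> True}) = ?q - 1"
    using card_field_ge_2[where 'a='a] by (simp add: Collect_neg_eq Compl_eq_Diff_UNIV card_Diff_singleton)
  have fiber: "real (card {u :: 'a. u \<noteq> 0 \<and> B u}) = (?q - 1) / real d"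
    if "d * card {u :: 'a. u \<noteq> 0 \<and> B u} = CARD('a) - 1" "d > 0" for B d
  proof -
    have "real d * real (card {u :: 'a. u \<noteq> 0 \<and> B u}) = ?q - 1"
      using arg_cong[OF that(1), of real] q2 by simp
    then show ?thesis using that(2) by (simp add: field_simps)
  qed
  have zero: "measure_pmf.prob P {\<omega> \<in> space P. ?X d i \<omega> = 0} = (real r - real r / real d) / (?q + real r - 1)"
    if d: "d dvd r" and i: "i \<in> {1..CARD('a) + 1}" for d i
  proof -
    have "measure_pmf.prob P {\<omega> \<in> space P. ?X d i \<omega> = 0} =
      (of_bool (\<not> d dvd 0) * ?q + real (card {j \<in> {1..<r}. \<not> d dvd j})) * real (card {u :: 'a. u \<noteq> 0 \<and> True}) / ((?q - 1) * (?q + real r - 1))"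
      by (rule prob[OF i, of "\<lambda>t. limit_value chi d t = 0" "\<lambda>j. \<not> d dvd j" "\<lambda>_. True"]) (simp add: limit_value_eq_0_iff[OF d])
    also have "real (card {j \<in> {1..<r}. \<not> d dvd j}) = real r - real r / real d"
    proof -
      have "{j \<in> {1..<r}. \<not> d dvd j} = {1..<r} - {j \<in> {1..<r}. d dvd j}" by auto
      moreover have "card ({1..<r} - {j \<in> {1..<r}. d dvd j}) = card {1..<r} - card {j \<in> {1..<r}. d dvd j}"
        by (rule card_Diff_subset) auto
      ultimately have "card {j \<in> {1..<r}. \<not> d dvd j} = (r - 1) - (r div d - 1)"
        using card_multiples[OF d] r by (simp only: card_atLeastLessThan)
      moreover have "r div d \<ge> 1" "r div d \<le> r" using d divisor_pos[OF d] r by (auto simp: dvd_imp_le Suc_le_eq div_greater_zero_iff)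
      ultimately show ?thesis using r d by (simp add: real_of_nat_div of_nat_diff)
    qed
    finally show ?thesis unfolding card_all using q1 by simp
  qed
  have root: "measure_pmf.prob P {\<omega> \<in> space P. ?X d i \<omega> = e} = (?q + real r / real d - 1) / (real d * (?q + real r - 1))"
    if d: "d dvd r" and i: "i \<in> {1..CARD('a) + 1}" and e: "e \<in> unity_roots d" for d i e
  proof -
    have "measure_pmf.prob P {\<omega> \<in> space P. ?X d i \<omega> = e} =
      (of_bool (d dvd 0) * ?q + real (card {j \<in> {1..<r}. d dvd j})) * real (card {u :: 'a. u \<noteq> 0 \<and> chi d u = e}) / ((?q - 1) * (?q + real r - 1))"
      by (rule prob[OF i, of "\<lambda>t. limit_value chi d t = e" "\<lambda>j. d dvd j" "\<lambda>u. chi d u = e"]) (simp add: limit_value_eq_unity_root_iff[OF d e])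
    also have "real (card {u :: 'a. u \<noteq> 0 \<and> chi d u = e}) = (?q - 1) / real d"
      by (rule fiber[OF card_chi_fiber[OF d e] divisor_pos[OF d]])
    also have "real (card {j \<in> {1..<r}. d dvd j}) = real r / real d - 1"
    proof -
      have "r div d \<ge> 1" using d divisor_pos[OF d] r by (auto simp: dvd_imp_le Suc_le_eq div_greater_zero_iff)
      then show ?thesis using card_multiples[OF d] r d by (simp add: real_of_nat_div of_nat_diff)
    qed
    finally show ?thesis using q1 divisor_pos[OF d] by simp
  qed
  show ?thesis
  proof
    fix d i assume d: "d dvd r" and i: "i \<in> {1..CARD('a) + 1}"
    show "?X d i \<in> borel_measurable (measure_pmf P)" by simp
    show "measure_pmf.prob P {\<omega> \<in> space P. ?X d i \<omega> = 0} = (real r - real r / real d) / (?q + real r - 1)"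
      by (rule zero[OF d i])
    show "measure_pmf.prob P {\<omega> \<in> space P. ?X d i \<omega> = e} = (?q + real r / real d - 1) / (real d * (?q + real r - 1))"
      if "e \<in> unity_roots d" for e by (rule root[OF d i that])
    show "?X d i \<omega> \<in> unity_roots d \<union> {0}" for \<omega>
      using chi_unity_root[OF d nz] by (simp add: limit_value_def)
  next
    fix d d' i j assume d: "d dvd r" "d' dvd r" and ij: "i \<in> {1..CARD('a) + 1}" "j \<in> {1..CARD('a) + 1}" "i \<noteq> j"
    \<comment> \<open>The families restricted to \<open>{i}\<close> and \<open>{j}\<close> are
      independent; composing with evaluation and \<open>limit_value\<close> yields the single
      variables.\<close>
    have "prob_space.indep_var (measure_pmf P) (PiM {i} (\<lambda>_. count_space UNIV)) (\<lambda>\<omega>. restrict (\<lambda>i. Y i \<omega>) {i})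
        (PiM {j} (\<lambda>_. count_space UNIV)) (\<lambda>\<omega>. restrict (\<lambda>i. Y i \<omega>) {j})"
      using ij by (intro prob_space.indep_var_restrict[OF prob_space_measure_pmf indep]) auto
    then have "prob_space.indep_var (measure_pmf P) borel ((\<lambda>f. limit_value chi d (?N (f i))) \<circ> (\<lambda>\<omega>. restrict (\<lambda>i. Y i \<omega>) {i}))
        borel ((\<lambda>f. limit_value chi d' (?N (f j))) \<circ> (\<lambda>\<omega>. restrict (\<lambda>i. Y i \<omega>) {j}))"
      by (rule prob_space.indep_var_compose[OF prob_space_measure_pmf])
        (rule measurable_compose[OF measurable_component_singleton]; simp)+
    then show "prob_space.indep_var (measure_pmf P) borel (?X d i) borel (?X d' j)" by (simp add: o_def)
  next
    show "prob_space.indep_vars (measure_pmf P) (\<lambda>_. PiM {d. d dvd r} (\<lambda>_. borel)) (\<lambda>i \<omega>. \<lambda>d\<in>{d. d dvd r}. ?X d i \<omega>) {1..CARD('a) + 1}"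
      by (rule prob_space.indep_vars_compose2[OF prob_space_measure_pmf indep, where Y = "\<lambda>i t. \<lambda>d\<in>{d. d dvd r}. limit_value chi d (?N t)"])
        (auto simp: space_PiM)
  next
    fix d i \<sigma> \<omega> assume d: "d dvd r" and \<sigma>: "\<And>p. p \<in> prime_factors d \<Longrightarrow> 1 \<le> \<sigma> p \<and> \<sigma> p \<le> p ^ multiplicity p d \<and>
          [\<sigma> p * (d div p ^ multiplicity p d) = 1] (mod p ^ multiplicity p d)"
    show "?X d i \<omega> = (\<Prod>p\<in>prime_factors d. ?X (p ^ multiplicity p d) i \<omega> ^ \<sigma> p)"
      by (rule limit_value_prod_prime_powers[OF d nz]) (use \<sigma> in \<open>simp add: exponents_ok_def\<close>)
  next
    fix p s i assume p: "p \<in> prime_factors r" and s: "1 < s" "s \<le> multiplicity p r" and i: "i \<in> {1..CARD('a) + 1}"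
    have ps: "p ^ s dvd r" "p ^ (s - 1) dvd r" using prime_power_dvd_r[OF p] s by auto
    have "{\<omega> \<in> space P. ?X (p ^ s) i \<omega> = 0 \<and> ?X (p ^ (s - 1)) i \<omega> = 0} = {\<omega> \<in> space P. ?X (p ^ (s - 1)) i \<omega> = 0}"
      using limit_value_eq_0_iff[OF ps(1) nz] limit_value_eq_0_iff[OF ps(2) nz]
      by (auto dest: power_le_dvd[OF _ diff_le_self])
    \<comment> \<open>Conditioning on a null event would give 0 instead of 1. Here
      \<open>1 < s\<close> makes \<open>p ^ (s - 1)\<close> larger than 1, so the event has positive
      probability.\<close>
    moreover have "measure_pmf.prob P {\<omega> \<in> space P. ?X (p ^ (s - 1)) i \<omega> = 0} \<noteq> 0"
    proof -
      have "p ^ (s - 1) > 1" using s p by (intro one_less_power prime_gt_1_nat) auto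
      moreover have "real r / real n < real r" if "n > 1" for n :: nat using r that by (simp add: divide_less_eq)
      ultimately have "real r / real (p ^ (s - 1)) < real r" by blast
      then show ?thesis unfolding zero[OF ps(2) i] using q2 by auto
    qed
    ultimately show "cond_prob (measure_pmf P) (\<lambda>\<omega>. ?X (p ^ s) i \<omega> = 0) (\<lambda>\<omega>. ?X (p ^ (s - 1)) i \<omega> = 0) = 1"
      by (simp add: cond_prob_def)
    fix e assume e: "e \<in> unity_roots (p ^ s)"
    have "limit_value chi (p ^ (s - 1)) t = e ^ p" if "limit_value chi (p ^ s) t = e" for t
    proof -
      have "p ^ s dvd fst t" "chi (p ^ s) (snd t) = e" using that limit_value_eq_unity_root_iff[OF ps(1) e] by auto
      moreover have "p ^ (s - 1) dvd p ^ s" by (simp add: le_imp_power_dvd)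
      ultimately show ?thesis using chi_prime_power_step[OF p _ s(2)] s
        unfolding limit_value_def by (metis dvd_trans less_imp_le)
    qed
    then have "{\<omega> \<in> space P. ?X (p ^ (s - 1)) i \<omega> = e ^ p \<and> ?X (p ^ s) i \<omega> = e} = {\<omega> \<in> space P. ?X (p ^ s) i \<omega> = e}"
      by blast
    moreover have "measure_pmf.prob P {\<omega> \<in> space P. ?X (p ^ s) i \<omega> = e} \<noteq> 0"
    proof -
      have "real r / real (p ^ s) > 0" using r divisor_pos[OF ps(1)] by simp
      then show ?thesis unfolding root[OF ps(1) i e] using q2 divisor_pos[OF ps(1)] by auto
    qed
    ultimately show "cond_prob (measure_pmf P) (\<lambda>\<omega>. ?X (p ^ (s - 1)) i \<omega> = e ^ p) (\<lambda>\<omega>. ?X (p ^ s) i \<omega> = e) = 1"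
      by (simp add: cond_prob_def)
  next
    fix d i \<epsilon> assume d: "d dvd r" and dr: "d \<noteq> r" and i: "i \<in> {1..CARD('a) + 1}" and \<epsilon>: "\<And>k. k dvd r \<Longrightarrow> \<epsilon> k \<in> unity_roots k"
    let ?A = "\<lambda>j. gcd j r = d"
    let ?B = "\<lambda>u. \<forall>p\<in>prime_factors r. \<forall>s\<in>{1..multiplicity p d}. chi (p ^ s) u = \<epsilon> (p ^ s)"
    have "measure_pmf.prob P {\<omega> \<in> space P. \<forall>p\<in>prime_factors r. (\<forall>s\<in>{1..multiplicity p d}. ?X (p ^ s) i \<omega> = \<epsilon> (p ^ s) \<and> \<epsilon> (p ^ s) \<noteq> 0) \<and>
            (\<forall>s\<in>{multiplicity p d<..multiplicity p r}. ?X (p ^ s) i \<omega> = 0)} =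
      ?R ?A ?B"
    proof (rule prob[OF i])
      fix t :: "nat \<times> 'a" assume t: "snd t \<noteq> 0"
      have 1: "(limit_value chi (p ^ s) t = \<epsilon> (p ^ s) \<and> \<epsilon> (p ^ s) \<noteq> 0) \<longleftrightarrow> p ^ s dvd fst t \<and> chi (p ^ s) (snd t) = \<epsilon> (p ^ s)"
        if "p \<in> prime_factors r" "s \<in> {1..multiplicity p d}" for p s
      proof -
        have ps: "p ^ s dvd r" using that multiplicity_le[OF d, of p] by (intro prime_power_dvd_r) auto
        show ?thesis using limit_value_eq_unity_root_iff[OF ps \<epsilon>[OF ps], of t] unity_roots_nonzero[OF divisor_pos[OF ps] \<epsilon>[OF ps]] by blast
      qed
      have 2: "limit_value chi (p ^ s) t = 0 \<longleftrightarrow> \<not> p ^ s dvd fst t"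
        if "p \<in> prime_factors r" "s \<in> {multiplicity p d<..multiplicity p r}" for p s
        using that by (intro limit_value_eq_0_iff t prime_power_dvd_r) auto
      have "(\<forall>p\<in>prime_factors r. (\<forall>s\<in>{1..multiplicity p d}. limit_value chi (p ^ s) t = \<epsilon> (p ^ s) \<and> \<epsilon> (p ^ s) \<noteq> 0) \<and>
            (\<forall>s\<in>{multiplicity p d<..multiplicity p r}. limit_value chi (p ^ s) t = 0)) \<longleftrightarrow>
          (\<forall>p\<in>prime_factors r. (\<forall>s\<in>{1..multiplicity p d}. p ^ s dvd fst t \<and> chi (p ^ s) (snd t) = \<epsilon> (p ^ s)) \<and>
            (\<forall>s\<in>{multiplicity p d<..multiplicity p r}. \<not> p ^ s dvd fst t))"
        by (rule ball_cong[OF refl], rule arg_cong2[of _ _ _ _ "(\<and>)"]; rule ball_cong[OF refl]; rule 1 2; assumption)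
      also have "\<dots> \<longleftrightarrow> (\<forall>p\<in>prime_factors r. (\<forall>s\<in>{1..multiplicity p d}. p ^ s dvd fst t) \<and>
            (\<forall>s\<in>{multiplicity p d<..multiplicity p r}. \<not> p ^ s dvd fst t)) \<and> ?B (snd t)" by blast
      also have "\<dots> \<longleftrightarrow> ?A (fst t) \<and> ?B (snd t)" unfolding gcd_eq_iff_prime_powers[OF d] ..
      finally show "(\<forall>p\<in>prime_factors r. (\<forall>s\<in>{1..multiplicity p d}. limit_value chi (p ^ s) t = \<epsilon> (p ^ s) \<and> \<epsilon> (p ^ s) \<noteq> 0) \<and>
            (\<forall>s\<in>{multiplicity p d<..multiplicity p r}. limit_value chi (p ^ s) t = 0)) \<longleftrightarrow> ?A (fst t) \<and> ?B (snd t)" .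
    qed
    \<comment> \<open>The index 0 has \<open>gcd 0 r = r\<close>, so for \<open>d \<noteq> r\<close>
      the term of weight q is absent.\<close>
    also have "(of_bool (?A 0) :: real) = 0" using dr by simp
    also have "card {j \<in> {1..<r}. ?A j} = totient (r div d)"
    proof -
      have "{j \<in> {1..<r}. ?A j} = {j \<in> {0<..r}. ?A j}" using dr by (auto simp: le_less)
      then show ?thesis using card_gcd_eq_totient[of r d] d r by simp
    qed
    also have "(0 * ?q + real (totient (r div d))) * real (card {u :: 'a. u \<noteq> 0 \<and> ?B u}) / ((?q - 1) * (?q + real r - 1)) =
      (if \<forall>p\<in>prime_factors r. \<forall>s\<in>{1..multiplicity p d}. \<epsilon> (p ^ (s - 1)) = \<epsilon> (p ^ s) ^ p
          then real (totient (r div d)) / (real d * (?q + real r - 1)) else 0)"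
    proof (cases "\<forall>p\<in>prime_factors r. \<forall>s\<in>{1..multiplicity p d}. \<epsilon> (p ^ (s - 1)) = \<epsilon> (p ^ s) ^ p")
      case True
      have "real (card {u :: 'a. u \<noteq> 0 \<and> ?B u}) = (?q - 1) / real d"
        by (rule fiber[OF card_chi_compatible[OF d \<epsilon>] divisor_pos[OF d]]) (use True in blast)+
      then show ?thesis using True q1 by simp
    next
      case False
      then have "{u :: 'a. u \<noteq> 0 \<and> ?B u} = {}" using chi_compatible[OF d _ \<epsilon>] by blast
      then show ?thesis using False by (simp only: card.empty) simp
    qed
    finally show "measure_pmf.prob P {\<omega> \<in> space P. \<forall>p\<in>prime_factors r. (\<forall>s\<in>{1..multiplicity p d}. ?X (p ^ s) i \<omega> = \<epsilon> (p ^ s) \<and> \<epsilon> (p ^ s) \<noteq> 0) \<and>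
            (\<forall>s\<in>{multiplicity p d<..multiplicity p r}. ?X (p ^ s) i \<omega> = 0)} =
      (if \<forall>p\<in>prime_factors r. \<forall>s\<in>{1..multiplicity p d}. \<epsilon> (p ^ (s - 1)) = \<epsilon> (p ^ s) ^ p
          then real (totient (r div d)) / (real d * (?q + real r - 1)) else 0)" .
  next
    fix i \<epsilon> assume i: "i \<in> {1..CARD('a) + 1}" and \<epsilon>: "\<And>k. k dvd r \<Longrightarrow> \<epsilon> k \<in> unity_roots k"
    let ?A = "\<lambda>j. gcd j r = r"
    let ?B = "\<lambda>u. \<forall>p\<in>prime_factors r. \<forall>s\<in>{1..multiplicity p r}. chi (p ^ s) u = \<epsilon> (p ^ s)"
    have "measure_pmf.prob P {\<omega> \<in> space P. \<forall>p\<in>prime_factors r. \<forall>s\<le>multiplicity p r. ?X (p ^ s) i \<omega> = \<epsilon> (p ^ s)} =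
      ?R ?A ?B"
    proof (rule prob[OF i])
      fix t :: "nat \<times> 'a" assume t: "snd t \<noteq> 0"
      have 1: "limit_value chi (p ^ s) t = \<epsilon> (p ^ s) \<longleftrightarrow> p ^ s dvd fst t \<and> chi (p ^ s) (snd t) = \<epsilon> (p ^ s)"
        if "p \<in> prime_factors r" "s \<in> {1..multiplicity p r}" for p s
        using that by (intro limit_value_eq_unity_root_iff \<epsilon> prime_power_dvd_r) auto
      \<comment> \<open>The range of \<open>s\<close> in this axiom includes 0, where both sides are
        1.\<close>
      have 0: "limit_value chi 1 t = \<epsilon> 1" using limit_value_1[OF t] \<epsilon>[of 1] by (simp add: unity_roots_def)
      have "(\<forall>s\<le>multiplicity p r. limit_value chi (p ^ s) t = \<epsilon> (p ^ s)) \<longleftrightarrow>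
          (\<forall>s\<in>{1..multiplicity p r}. limit_value chi (p ^ s) t = \<epsilon> (p ^ s))" for p
      proof (intro iffI ballI allI impI)
        fix s assume "\<forall>s\<in>{1..multiplicity p r}. limit_value chi (p ^ s) t = \<epsilon> (p ^ s)" "s \<le> multiplicity p r"
        then show "limit_value chi (p ^ s) t = \<epsilon> (p ^ s)" using 0 by (cases "s = 0") auto
      qed auto
      then have "(\<forall>p\<in>prime_factors r. \<forall>s\<le>multiplicity p r. limit_value chi (p ^ s) t = \<epsilon> (p ^ s)) \<longleftrightarrow>
          (\<forall>p\<in>prime_factors r. \<forall>s\<in>{1..multiplicity p r}. p ^ s dvd fst t \<and> chi (p ^ s) (snd t) = \<epsilon> (p ^ s))"
        using 1 by (simp only: cong: ball_cong)
      \<comment> \<open>The added range is empty; it brings the condition into the form of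
        \<open>gcd_eq_iff_prime_powers\<close> with \<open>d = r\<close>.\<close>
      also have "\<dots> \<longleftrightarrow> (\<forall>p\<in>prime_factors r. (\<forall>s\<in>{1..multiplicity p r}. p ^ s dvd fst t) \<and>
            (\<forall>s\<in>{multiplicity p r<..multiplicity p r}. \<not> p ^ s dvd fst t)) \<and> ?B (snd t)" by auto
      also have "\<dots> \<longleftrightarrow> ?A (fst t) \<and> ?B (snd t)" unfolding gcd_eq_iff_prime_powers[OF dvd_refl] ..
      finally show "(\<forall>p\<in>prime_factors r. \<forall>s\<le>multiplicity p r. limit_value chi (p ^ s) t = \<epsilon> (p ^ s)) \<longleftrightarrow> ?A (fst t) \<and> ?B (snd t)" .
    qed
    also have "(of_bool (?A 0) :: real) = 1" by simp
    \<comment> \<open>No positive index below \<open>r\<close> is divisible by \<open>r\<close>; the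
      whole probability comes from index 0 with weight q.\<close>
    also have "card {j \<in> {1..<r}. ?A j} = 0"
    proof -
      have "\<not> r dvd j" if "j \<in> {1..<r}" for j using that by (auto dest: dvd_imp_le)
      then have "{j \<in> {1..<r}. ?A j} = {}" using gcd_dvd1 by (metis (mono_tags, lifting) Collect_empty_eq)
      then show ?thesis by (simp only: card.empty)
    qed
    also have "(1 * ?q + real 0) * real (card {u :: 'a. u \<noteq> 0 \<and> ?B u}) / ((?q - 1) * (?q + real r - 1)) =
      (if \<forall>p\<in>prime_factors r. \<forall>s\<in>{1..multiplicity p r}. \<epsilon> (p ^ (s - 1)) = \<epsilon> (p ^ s) ^ p
          then ?q / (real r * (?q + real r - 1)) else 0)"
    proof (cases "\<forall>p\<in>prime_factors r. \<forall>s\<in>{1..multiplicity p r}. \<epsilon> (p ^ (s - 1)) = \<epsilon> (p ^ s) ^ p")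
      case True
      have "real (card {u :: 'a. u \<noteq> 0 \<and> ?B u}) = (?q - 1) / real r"
        by (rule fiber[OF card_chi_compatible[OF dvd_refl \<epsilon>] divisor_pos[OF dvd_refl]]) (use True in blast)+
      then show ?thesis using True q1 by simp
    next
      case False
      then have "{u :: 'a. u \<noteq> 0 \<and> ?B u} = {}" using chi_compatible[OF dvd_refl _ \<epsilon>] by blast
      then show ?thesis using False by (simp only: card.empty) simp
    qed
    finally show "measure_pmf.prob P {\<omega> \<in> space P. \<forall>p\<in>prime_factors r. \<forall>s\<le>multiplicity p r. ?X (p ^ s) i \<omega> = \<epsilon> (p ^ s)} =
      (if \<forall>p\<in>prime_factors r. \<forall>s\<in>{1..multiplicity p r}. \<epsilon> (p ^ (s - 1)) = \<epsilon> (p ^ s) ^ p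
          then ?q / (real r * (?q + real r - 1)) else 0)" .
  qed
qed

end

section \<open>Uniqueness of the limiting law\<close>

context compatible_characters
begin

definition type_vector :: "nat \<times> 'a \<Rightarrow> nat \<Rightarrow> complex" where
  "type_vector t = (\<lambda>d\<in>{d. d dvd r}. limit_value chi d t)"

text \<open>The probability that \<open>joint_prob_proper\<close> and \<open>joint_prob_full\<close>
  force on the vector of \<open>t\<close>; it depends on the index only through its gcd with
  \<open>r\<close>.\<close>

definition type_vector_prob :: "nat \<times> 'a \<Rightarrow> real" where
  "type_vector_prob t =
    (if gcd (fst t) r = r then real CARD('a) / (real r * (real CARD('a) + real r - 1))
     else real (totient (r div gcd (fst t) r)) / (real (gcd (fst t) r) * (real CARD('a) + real r - 1)))"

lemma finite_divisors: "finite {d. d dvd r}"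
  using r by simp

lemma snd_local_types: "t \<in> local_types r \<Longrightarrow> snd t \<noteq> 0"
  by (auto simp: local_types_def)

text \<open>The product formula, applied with any admissible exponents, recovers every coordinate
  from those of prime power order, for the given variables and for \<open>limit_value\<close>
  alike.\<close>

lemma vector_event_iff:
  assumes L: "limit_variables CARD('a) r P X" and i: "i \<in> {1..CARD('a) + 1}"
    and t: "t \<in> local_types r" and \<omega>: "\<omega> \<in> space P"
  shows "(\<forall>d. d dvd r \<longrightarrow> X d i \<omega> = limit_value chi d t) \<longleftrightarrow>
    (\<forall>p\<in>prime_factors r. \<forall>s\<in>{1..multiplicity p r}. X (p ^ s) i \<omega> = limit_value chi (p ^ s) t)"
proof
  assume "\<forall>d. d dvd r \<longrightarrow> X d i \<omega> = limit_value chi d t"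
  then show "\<forall>p\<in>prime_factors r. \<forall>s\<in>{1..multiplicity p r}. X (p ^ s) i \<omega> = limit_value chi (p ^ s) t"
    using prime_power_dvd_r by simp
next
  interpret L: limit_variables "CARD('a)" r P X by (rule L)
  assume A: "\<forall>p\<in>prime_factors r. \<forall>s\<in>{1..multiplicity p r}. X (p ^ s) i \<omega> = limit_value chi (p ^ s) t"
  show "\<forall>d. d dvd r \<longrightarrow> X d i \<omega> = limit_value chi d t"
  proof (intro allI impI)
    fix d assume d: "d dvd r"
    have pf: "prime_factors d \<subseteq> prime_factors r" using d r by (intro dvd_prime_factors) auto
    obtain \<sigma> where \<sigma>: "exponents_ok d \<sigma>" using exponents_exist[OF divisor_pos[OF d]] by blast
    have "X d i \<omega> = (\<Prod>p\<in>prime_factors d. X (p ^ multiplicity p d) i \<omega> ^ \<sigma> p)"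
      by (rule L.X_eq_prod[OF d i \<omega>]) (use \<sigma> in \<open>simp add: exponents_ok_def\<close>)
    also have "\<dots> = (\<Prod>p\<in>prime_factors d. limit_value chi (p ^ multiplicity p d) t ^ \<sigma> p)"
    proof (rule prod.cong)
      fix p assume p: "p \<in> prime_factors d"
      have "multiplicity p d \<in> {1..multiplicity p r}"
        using p multiplicity_le[OF d, of p] by (simp add: prime_factors_multiplicity Suc_le_eq)
      then have "X (p ^ multiplicity p d) i \<omega> = limit_value chi (p ^ multiplicity p d) t" using A pf p by blast
      then show "X (p ^ multiplicity p d) i \<omega> ^ \<sigma> p = limit_value chi (p ^ multiplicity p d) t ^ \<sigma> p" by simp
    qed simp
    also have "\<dots> = limit_value chi d t"
      by (rule limit_value_prod_prime_powers[OF d snd_local_types[OF t] \<sigma>, symmetric])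
    finally show "X d i \<omega> = limit_value chi d t" .
  qed
qed

lemma prob_vector:
  assumes L: "limit_variables CARD('a) r P X" and i: "i \<in> {1..CARD('a) + 1}" and t: "t \<in> local_types r"
  shows "measure P {\<omega> \<in> space P. \<forall>d. d dvd r \<longrightarrow> X d i \<omega> = limit_value chi d t} = type_vector_prob t"
proof -
  interpret L: limit_variables "CARD('a)" r P X by (rule L)
  note u = snd_local_types[OF t]
  let ?g = "gcd (fst t) r"
  have g: "?g dvd r" by simp
  \<comment> \<open>The axioms on joint probabilities require a root of unity at every divisor of
    \<open>r\<close>, even where the pattern prescribes 0; the default 1 belongs to every
    order.\<close>
  define \<epsilon> where "\<epsilon> k = (if k dvd ?g then limit_value chi k t else 1)" for k
  have eps_chi: "\<epsilon> k = chi k (snd t)" if "k dvd ?g" for k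
    using that by (simp add: \<epsilon>_def limit_value_def)
  have eps: "\<epsilon> k \<in> unity_roots k" if k: "k dvd r" for k
  proof (cases "k dvd ?g")
    case True
    then show ?thesis using eps_chi chi_unity_root[OF k u] by simp
  next
    case False
    then have "\<epsilon> k = 1" unfolding \<epsilon>_def by (rule if_not_P)
    then show ?thesis by (simp add: unity_roots_def)
  qed
  have dvd_iff: "p ^ s dvd ?g \<longleftrightarrow> s \<le> multiplicity p ?g" if "p \<in> prime_factors r" for p s
    by (rule prime_power_dvd_iff[OF g that])
  have compat: "\<forall>p\<in>prime_factors r. \<forall>s\<in>{1..multiplicity p ?g}. \<epsilon> (p ^ (s - 1)) = \<epsilon> (p ^ s) ^ p"
  proof (intro ballI)
    fix p s assume p: "p \<in> prime_factors r" and s: "s \<in> {1..multiplicity p ?g}"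
    have "p ^ s dvd ?g" "p ^ (s - 1) dvd ?g" unfolding dvd_iff[OF p] using s by auto
    then have e: "\<epsilon> (p ^ s) = chi (p ^ s) (snd t)" "\<epsilon> (p ^ (s - 1)) = chi (p ^ (s - 1)) (snd t)" by (auto intro: eps_chi)
    have "1 \<le> s" "s \<le> multiplicity p r" using s multiplicity_le[OF g, of p] by auto
    then show "\<epsilon> (p ^ (s - 1)) = \<epsilon> (p ^ s) ^ p" unfolding e by (rule chi_prime_power_step[OF p])
  qed
  show ?thesis
  proof (cases "?g = r")
    case False
    have "{\<omega> \<in> space P. \<forall>d. d dvd r \<longrightarrow> X d i \<omega> = limit_value chi d t} =
      {\<omega> \<in> space P. \<forall>p\<in>prime_factors r.
            (\<forall>s\<in>{1..multiplicity p ?g}. X (p ^ s) i \<omega> = \<epsilon> (p ^ s) \<and> \<epsilon> (p ^ s) \<noteq> 0) \<and>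
            (\<forall>s\<in>{multiplicity p ?g<..multiplicity p r}. X (p ^ s) i \<omega> = 0)}"
    proof (rule Collect_cong, rule conj_cong[OF refl])
      fix \<omega> assume \<omega>: "\<omega> \<in> space P"
      have 1: "\<epsilon> (p ^ s) = limit_value chi (p ^ s) t \<and> \<epsilon> (p ^ s) \<noteq> 0"
        if p: "p \<in> prime_factors r" and s: "s \<in> {1..multiplicity p ?g}" for p s
      proof -
        have d: "p ^ s dvd ?g" unfolding dvd_iff[OF p] using s by simp
        then have "p ^ s dvd r" using g dvd_trans by blast
        then show ?thesis using d eps_chi[OF d] chi_nonzero[OF _ u] unfolding \<epsilon>_def by simp
      qed
      have 2: "limit_value chi (p ^ s) t = 0"
        if p: "p \<in> prime_factors r" and s: "s \<in> {multiplicity p ?g<..multiplicity p r}" for p s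
      proof -
        have "p ^ s dvd r" using p s by (intro prime_power_dvd_r) auto
        moreover have "\<not> p ^ s dvd ?g" unfolding dvd_iff[OF p] using s by simp
        ultimately have "\<not> p ^ s dvd fst t" by simp
        then show ?thesis unfolding limit_value_def by (rule if_not_P)
      qed
      show "(\<forall>d. d dvd r \<longrightarrow> X d i \<omega> = limit_value chi d t) \<longleftrightarrow>
        (\<forall>p\<in>prime_factors r.
            (\<forall>s\<in>{1..multiplicity p ?g}. X (p ^ s) i \<omega> = \<epsilon> (p ^ s) \<and> \<epsilon> (p ^ s) \<noteq> 0) \<and>
            (\<forall>s\<in>{multiplicity p ?g<..multiplicity p r}. X (p ^ s) i \<omega> = 0))"
        unfolding vector_event_iff[OF L i t \<omega>]
      proof (rule ball_cong[OF refl])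
        fix p assume p: "p \<in> prime_factors r"
        have "{1..multiplicity p r} = {1..multiplicity p ?g} \<union> {multiplicity p ?g<..multiplicity p r}"
          using multiplicity_le[OF g, of p] by auto
        then have "(\<forall>s\<in>{1..multiplicity p r}. X (p ^ s) i \<omega> = limit_value chi (p ^ s) t) \<longleftrightarrow>
          (\<forall>s\<in>{1..multiplicity p ?g}. X (p ^ s) i \<omega> = limit_value chi (p ^ s) t) \<and>
          (\<forall>s\<in>{multiplicity p ?g<..multiplicity p r}. X (p ^ s) i \<omega> = limit_value chi (p ^ s) t)"
          by (simp only: ball_Un)
        then show "(\<forall>s\<in>{1..multiplicity p r}. X (p ^ s) i \<omega> = limit_value chi (p ^ s) t) \<longleftrightarrow>
          (\<forall>s\<in>{1..multiplicity p ?g}. X (p ^ s) i \<omega> = \<epsilon> (p ^ s) \<and> \<epsilon> (p ^ s) \<noteq> 0) \<and>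
            (\<forall>s\<in>{multiplicity p ?g<..multiplicity p r}. X (p ^ s) i \<omega> = 0)"
          using 1[OF p] 2[OF p] by metis
      qed
    qed
    then have "measure P {\<omega> \<in> space P. \<forall>d. d dvd r \<longrightarrow> X d i \<omega> = limit_value chi d t} =
      (if \<forall>p\<in>prime_factors r. \<forall>s\<in>{1..multiplicity p ?g}. \<epsilon> (p ^ (s - 1)) = \<epsilon> (p ^ s) ^ p
          then real (totient (r div ?g)) / (real ?g * (real CARD('a) + real r - 1)) else 0)"
      using L.joint_prob_proper[OF g False i eps] by (simp only:)
    then show ?thesis unfolding type_vector_prob_def if_P[OF compat] if_not_P[OF False] .
  next
    case True
    have "{\<omega> \<in> space P. \<forall>d. d dvd r \<longrightarrow> X d i \<omega> = limit_value chi d t} =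
      {\<omega> \<in> space P. \<forall>p\<in>prime_factors r. \<forall>s\<le>multiplicity p r. X (p ^ s) i \<omega> = \<epsilon> (p ^ s)}"
    proof (rule Collect_cong, rule conj_cong[OF refl])
      fix \<omega> assume \<omega>: "\<omega> \<in> space P"
      have 1: "\<epsilon> (p ^ s) = limit_value chi (p ^ s) t" if "p \<in> prime_factors r" "s \<le> multiplicity p r" for p s
        using prime_power_dvd_r[OF that] True by (simp add: \<epsilon>_def)
      show "(\<forall>d. d dvd r \<longrightarrow> X d i \<omega> = limit_value chi d t) \<longleftrightarrow>
        (\<forall>p\<in>prime_factors r. \<forall>s\<le>multiplicity p r. X (p ^ s) i \<omega> = \<epsilon> (p ^ s))"
      proof
        assume "\<forall>d. d dvd r \<longrightarrow> X d i \<omega> = limit_value chi d t"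
        then show "\<forall>p\<in>prime_factors r. \<forall>s\<le>multiplicity p r. X (p ^ s) i \<omega> = \<epsilon> (p ^ s)"
          using 1 prime_power_dvd_r by simp
      next
        assume "\<forall>p\<in>prime_factors r. \<forall>s\<le>multiplicity p r. X (p ^ s) i \<omega> = \<epsilon> (p ^ s)"
        then show "\<forall>d. d dvd r \<longrightarrow> X d i \<omega> = limit_value chi d t"
          unfolding vector_event_iff[OF L i t \<omega>] using 1 by simp
      qed
    qed
    then have "measure P {\<omega> \<in> space P. \<forall>d. d dvd r \<longrightarrow> X d i \<omega> = limit_value chi d t} =
      (if \<forall>p\<in>prime_factors r. \<forall>s\<in>{1..multiplicity p r}. \<epsilon> (p ^ (s - 1)) = \<epsilon> (p ^ s) ^ p
          then real CARD('a) / (real r * (real CARD('a) + real r - 1)) else 0)"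
      using L.joint_prob_full[OF i eps] by (simp only:)
    then show ?thesis unfolding type_vector_prob_def if_P[OF compat[unfolded True]] if_P[OF True] .
  qed
qed

abbreviation vector :: "(nat \<Rightarrow> nat \<Rightarrow> 'b \<Rightarrow> complex) \<Rightarrow> nat \<Rightarrow> 'b \<Rightarrow> nat \<Rightarrow> complex" where
  "vector X i \<omega> \<equiv> (\<lambda>d\<in>{d. d dvd r}. X d i \<omega>)"

lemma vector_eq_type_vector_iff:
  "vector X i \<omega> = type_vector t \<longleftrightarrow> (\<forall>d. d dvd r \<longrightarrow> X d i \<omega> = limit_value chi d t)"
  by (auto simp: type_vector_def restrict_def fun_eq_iff)

lemma prob_sums_partition:
  assumes L: "limit_variables CARD('a) r P X"
    and total: "\<forall>i\<in>{1..CARD('a) + 1}.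
      (\<Sum>w\<in>type_vector ` local_types r. measure P {\<omega> \<in> space P. vector X i \<omega> = w}) = 1"
  shows "measure P {\<omega> \<in> space P. \<forall>d. d dvd r \<and> d \<noteq> 1 \<longrightarrow> (\<Sum>i=1..CARD('a)+1. X d i \<omega>) = M d} =
    (\<Sum>s\<in>{s \<in> PiE {1..CARD('a) + 1} (\<lambda>_. type_vector ` local_types r).
        \<forall>d. d dvd r \<and> d \<noteq> 1 \<longrightarrow> (\<Sum>i=1..CARD('a)+1. s i d) = M d}.
      \<Prod>i\<in>{1..CARD('a) + 1}. measure P {\<omega> \<in> space P. vector X i \<omega> = s i})"
proof -
  interpret L: limit_variables "CARD('a)" r P X by (rule L)
  let ?I = "{1..CARD('a) + 1}" and ?S = "type_vector ` local_types r"
  have single: "{\<omega> \<in> space P. X d i \<omega> = c} \<in> sets P" if "d dvd r" "i \<in> ?I" for d i c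
  proof -
    have "X d i -` {c} \<inter> space P \<in> sets P"
      using L.random_variable_X[OF that] by (rule measurable_sets) simp
    moreover have "X d i -` {c} \<inter> space P = {\<omega> \<in> space P. X d i \<omega> = c}" by blast
    ultimately show ?thesis by simp
  qed
  show ?thesis
  proof (rule L.prob_partition)
    show "finite ?I" by simp
    show "finite ?S" using finite_local_types by blast
    show "{\<omega> \<in> space P. vector X i \<omega> = w} \<in> sets P" if i: "i \<in> ?I" and w: "w \<in> ?S" for i w
    proof -
      from w obtain t where t: "w = type_vector t" by blast
      have "{\<omega> \<in> space P. vector X i \<omega> = w} = {\<omega> \<in> space P. \<forall>d\<in>{d. d dvd r}. X d i \<omega> = limit_value chi d t}"
        unfolding t vector_eq_type_vector_iff by blast
      also have "\<dots> \<in> sets P" using single[OF _ i] by (intro sets.sets_Collect_finite_All finite_divisors) auto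
      finally show ?thesis .
    qed
    show "(\<Sum>w\<in>?S. L.prob {\<omega> \<in> space P. vector X i \<omega> = w}) = 1" if "i \<in> ?I" for i by (rule bspec[OF total that])
    show "L.prob {\<omega> \<in> space P. \<forall>i\<in>?I. vector X i \<omega> = s i} = (\<Prod>i\<in>?I. L.prob {\<omega> \<in> space P. vector X i \<omega> = s i})"
      if s: "s \<in> PiE ?I (\<lambda>_. ?S)" for s
    proof -
      have ext: "s i \<in> extensional {d. d dvd r}" if "i \<in> ?I" for i
      proof -
        have "s i \<in> ?S" using s that by (rule PiE_mem)
        then obtain t where "s i = type_vector t" by blast
        then show ?thesis by (simp add: type_vector_def)
      qed
      \<comment> \<open>A single vector is a box of singletons over the finitely many divisors of
        \<open>r\<close>. Boxes are measurable in the product space, so \<open>indep_vectors\<close>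
        applies to them.\<close>
      have eq: "vector X i -` PiE {d. d dvd r} (\<lambda>d. {s i d}) \<inter> space P = {\<omega> \<in> space P. vector X i \<omega> = s i}"
        if i: "i \<in> ?I" for i
      proof -
        have "vector X i \<omega> \<in> PiE {d. d dvd r} (\<lambda>d. {s i d}) \<longleftrightarrow> vector X i \<omega> = s i" for \<omega>
          using ext[OF i] by (auto simp: PiE_iff extensional_def fun_eq_iff)
        then show ?thesis by blast
      qed
      have ne: "?I \<noteq> {}" by simp
      have "L.prob (\<Inter>i\<in>?I. vector X i -` PiE {d. d dvd r} (\<lambda>d. {s i d}) \<inter> space P) =
          (\<Prod>i\<in>?I. L.prob (vector X i -` PiE {d. d dvd r} (\<lambda>d. {s i d}) \<inter> space P))"
        by (rule L.indep_varsD_finite[OF L.indep_vectors ne]) (auto intro!: sets_PiM_I_finite finite_divisors)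
      also have "(\<Prod>i\<in>?I. L.prob (vector X i -` PiE {d. d dvd r} (\<lambda>d. {s i d}) \<inter> space P)) =
          (\<Prod>i\<in>?I. L.prob {\<omega> \<in> space P. vector X i \<omega> = s i})" by (rule prod.cong) (simp_all only: eq)
      also have "(\<Inter>i\<in>?I. vector X i -` PiE {d. d dvd r} (\<lambda>d. {s i d}) \<inter> space P) =
          (\<Inter>i\<in>?I. {\<omega> \<in> space P. vector X i \<omega> = s i})" by (rule INF_cong) (simp_all only: eq)
      also have "\<dots> = {\<omega> \<in> space P. \<forall>i\<in>?I. vector X i \<omega> = s i}" using ne by blast
      finally show ?thesis .
    qed
    have "{\<omega> \<in> space P. \<forall>d\<in>{d. d dvd r \<and> d \<noteq> 1}. (\<Sum>i\<in>?I. X d i \<omega>) = M d} \<in> sets P"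
    proof (rule sets.sets_Collect_finite_All)
      show "finite {d. d dvd r \<and> d \<noteq> 1}" by (rule finite_subset[OF _ finite_divisors]) blast
      fix d assume d: "d \<in> {d. d dvd r \<and> d \<noteq> 1}"
      have "(\<lambda>\<omega>. \<Sum>i\<in>?I. X d i \<omega>) \<in> borel_measurable P"
        using d by (intro borel_measurable_sum L.random_variable_X) auto
      then have "(\<lambda>\<omega>. \<Sum>i\<in>?I. X d i \<omega>) -` {M d} \<inter> space P \<in> sets P" by (rule measurable_sets) simp
      moreover have "(\<lambda>\<omega>. \<Sum>i\<in>?I. X d i \<omega>) -` {M d} \<inter> space P = {\<omega> \<in> space P. (\<Sum>i\<in>?I. X d i \<omega>) = M d}" by blast
      ultimately show "{\<omega> \<in> space P. (\<Sum>i\<in>?I. X d i \<omega>) = M d} \<in> sets P" by simp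
    qed
    then show "{\<omega> \<in> space P. \<forall>d. d dvd r \<and> d \<noteq> 1 \<longrightarrow> (\<Sum>i\<in>?I. X d i \<omega>) = M d} \<in> sets P"
      by (simp only: Ball_def mem_Collect_eq)
    show "(\<forall>d. d dvd r \<and> d \<noteq> 1 \<longrightarrow> (\<Sum>i\<in>?I. X d i \<omega>) = M d) \<longleftrightarrow> (\<forall>d. d dvd r \<and> d \<noteq> 1 \<longrightarrow> (\<Sum>i\<in>?I. s i d) = M d)"
      if s: "\<And>i. i \<in> ?I \<Longrightarrow> vector X i \<omega> = s i" for \<omega> s
    proof -
      have "(\<Sum>i\<in>?I. X d i \<omega>) = (\<Sum>i\<in>?I. s i d)" if "d dvd r" for d
      proof (rule sum.cong)
        fix i assume "i \<in> ?I"
        from fun_cong[OF s[OF this], of d] show "X d i \<omega> = s i d" using that by simp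
      qed simp
      then show ?thesis by auto
    qed
  qed
qed

text \<open>Both families give every type vector the same probability, by
  \<open>prob_vector\<close>. The second one takes only type vectors as values, so these
  probabilities add up to 1. The first family therefore also takes type vectors almost surely,
  without any summation of the explicit formula.\<close>

lemma limit_variables_prob_unique:
  fixes P :: "'b measure" and P' :: "'c measure"
  assumes L: "limit_variables CARD('a) r P X" and L': "limit_variables CARD('a) r P' X'"
    and types: "\<And>i \<omega>. i \<in> {1..CARD('a) + 1} \<Longrightarrow> \<omega> \<in> space P' \<Longrightarrow> vector X' i \<omega> \<in> type_vector ` local_types r"
  shows "measure P {\<omega> \<in> space P. \<forall>d. d dvd r \<and> d \<noteq> 1 \<longrightarrow> (\<Sum>i=1..CARD('a)+1. X d i \<omega>) = M d} =
    measure P' {\<omega> \<in> space P'. \<forall>d. d dvd r \<and> d \<noteq> 1 \<longrightarrow> (\<Sum>i=1..CARD('a)+1. X' d i \<omega>) = M d}"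
proof -
  interpret L': limit_variables "CARD('a)" r P' X' by (rule L')
  let ?I = "{1..CARD('a) + 1}" and ?S = "type_vector ` local_types r"
  have eq: "measure P {\<omega> \<in> space P. vector X i \<omega> = w} = measure P' {\<omega> \<in> space P'. vector X' i \<omega> = w}"
    if i: "i \<in> ?I" and w: "w \<in> ?S" for i w
  proof -
    from w obtain t where t: "t \<in> local_types r" "w = type_vector t" by blast
    show ?thesis unfolding t(2) vector_eq_type_vector_iff prob_vector[OF L i t(1)] prob_vector[OF L' i t(1)] ..
  qed
  have pos: "type_vector_prob t > 0" if "t \<in> local_types r" for t
  proof -
    have "gcd (fst t) r > 0" using r by simp
    moreover have "r div gcd (fst t) r > 0" using r by (simp add: div_greater_zero_iff gcd_le2_nat)
    moreover have "real CARD('a) \<ge> 2" using card_field_ge_2[where 'a='a] by simp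
    ultimately show ?thesis using r by (auto simp: type_vector_prob_def intro!: divide_pos_pos mult_pos_pos)
  qed
  have total': "(\<Sum>w\<in>?S. measure P' {\<omega> \<in> space P'. vector X' i \<omega> = w}) = 1" if i: "i \<in> ?I" for i
  proof -
    \<comment> \<open>Sets outside the sigma-algebra have measure 0 by convention, so a positive
      value proves measurability.\<close>
    have ev: "{\<omega> \<in> space P'. vector X' i \<omega> = w} \<in> sets P'" if w: "w \<in> ?S" for w
    proof -
      from w obtain t where t: "t \<in> local_types r" "w = type_vector t" by blast
      have "measure P' {\<omega> \<in> space P'. vector X' i \<omega> = w} > 0"
        unfolding t(2) vector_eq_type_vector_iff prob_vector[OF L' i t(1)] by (rule pos[OF t(1)])
      then show ?thesis using measure_notin_sets by fastforce
    qed
    have "(\<Sum>w\<in>?S. measure P' {\<omega> \<in> space P'. vector X' i \<omega> = w}) =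
        measure P' (\<Union>w\<in>?S. {\<omega> \<in> space P'. vector X' i \<omega> = w})"
    proof (rule L'.finite_measure_finite_Union[symmetric])
      show "finite ?S" by (intro finite_imageI finite_local_types)
      show "(\<lambda>w. {\<omega> \<in> space P'. vector X' i \<omega> = w}) ` ?S \<subseteq> sets P'" by (intro image_subsetI ev)
      show "disjoint_family_on (\<lambda>w. {\<omega> \<in> space P'. vector X' i \<omega> = w}) ?S"
        unfolding disjoint_family_on_def by blast
    qed
    also have "(\<Union>w\<in>?S. {\<omega> \<in> space P'. vector X' i \<omega> = w}) = space P'" using types[OF i] by blast
    finally show ?thesis unfolding L'.prob_space .
  qed
  have total: "(\<Sum>w\<in>?S. measure P {\<omega> \<in> space P. vector X i \<omega> = w}) = 1" if i: "i \<in> ?I" for i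
    unfolding total'[OF i, symmetric] by (rule sum.cong[OF refl eq[OF i]])
  have sums: "\<forall>i\<in>?I. (\<Sum>w\<in>?S. measure P {\<omega> \<in> space P. vector X i \<omega> = w}) = 1" by (rule ballI) (rule total)
  have sums': "\<forall>i\<in>?I. (\<Sum>w\<in>?S. measure P' {\<omega> \<in> space P'. vector X' i \<omega> = w}) = 1" by (rule ballI) (rule total')
  show ?thesis
    unfolding prob_sums_partition[OF L sums] prob_sums_partition[OF L' sums']
  proof (rule sum.cong[OF refl], rule prod.cong[OF refl])
    fix s i assume s: "s \<in> {s \<in> PiE ?I (\<lambda>_. ?S). \<forall>d. d dvd r \<and> d \<noteq> 1 \<longrightarrow> (\<Sum>i=1..CARD('a)+1. s i d) = M d}" and i: "i \<in> ?I"
    have "s \<in> PiE ?I (\<lambda>_. ?S)" using s by blast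
    then have "s i \<in> ?S" using i by (rule PiE_mem)
    then show "measure P {\<omega> \<in> space P. vector X i \<omega> = s i} = measure P' {\<omega> \<in> space P'. vector X' i \<omega> = s i}"
      by (rule eq[OF i])
  qed
qed

section \<open>The law of the sums in the model\<close>

lemma measure_type_pmf_singleton:
  fixes t :: "nat \<times> 'a"
  assumes t: "t \<in> local_types r"
  shows "measure_pmf.prob (type_pmf r) {t'. normalize_type r t' = t} =
    type_weight t / (\<Sum>t\<in>(local_types r :: (nat \<times> 'a) set). type_weight t)"
proof -
  have "measure_pmf.prob (type_pmf r) {t'. normalize_type r t' = t} = measure_pmf.prob (type_pmf r) {t}"
    using t by (intro measure_prob_cong_0) (auto simp: pmf_type_pmf[OF r1] normalize_type_def split: if_splits)
  then show ?thesis using t by (simp add: measure_pmf_single pmf_type_pmf[OF r1])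
qed

text \<open>A bijection between the points of the projective line and
  \<open>{1..CARD('a) + 1}\<close> turns a vector of independent types into a type map whose
  probability is proportional to the product of the weights.\<close>

lemma prob_sums_model:
  fixes P :: "'b pmf" and Y :: "nat \<Rightarrow> 'b \<Rightarrow> nat \<times> 'a"
  assumes indep: "prob_space.indep_vars (measure_pmf P) (\<lambda>_. count_space UNIV) Y {1..CARD('a) + 1}"
    and dist: "\<And>i. i \<in> {1..CARD('a) + 1} \<Longrightarrow> map_pmf (Y i) P = type_pmf r"
  shows "measure (measure_pmf P) {\<omega> \<in> space P. \<forall>d. d dvd r \<and> d \<noteq> 1 \<longrightarrow>
      (\<Sum>i=1..CARD('a)+1. limit_value chi d (normalize_type r (Y i \<omega>))) = M d} =
    (\<Sum>t\<in>{t \<in> type_maps r. type_sum_cond r chi M t}. \<Prod>p\<in>UNIV. type_weight (t p)) /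
       (\<Sum>t\<in>(type_maps r :: ('a option \<Rightarrow> nat \<times> 'a) set). \<Prod>p\<in>UNIV. type_weight (t p))"
    (is "?prob = ?num / ?den")
proof -
  let ?I = "{1..CARD('a) + 1}" and ?N = "normalize_type r"
  let ?W = "\<Sum>t\<in>(local_types r :: (nat \<times> 'a) set). type_weight t"
  have "card (UNIV :: 'a option set) = card ?I" by (simp add: card_UNIV_option)
  then obtain b where b: "bij_betw b (UNIV :: 'a option set) ?I"
    using finite_same_card_bij[of "UNIV :: 'a option set" ?I] by auto
  have bI: "b p \<in> ?I" for p using b by (auto simp: bij_betw_def)
  have single: "measure P {\<omega> \<in> space P. ?N (Y i \<omega>) = t} = type_weight t / ?W" if i: "i \<in> ?I" and t: "t \<in> local_types r" for i t
  proof -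
    have "{\<omega> \<in> space P. ?N (Y i \<omega>) = t} = Y i -` {t'. ?N t' = t}" by auto
    then have "measure P {\<omega> \<in> space P. ?N (Y i \<omega>) = t} = measure_pmf.prob P (Y i -` {t'. ?N t' = t})"
      by (simp only:)
    also have "\<dots> = measure_pmf.prob (map_pmf (Y i) P) {t'. ?N t' = t}" by (rule measure_map_pmf[symmetric])
    also have "\<dots> = type_weight t / ?W" unfolding dist[OF i] by (rule measure_type_pmf_singleton[OF t])
    finally show ?thesis .
  qed
  have indepN: "prob_space.indep_vars (measure_pmf P) (\<lambda>_. count_space UNIV) (\<lambda>i \<omega>. ?N (Y i \<omega>)) ?I"
    by (rule prob_space.indep_vars_compose2[OF prob_space_measure_pmf indep]) simp
  have part: "measure P {\<omega> \<in> space P. C \<omega>} =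
      (\<Sum>s\<in>{s \<in> type_maps r. D s}. \<Prod>p\<in>UNIV. type_weight (s p)) / ?W ^ card (UNIV :: 'a option set)"
    if D: "\<And>\<omega> s. (\<And>p. ?N (Y (b p) \<omega>) = s p) \<Longrightarrow> C \<omega> \<longleftrightarrow> D s" for C and D :: "('a option \<Rightarrow> nat \<times> 'a) \<Rightarrow> bool"
  proof -
    have "measure P {\<omega> \<in> space P. C \<omega>} =
      (\<Sum>s\<in>{s \<in> PiE UNIV (\<lambda>_. local_types r). D s}. \<Prod>p\<in>UNIV. measure P {\<omega> \<in> space P. ?N (Y (b p) \<omega>) = s p})"
    proof (rule prob_space.prob_partition[OF prob_space_measure_pmf])
      show "finite (UNIV :: 'a option set)" by simp
      show "finite (local_types r :: (nat \<times> 'a) set)" by (rule finite_local_types)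
      show "{\<omega> \<in> space P. ?N (Y (b p) \<omega>) = t} \<in> sets (measure_pmf P)" for p t by simp
      show "(\<Sum>t\<in>local_types r. measure P {\<omega> \<in> space P. ?N (Y (b p) \<omega>) = t}) = 1" for p
      proof -
        have "(\<Sum>t\<in>local_types r. measure P {\<omega> \<in> space P. ?N (Y (b p) \<omega>) = t}) = (\<Sum>t\<in>(local_types r :: (nat \<times> 'a) set). type_weight t / ?W)"
          by (intro sum.cong refl single[OF bI])
        then show ?thesis using total_type_weight_pos[OF r1, where 'a='a] by (simp add: sum_divide_distrib[symmetric])
      qed
      show "measure P {\<omega> \<in> space P. \<forall>p\<in>UNIV. ?N (Y (b p) \<omega>) = s p} =
          (\<Prod>p\<in>UNIV. measure P {\<omega> \<in> space P. ?N (Y (b p) \<omega>) = s p})" for s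
      proof -
        define c where "c = the_inv_into UNIV b"
        have c: "c (b p) = p" for p unfolding c_def using b by (intro the_inv_into_f_f) (auto simp: bij_betw_def)
        let ?E = "\<lambda>i. (\<lambda>\<omega>. ?N (Y i \<omega>)) -` {s (c i)} \<inter> space P"
        have "measure P (\<Inter>i\<in>?I. ?E i) = (\<Prod>i\<in>?I. measure P (?E i))"
          by (rule prob_space.indep_varsD_finite[OF prob_space_measure_pmf indepN]) auto
        also have "\<dots> = (\<Prod>p\<in>UNIV. measure P (?E (b p)))" by (rule prod.reindex_bij_betw[OF b, symmetric])
        also have "\<dots> = (\<Prod>p\<in>UNIV. measure P {\<omega> \<in> space P. ?N (Y (b p) \<omega>) = s p})"
          by (intro prod.cong refl arg_cong[of _ _ "measure P"]) (auto simp: c)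
        also have "(\<Inter>i\<in>?I. ?E i) = {\<omega> \<in> space P. \<forall>p\<in>UNIV. ?N (Y (b p) \<omega>) = s p}"
        proof (intro equalityI subsetI)
          fix \<omega> assume \<omega>: "\<omega> \<in> (\<Inter>i\<in>?I. ?E i)"
          have "?N (Y (b p) \<omega>) = s p" for p
          proof -
            have "\<omega> \<in> ?E (b p)" using \<omega> bI[of p] by (rule INT_D)
            then show ?thesis by (simp add: c)
          qed
          then show "\<omega> \<in> {\<omega> \<in> space P. \<forall>p\<in>UNIV. ?N (Y (b p) \<omega>) = s p}" by simp
        next
          fix \<omega> assume \<omega>: "\<omega> \<in> {\<omega> \<in> space P. \<forall>p\<in>UNIV. ?N (Y (b p) \<omega>) = s p}"
          show "\<omega> \<in> (\<Inter>i\<in>?I. ?E i)"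
          proof (rule INT_I)
            fix i assume "i \<in> ?I"
            then obtain p where "i = b p" using b unfolding bij_betw_def by blast
            then show "\<omega> \<in> ?E i" using \<omega> by (simp add: c)
          qed
        qed
        finally show ?thesis .
      qed
      show "{\<omega> \<in> space P. C \<omega>} \<in> sets (measure_pmf P)" by simp
      show "C \<omega> \<longleftrightarrow> D s" if "\<And>p. p \<in> UNIV \<Longrightarrow> ?N (Y (b p) \<omega>) = s p" for \<omega> s using D that by simp
    qed
    also have "\<dots> = (\<Sum>s\<in>{s \<in> type_maps r. D s}. \<Prod>p\<in>UNIV. type_weight (s p) / ?W)"
      unfolding type_maps_def by (intro sum.cong prod.cong refl single[OF bI]) (auto simp: PiE_iff)
    also have "\<dots> = (\<Sum>s\<in>{s \<in> type_maps r. D s}. \<Prod>p\<in>UNIV. type_weight (s p)) / ?W ^ card (UNIV :: 'a option set)"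
      unfolding sum_divide_distrib by (simp add: prod_dividef)
    finally show ?thesis .
  qed
  have "?prob = ?num / ?W ^ card (UNIV :: 'a option set)"
  proof (rule part)
    fix \<omega> s assume s: "\<And>p. ?N (Y (b p) \<omega>) = s p"
    have "(\<Sum>i=1..CARD('a)+1. limit_value chi d (?N (Y i \<omega>))) = (\<Sum>p\<in>UNIV. limit_value chi d (s p))" for d
      unfolding s[symmetric] by (rule sum.reindex_bij_betw[OF b, symmetric])
    then show "(\<forall>d. d dvd r \<and> d \<noteq> 1 \<longrightarrow> (\<Sum>i=1..CARD('a)+1. limit_value chi d (?N (Y i \<omega>))) = M d) \<longleftrightarrow> type_sum_cond r chi M s"
      unfolding type_sum_cond_def by (simp only:)
  qed
  \<comment> \<open>The same formula for the sure event identifies the denominator as the power of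
    the total weight of one point.\<close>
  moreover have "1 = ?den / ?W ^ card (UNIV :: 'a option set)"
    using part[of "\<lambda>_. True" "\<lambda>_. True"] measure_pmf.prob_space[of P] by (simp only: simp_thms Collect_mem_eq)
  moreover have "?W ^ card (UNIV :: 'a option set) \<noteq> 0" using total_type_weight_pos[OF r1, where 'a='a] by simp
  ultimately show ?thesis by (simp add: field_simps)
qed

text \<open>The sample space is fixed as a type of complex-valued functions, so types are encoded as
  functions on \<open>nat\<close>. The product distribution of the encoded types, decoded
  coordinatewise, gives the independent variables.\<close>

lemma model_exists:
  "\<exists>(P :: (nat \<Rightarrow> nat \<Rightarrow> complex) pmf) Y :: nat \<Rightarrow> (nat \<Rightarrow> nat \<Rightarrow> complex) \<Rightarrow> nat \<times> 'a.
    prob_space.indep_vars (measure_pmf P) (\<lambda>_. count_space UNIV) Y {1..CARD('a) + 1} \<and>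
    (\<forall>i\<in>{1..CARD('a) + 1}. map_pmf (Y i) P = type_pmf r)"
proof -
  let ?I = "{1..CARD('a) + 1}"
  obtain f :: "'a \<Rightarrow> nat" where f: "inj f"
    using finite_imp_inj_to_nat_seg[of "UNIV :: 'a set"] by auto
  \<comment> \<open>Coordinate 0 holds the index and every other coordinate the number of the unit,
    so coordinates 0 and 1 determine the type.\<close>
  define enc :: "nat \<times> 'a \<Rightarrow> nat \<Rightarrow> complex" where "enc t n = of_nat (if n = 0 then fst t else f (snd t))" for t n
  have "inj enc"
  proof (rule injI)
    fix s t assume eq: "enc s = enc t"
    have "fst s = fst t" "f (snd s) = f (snd t)" using fun_cong[OF eq, of 0] fun_cong[OF eq, of 1] by (auto simp: enc_def)
    then show "s = t" using f by (simp add: prod_eq_iff inj_eq)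
  qed
  then have dec: "inv enc (enc t) = t" for t by (rule inv_f_f)
  define P where "P = Pi_pmf ?I undefined (\<lambda>_. map_pmf enc (type_pmf r))"
  have "prob_space.indep_vars (measure_pmf P) (\<lambda>_. count_space UNIV) (\<lambda>i \<omega>. inv enc (\<omega> i)) ?I"
    unfolding P_def
    by (rule prob_space.indep_vars_compose2[OF prob_space_measure_pmf indep_vars_Pi_pmf]) auto
  moreover have "map_pmf (\<lambda>\<omega>. inv enc (\<omega> i)) P = type_pmf r" if "i \<in> ?I" for i
  proof -
    have "map_pmf (\<lambda>\<omega>. inv enc (\<omega> i)) P = map_pmf (inv enc) (map_pmf (\<lambda>\<omega>. \<omega> i) P)"
      by (simp add: pmf.map_comp o_def)
    also have "map_pmf (\<lambda>\<omega>. \<omega> i) P = map_pmf enc (type_pmf r)"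
      unfolding P_def using that by (subst Pi_pmf_component) auto
    also have "map_pmf (inv enc) (map_pmf enc (type_pmf r)) = type_pmf r"
      by (simp add: pmf.map_comp o_def dec)
    finally show ?thesis .
  qed
  ultimately show ?thesis by blast
qed

end

theorem theorem1p2:
  fixes q r :: nat and chi :: "nat \<Rightarrow> 'a::{field,finite} \<Rightarrow> complex"
  assumes "CARD('a) = q" and "r \<ge> 2" and "[q = 1] (mod r)"
    and "character_system r chi"
  shows "(\<exists>(P :: (nat \<Rightarrow> nat \<Rightarrow> complex) measure) X. limit_variables q r P X) \<and>
    (\<forall>(P :: 'b measure) X M.
       limit_variables q r P X \<longrightarrow>
       (\<forall>d. d dvd r \<and> d \<noteq> 1 \<longrightarrow> M d \<in> cyclotomic_ring d) \<longrightarrow>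
       (\<lambda>ds. real (card {F \<in> F_hat_full r ds.
                          \<forall>d. d dvd r \<and> d \<noteq> 1 \<longrightarrow> char_sum r ds chi d F = M d}) /
             real (card (F_hat_full r ds :: 'a poly set)))
         \<sim>[degrees_at_top r]
       (\<lambda>_. \<P>(\<omega> in P. \<forall>d. d dvd r \<and> d \<noteq> 1 \<longrightarrow> (\<Sum>i=1..q+1. X d i \<omega>) = M d)))"
proof -
  interpret compatible_characters r chi by unfold_locales (fact assms)+
  obtain P\<^sub>0 :: "(nat \<Rightarrow> nat \<Rightarrow> complex) pmf" and Y :: "nat \<Rightarrow> (nat \<Rightarrow> nat \<Rightarrow> complex) \<Rightarrow> nat \<times> 'a"
    where indep: "prob_space.indep_vars (measure_pmf P\<^sub>0) (\<lambda>_. count_space UNIV) Y {1..CARD('a) + 1}"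
      and dist: "\<And>i. i \<in> {1..CARD('a) + 1} \<Longrightarrow> map_pmf (Y i) P\<^sub>0 = type_pmf r"
    using model_exists by blast
  define X\<^sub>0 where "X\<^sub>0 d i \<omega> = limit_value chi d (normalize_type r (Y i \<omega>))" for d i \<omega>
  have model: "limit_variables CARD('a) r (measure_pmf P\<^sub>0) X\<^sub>0"
    using limit_variables_model[OF indep dist] unfolding X\<^sub>0_def .
  \<comment> \<open>Normalisation makes this hold at every sample point, as the uniqueness argument
    requires of the family with known values.\<close>
  have types: "(\<lambda>d\<in>{d. d dvd r}. X\<^sub>0 d i \<omega>) \<in> type_vector ` local_types r" for i \<omega>
    unfolding X\<^sub>0_def type_vector_def[symmetric] using normalize_type_in[OF r1] by (rule imageI)
  show ?thesis
  proof (intro conjI allI impI)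
    show "\<exists>(P :: (nat \<Rightarrow> nat \<Rightarrow> complex) measure) X. limit_variables q r P X"
      using model assms(1) by blast
    fix P :: "'b measure" and X M
    assume "limit_variables q r P X"
    then have L: "limit_variables CARD('a) r P X" using assms(1) by simp
    have "\<P>(\<omega> in P. \<forall>d. d dvd r \<and> d \<noteq> 1 \<longrightarrow> (\<Sum>i=1..CARD('a)+1. X d i \<omega>) = M d) =
        \<P>(\<omega> in measure_pmf P\<^sub>0. \<forall>d. d dvd r \<and> d \<noteq> 1 \<longrightarrow> (\<Sum>i=1..CARD('a)+1. X\<^sub>0 d i \<omega>) = M d)"
      by (rule limit_variables_prob_unique[OF L model types])
    also have "\<dots> = (\<Sum>t\<in>{t \<in> type_maps r. type_sum_cond r chi M t}. \<Prod>p\<in>UNIV. type_weight (t p)) /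
       (\<Sum>t\<in>(type_maps r :: ('a option \<Rightarrow> nat \<times> 'a) set). \<Prod>p\<in>UNIV. type_weight (t p))"
      unfolding X\<^sub>0_def by (rule prob_sums_model[OF indep dist])
    finally show "(\<lambda>ds. real (card {F \<in> F_hat_full r ds.
                          \<forall>d. d dvd r \<and> d \<noteq> 1 \<longrightarrow> char_sum r ds chi d F = M d}) /
             real (card (F_hat_full r ds :: 'a poly set)))
         \<sim>[degrees_at_top r]
       (\<lambda>_. \<P>(\<omega> in P. \<forall>d. d dvd r \<and> d \<noteq> 1 \<longrightarrow> (\<Sum>i=1..q+1. X d i \<omega>) = M d))"
      using char_sum_distribution[OF assms(2,4), of M] assms(1) by (simp only:)
  qed
qed

end
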